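(* Let $a\in C[0,1]$ with $a\ge0$, $T>0$, $w^0\in H^1_0(0,1)$, $w^1\in L^2(0,1)$, $g\in L^2(0,T;L^2(0,1))$. For each $N\ge1$ let $W_h=[w_j]_{1\le j\le N}$ solve $M_hW_h''+K_hW_h+L_hW_h=M_hG_h(t)$ on $(0,T)$, $W_h(0)=W_h^0$, $W_h'(0)=W_h^1$ (data as in the context), and let $w$ be the unique weak solution described in the context. Then, as $h\to0$, $$\frac{w_1(\cdot)}h\to w_x(\cdot,0)\quad\text{and}\quad w_1'(\cdot)\to0\quad\text{in }L^2(0,T).$$
   Context: $h=1/(N+1)$, $x_j=jh$, $a_j=a(x_j)$; $K_h=\frac1h\mathrm{tridiag}(-1,2,-1)$, $M_h=\frac h4\mathrm{tridiag}(1,2,1)$, $L_h=h\,\mathrm{diag}(a_1,\dots,a_N)$. Discrete data: $W_h^0=[w^0(x_j)]_j$; $W_h^1=hM_h^{-1}[\frac1{2h}\int_{x_{j-1}}^{x_{j+1}}w^1dx]_j$; $G_h(t)=hM_h^{-1}[\frac1{2h}\int_{x_{j-1}}^{x_{j+1}}g(t,x)dx]_j$. $w\in C([0,T];H^1_0(0,1))\cap C^1([0,T];L^2(0,1))$ is the unique weak solution of $w''-w_{xx}+aw=g$ on $(0,T)\times(0,1)$, $w(t,0)=w(t,1)=0$, $w(0)=w^0$, $w'(0)=w^1$, i.e. $-\int_0^T(w',\varphi)_{L^2}p'+\int_0^T(w,\varphi)_{H^1_0}p+\int_0^T(aw,\varphi)_{L^2}p=\int_0^T(g,\varphi)_{L^2}p$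 for all $\varphi\in H^1_0$, $p\in C_c^\infty(0,T)$, with $(u,v)_{H^1_0}=\int_0^1u_x\overline{v_x}$; $w_x(t,0)$ denotes the boundary normal derivative, which belongs to $L^2(0,T)$. *)

theory Defs
  imports "HOL-Analysis.Analysis"
begin

definition L2on :: "real set \<Rightarrow> (real \<Rightarrow> complex) \<Rightarrow> bool" where
  "L2on S f \<longleftrightarrow> f \<in> borel_measurable (lebesgue_on S)
      \<and> integrable (lebesgue_on S) (\<lambda>x. (cmod (f x))^2)"

definition L2norm2 :: "real set \<Rightarrow> (real \<Rightarrow> complex) \<Rightarrow> real" where
  "L2norm2 S f = integral\<^sup>L (lebesgue_on S) (\<lambda>x. (cmod (f x))^2)"

definition L2ip :: "(real \<Rightarrow> complex) \<Rightarrow> (real \<Rightarrow> complex) \<Rightarrow> complex" where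
  "L2ip u v = integral\<^sup>L (lebesgue_on {0..1}) (\<lambda>x. u x * cnj (v x))"

text \<open>u (its continuous representative) lies in H^1(0,1) with weak derivative ux.\<close>
definition H1 :: "(real \<Rightarrow> complex) \<Rightarrow> (real \<Rightarrow> complex) \<Rightarrow> bool" where
  "H1 u ux \<longleftrightarrow> L2on {0..1} ux
      \<and> (\<forall>x\<in>{0..1}. u x = u 0 + integral\<^sup>L (lebesgue_on {0..x}) ux)"

definition H10 :: "(real \<Rightarrow> complex) \<Rightarrow> (real \<Rightarrow> complex) \<Rightarrow> bool" where
  "H10 u ux \<longleftrightarrow> H1 u ux \<and> u 0 = 0 \<and> u 1 = 0"

definition in_H10 :: "(real \<Rightarrow> complex) \<Rightarrow> bool" where
  "in_H10 u \<longleftrightarrow> (\<exists>ux. H10 u ux)"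

definition L2_time_space :: "real \<Rightarrow> (real \<Rightarrow> real \<Rightarrow> complex) \<Rightarrow> bool" where
  "L2_time_space T g \<longleftrightarrow>
     (\<lambda>p. g (fst p) (snd p)) \<in> borel_measurable (lebesgue_on ({0..T} \<times> {0..1}))
     \<and> integrable (lebesgue_on ({0..T} \<times> {0..1})) (\<lambda>p. (cmod (g (fst p) (snd p)))^2)"

definition test_fun :: "real \<Rightarrow> (real \<Rightarrow> real) \<Rightarrow> bool" where
  "test_fun T p \<longleftrightarrow> (\<forall>k. \<forall>t. ((deriv ^^ k) p) differentiable (at t))
      \<and> (\<exists>c d. 0 < c \<and> d < T \<and> (\<forall>t. t \<notin> {c..d} \<longrightarrow> p t = 0))"

text \<open>w is the weak solution of w'' - w_xx + a w = g, w(t,0)=w(t,1)=0, w(0)=w0, w'(0)=w1,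
  with w in C([0,T];H^1_0) \<inter> C^1([0,T];L^2); wx is its spatial derivative and wt its time
  derivative (in L^2(0,1)).\<close>
definition weak_solution ::
  "(real \<Rightarrow> real) \<Rightarrow> real \<Rightarrow> (real \<Rightarrow> real \<Rightarrow> complex) \<Rightarrow> (real \<Rightarrow> complex) \<Rightarrow> (real \<Rightarrow> complex)
   \<Rightarrow> (real \<Rightarrow> real \<Rightarrow> complex) \<Rightarrow> (real \<Rightarrow> real \<Rightarrow> complex) \<Rightarrow> (real \<Rightarrow> real \<Rightarrow> complex) \<Rightarrow> bool" where
  "weak_solution a T g w0 w1 w wx wt \<longleftrightarrow>
     (\<forall>t\<in>{0..T}. H10 (w t) (wx t) \<and> L2on {0..1} (wt t))
   \<and> (\<forall>t\<in>{0..T}. ((\<lambda>s. L2norm2 {0..1} (\<lambda>x. wx s x - wx t x)) \<longlongrightarrow> 0) (at t within {0..T}))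
   \<and> (\<forall>t\<in>{0..T}. ((\<lambda>s. L2norm2 {0..1} (\<lambda>x. (w s x - w t x) / complex_of_real (s - t) - wt t x))
                      \<longlongrightarrow> 0) (at t within {0..T}))
   \<and> (\<forall>t\<in>{0..T}. ((\<lambda>s. L2norm2 {0..1} (\<lambda>x. wt s x - wt t x)) \<longlongrightarrow> 0) (at t within {0..T}))
   \<and> (\<forall>x\<in>{0..1}. w 0 x = w0 x)
   \<and> L2norm2 {0..1} (\<lambda>x. wt 0 x - w1 x) = 0
   \<and> (\<forall>\<phi> \<phi>x p. H10 \<phi> \<phi>x \<longrightarrow> test_fun T p \<longrightarrow>
        - integral\<^sup>L (lebesgue_on {0..T}) (\<lambda>t. L2ip (wt t) \<phi> * complex_of_real (deriv p t))
        + integral\<^sup>L (lebesgue_on {0..T}) (\<lambda>t. L2ip (wx t) \<phi>x * complex_of_real (p t))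
        + integral\<^sup>L (lebesgue_on {0..T}) (\<lambda>t. L2ip (\<lambda>x. complex_of_real (a x) * w t x) \<phi>
                                               * complex_of_real (p t))
      = integral\<^sup>L (lebesgue_on {0..T}) (\<lambda>t. L2ip (g t) \<phi> * complex_of_real (p t)))"

text \<open>psi is the boundary normal derivative w_x(.,0) in L^2(0,T), characterised by Green's
  formula: for test functions phi in H^1(0,1) with phi(1)=0 (not necessarily vanishing at 0),
  (w'',phi) + (w_x,phi_x) + w_x(t,0) conj(phi(0)) + (a w,phi) = (g,phi) in D'(0,T).\<close>
definition normal_derivative_at_0 ::
  "(real \<Rightarrow> real) \<Rightarrow> real \<Rightarrow> (real \<Rightarrow> real \<Rightarrow> complex)
   \<Rightarrow> (real \<Rightarrow> real \<Rightarrow> complex) \<Rightarrow> (real \<Rightarrow> real \<Rightarrow> complex) \<Rightarrow> (real \<Rightarrow> real \<Rightarrow> complex)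
   \<Rightarrow> (real \<Rightarrow> complex) \<Rightarrow> bool" where
  "normal_derivative_at_0 a T g w wx wt \<psi> \<longleftrightarrow> L2on {0..T} \<psi>
   \<and> (\<forall>\<phi> \<phi>x p. H1 \<phi> \<phi>x \<longrightarrow> \<phi> 1 = 0 \<longrightarrow> test_fun T p \<longrightarrow>
        - integral\<^sup>L (lebesgue_on {0..T}) (\<lambda>t. L2ip (wt t) \<phi> * complex_of_real (deriv p t))
        + integral\<^sup>L (lebesgue_on {0..T}) (\<lambda>t. L2ip (wx t) \<phi>x * complex_of_real (p t))
        + integral\<^sup>L (lebesgue_on {0..T}) (\<lambda>t. L2ip (\<lambda>x. complex_of_real (a x) * w t x) \<phi>
                                               * complex_of_real (p t))
        + integral\<^sup>L (lebesgue_on {0..T}) (\<lambda>t. \<psi> t * cnj (\<phi> 0) * complex_of_real (p t))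
      = integral\<^sup>L (lebesgue_on {0..T}) (\<lambda>t. L2ip (g t) \<phi> * complex_of_real (p t)))"

definition mesh :: "nat \<Rightarrow> real" where "mesh N = 1 / (real N + 1)"
definition node :: "nat \<Rightarrow> nat \<Rightarrow> real" where "node N j = real j * mesh N"

text \<open>Vectors in C^N are functions nat => complex, indices 1..N; extension by zero.\<close>
definition ext0 :: "nat \<Rightarrow> (nat \<Rightarrow> complex) \<Rightarrow> nat \<Rightarrow> complex" where
  "ext0 N v j = (if 1 \<le> j \<and> j \<le> N then v j else 0)"

definition Kh :: "nat \<Rightarrow> (nat \<Rightarrow> complex) \<Rightarrow> nat \<Rightarrow> complex" where
  "Kh N v j = complex_of_real (1 / mesh N) *
     (2 * ext0 N v j - ext0 N v (j - 1) - ext0 N v (j + 1))"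

definition Mh :: "nat \<Rightarrow> (nat \<Rightarrow> complex) \<Rightarrow> nat \<Rightarrow> complex" where
  "Mh N v j = complex_of_real (mesh N / 4) *
     (ext0 N v (j - 1) + 2 * ext0 N v j + ext0 N v (j + 1))"

definition Lh :: "(real \<Rightarrow> real) \<Rightarrow> nat \<Rightarrow> (nat \<Rightarrow> complex) \<Rightarrow> nat \<Rightarrow> complex" where
  "Lh a N v j = complex_of_real (mesh N * a (node N j)) * ext0 N v j"

text \<open>(1/2) int_{x_{j-1}}^{x_{j+1}} f dx = h * (1/(2h)) int ... ; this is the j-th entry of
  M_h W_h^1 (for f = w1) resp. of M_h G_h(t) (for f = g(t,.)).\<close>
definition half_cell_int :: "nat \<Rightarrow> (real \<Rightarrow> complex) \<Rightarrow> nat \<Rightarrow> complex" where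
  "half_cell_int N f j = integral\<^sup>L (lebesgue_on {node N (j - 1) .. node N (j + 1)}) f / 2"

text \<open>W (with derivative V) is the (Caratheodory) solution on [0,T] of
  M_h W'' + K_h W + L_h W = M_h G_h(t), W(0)=W_h^0, W'(0)=W_h^1:
  W is C^1 with W' = V and M_h V(t) = M_h W_h^1 + int_0^t (M_h G_h - K_h W - L_h W) ds.\<close>
definition discrete_solution ::
  "(real \<Rightarrow> real) \<Rightarrow> real \<Rightarrow> (real \<Rightarrow> real \<Rightarrow> complex) \<Rightarrow> (real \<Rightarrow> complex) \<Rightarrow> (real \<Rightarrow> complex)
   \<Rightarrow> nat \<Rightarrow> (real \<Rightarrow> nat \<Rightarrow> complex) \<Rightarrow> (real \<Rightarrow> nat \<Rightarrow> complex) \<Rightarrow> bool" where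
  "discrete_solution a T g w0 w1 N W V \<longleftrightarrow>
     (\<forall>j\<in>{1..N}. \<forall>t\<in>{0..T}. ((\<lambda>s. W s j) has_vector_derivative V t j) (at t within {0..T}))
   \<and> (\<forall>j\<in>{1..N}. continuous_on {0..T} (\<lambda>s. V s j))
   \<and> (\<forall>j\<in>{1..N}. W 0 j = w0 (node N j))
   \<and> (\<forall>j\<in>{1..N}. Mh N (V 0) j = half_cell_int N w1 j)
   \<and> (\<forall>j\<in>{1..N}. \<forall>t\<in>{0..T}.
        integrable (lebesgue_on {0..t})
          (\<lambda>s. half_cell_int N (g s) j - Kh N (W s) j - Lh a N (W s) j)
      \<and> Mh N (V t) j - Mh N (V 0) j =
        integral\<^sup>L (lebesgue_on {0..t})
          (\<lambda>s. half_cell_int N (g s) j - Kh N (W s) j - Lh a N (W s) j))"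

end

theory Submission
  imports Defs "HOL-Computational_Algebra.Polynomial" "HOL-Real_Asymp.Real_Asymp"
begin

text \<open>
  The multiplier \<open>(1 - x\<^sub>j) (w\<^sub>j\<^sub>+\<^sub>1 - w\<^sub>j\<^sub>-\<^sub>1) / (2h)\<close> gives for this scheme an exact discrete analogue of the
  identity behind hidden regularity: the square of the \<open>L\<^sup>2(0,T)\<close> norm of \<open>w\<^sub>1 / h\<close> plus a quarter of that of \<open>w\<^sub>1'\<close>
  is bounded, uniformly in \<open>h\<close>, by the initial energy and the sources.
  This is applied to the difference of the discrete solution and the nodal values of the truncated sine
  series of \<open>w\<close>, whose coefficients satisfy scalar equations driven by \<open>g - a w\<close>. Discrete sine vectors are
  eigenvectors of both matrices, so for a fixed truncation \<open>n\<close> the consistency error vanishes as \<open>h \<rightarrow> 0\<close>; the potential is merely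
  continuous, which makes its quadrature error small only in the maximum norm, and it is absorbed by
  integrating by parts in time. What remains is the tail of the Fourier series of the data. Hence the
  boundary fluxes of the truncated series form a Cauchy sequence; their limit is the normal derivative by Green's
  formula, and it is also the limit of \<open>w\<^sub>1 / h\<close>.
\<close>

section \<open>Square-integrable functions\<close>

text \<open>The mass matrix is h times a double average over neighbouring nodes, so it nearly
  annihilates the alternating vector (-1)^j. Uniformly in h, the energy controls cell means of the
  velocity but not its nodal values; a source is harmless when it enters as an average of cell
  values. This decides where each error goes. Half-cell integrals are such averages, so the series
  tails and, after division by the symbol of the half-cell integral, the eigenvalue defects are
  measured in L2. The quadrature error of the potential sits at the nodes and meets nodal velocities
  in the energy identity; hence the time derivative has to be moved onto it.

  The term \<open>a w\<close> counts as a source so that the sine modes decouple. The weight 1 - x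
  vanishes at the right end, so only the flux at 0 survives; the velocity vanishes at node 0, its
  mean in the first cell is w_1'/2, whence the factor one quarter. No trace estimate for the
  continuous problem enters: truncated fluxes are compared with each other through a common discrete
  trace on a fine mesh.\<close>

definition sqint :: "'a measure \<Rightarrow> ('a \<Rightarrow> complex) \<Rightarrow> bool" where
  "sqint M f \<longleftrightarrow> f \<in> borel_measurable M \<and> integrable M (\<lambda>x. (cmod (f x))\<^sup>2)"

text \<open>Square integrability is developed over an arbitrary measure because the product measure
  on the time-space rectangle is needed as well as intervals.\<close>

lemma L2on_iff_sqint: "L2on S f \<longleftrightarrow> sqint (lebesgue_on S) f"
  by (simp add: L2on_def sqint_def)

lemma sqint_integrable_norm2: "sqint M f \<Longrightarrow> integrable M (\<lambda>x. (cmod (f x))\<^sup>2)"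
  by (simp add: sqint_def)

lemma cmod_mult_le: "cmod (z * w) \<le> (cmod z)\<^sup>2 + (cmod w)\<^sup>2"
proof -
  have "2 * (cmod z * cmod w) \<le> (cmod z)\<^sup>2 + (cmod w)\<^sup>2"
    using sum_squares_bound[of "cmod z" "cmod w"] by simp
  moreover have "0 \<le> cmod z * cmod w" by simp
  ultimately show ?thesis unfolding norm_mult by linarith
qed

lemma cmod_add_sq_le: "(cmod (z + w))\<^sup>2 \<le> 2 * (cmod z)\<^sup>2 + 2 * (cmod w)\<^sup>2"
proof -
  have "(cmod (z + w))\<^sup>2 \<le> (cmod z + cmod w)\<^sup>2"
    by (simp add: norm_triangle_ineq power_mono)
  also have "\<dots> \<le> 2 * (cmod z)\<^sup>2 + 2 * (cmod w)\<^sup>2"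
    using sum_squares_bound[of "cmod z" "cmod w"] by (simp add: power2_sum)
  finally show ?thesis .
qed

lemma sqint_integrable_mult:
  assumes "sqint M f" "sqint M g"
  shows "integrable M (\<lambda>x. f x * g x)"
proof (rule Bochner_Integration.integrable_bound)
  show "integrable M (\<lambda>x. (cmod (f x))\<^sup>2 + (cmod (g x))\<^sup>2)"
    using assms by (auto simp: sqint_def)
  show "(\<lambda>x. f x * g x) \<in> borel_measurable M"
    using assms by (auto simp: sqint_def)
  show "AE x in M. norm (f x * g x) \<le> norm ((cmod (f x))\<^sup>2 + (cmod (g x))\<^sup>2)"
    using cmod_mult_le by auto
qed

lemma sqint_dominated:
  assumes "f \<in> borel_measurable M" "integrable M g" "AE x in M. (cmod (f x))\<^sup>2 \<le> g x"
  shows "sqint M f"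
  unfolding sqint_def
proof
  show "integrable M (\<lambda>x. (cmod (f x))\<^sup>2)"
    by (rule Bochner_Integration.integrable_bound[OF assms(2)]) (use assms in auto)
qed fact

lemma sqint_add [intro]:
  assumes "sqint M f" "sqint M g"
  shows "sqint M (\<lambda>x. f x + g x)"
  by (rule sqint_dominated[where g = "\<lambda>x. 2 * (cmod (f x))\<^sup>2 + 2 * (cmod (g x))\<^sup>2"])
    (use assms cmod_add_sq_le in \<open>auto simp: sqint_def\<close>)

lemma sqint_cmult [intro]: "sqint M f \<Longrightarrow> sqint M (\<lambda>x. c * f x)"
  by (auto simp: sqint_def norm_mult power_mult_distrib)

lemma sqint_uminus [intro]: "sqint M f \<Longrightarrow> sqint M (\<lambda>x. - f x)"
  by (auto simp: sqint_def)

lemma sqint_diff [intro]: "sqint M f \<Longrightarrow> sqint M g \<Longrightarrow> sqint M (\<lambda>x. f x - g x)"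
  using sqint_add[of M f "\<lambda>x. - g x"] by auto

lemma borel_measurable_cnj [measurable]: "cnj \<in> borel_measurable borel"
  by (intro borel_measurable_continuous_onI continuous_intros)

lemma sqint_cnj [intro]: "sqint M f \<Longrightarrow> sqint M (\<lambda>x. cnj (f x))"
  by (auto simp: sqint_def intro: measurable_compose[OF _ borel_measurable_cnj])

lemma sqint_zero [intro, simp]: "sqint M (\<lambda>x. 0)"
  by (auto simp: sqint_def)

lemma sqint_sum [intro]: "(\<And>i. i \<in> I \<Longrightarrow> sqint M (f i)) \<Longrightarrow> sqint M (\<lambda>x. \<Sum>i\<in>I. f i x)"
  by (induction I rule: infinite_finite_induct) auto

lemma sqint_norm2_add_le:
  assumes "sqint M f" "sqint M g"
  shows "(\<integral>x. (cmod (f x + g x))\<^sup>2 \<partial>M) \<le> 2 * (\<integral>x. (cmod (f x))\<^sup>2 \<partial>M) + 2 * (\<integral>x. (cmod (g x))\<^sup>2 \<partial>M)"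
proof -
  have "(\<integral>x. (cmod (f x + g x))\<^sup>2 \<partial>M) \<le> (\<integral>x. 2 * (cmod (f x))\<^sup>2 + 2 * (cmod (g x))\<^sup>2 \<partial>M)"
    using assms sqint_add[OF assms] cmod_add_sq_le
    by (intro integral_mono) (auto simp: sqint_def)
  also have "\<dots> = 2 * (\<integral>x. (cmod (f x))\<^sup>2 \<partial>M) + 2 * (\<integral>x. (cmod (g x))\<^sup>2 \<partial>M)"
    using assms by (auto simp: sqint_def)
  finally show ?thesis .
qed

text \<open>Reduces to the inequality for nonnegative integrals of the moduli. No conjugate appears,
  so the sesquilinear version follows by inserting \<open>cnj\<close> into one factor.\<close>

lemma Cauchy_Schwarz_sqint:
  assumes f: "sqint M f" and g: "sqint M g"
  shows "(cmod (\<integral>x. f x * g x \<partial>M))\<^sup>2 \<le> (\<integral>x. (cmod (f x))\<^sup>2 \<partial>M) * (\<integral>x. (cmod (g x))\<^sup>2 \<partial>M)"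
proof -
  have [measurable]: "f \<in> borel_measurable M" "g \<in> borel_measurable M"
    using f g by (auto simp: sqint_def)
  have "ennreal (cmod (\<integral>x. f x * g x \<partial>M)) \<le> (\<integral>\<^sup>+x. ennreal (norm (f x * g x)) \<partial>M)"
    by (rule integral_norm_bound_ennreal[OF sqint_integrable_mult[OF f g]])
  also have "\<dots> = (\<integral>\<^sup>+x. ennreal (cmod (f x)) * ennreal (cmod (g x)) \<partial>M)"
    by (simp add: norm_mult ennreal_mult)
  finally have "(ennreal (cmod (\<integral>x. f x * g x \<partial>M)))\<^sup>2 \<le> (\<integral>\<^sup>+x. ennreal (cmod (f x)) * ennreal (cmod (g x)) \<partial>M)\<^sup>2"
    by (simp add: power_mono)
  also have "\<dots> \<le> (\<integral>\<^sup>+x. (ennreal (cmod (f x)))\<^sup>2 \<partial>M) * (\<integral>\<^sup>+x. (ennreal (cmod (g x)))\<^sup>2 \<partial>M)"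
    by (rule Cauchy_Schwarz_nn_integral) auto
  also have "\<dots> = ennreal (\<integral>x. (cmod (f x))\<^sup>2 \<partial>M) * ennreal (\<integral>x. (cmod (g x))\<^sup>2 \<partial>M)"
    using f g by (simp add: ennreal_power nn_integral_eq_integral sqint_def)
  finally show ?thesis
    by (simp add: ennreal_power ennreal_mult[symmetric] integral_nonneg_AE)
qed

lemma (in finite_measure) sqint_const [intro, simp]: "sqint M (\<lambda>x. c)"
  by (auto simp: sqint_def)

lemma (in finite_measure) sqint_integrable: "sqint M f \<Longrightarrow> integrable M f"
  using sqint_integrable_mult[of M f "\<lambda>x. 1"] by auto

lemma (in finite_measure) L1_norm_le_sqint:
  assumes "sqint M f"
  shows "(\<integral>x. cmod (f x) \<partial>M)\<^sup>2 \<le> measure M (space M) * (\<integral>x. (cmod (f x))\<^sup>2 \<partial>M)"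
proof -
  have n: "sqint M (\<lambda>x. complex_of_real (cmod (f x)))"
    using assms by (auto simp: sqint_def)
  have "(cmod (\<integral>x. complex_of_real (cmod (f x)) * 1 \<partial>M))\<^sup>2
      \<le> (\<integral>x. (cmod (complex_of_real (cmod (f x))))\<^sup>2 \<partial>M) * (\<integral>x. (cmod 1)\<^sup>2 \<partial>M)"
    by (rule Cauchy_Schwarz_sqint[OF n]) auto
  then show ?thesis by (simp add: mult.commute)
qed

text \<open>Along a subsequence with squared distances below 4^-k the increments have L1 norms of
  order 2^-k, since the measure is finite; they are summable almost everywhere, which gives a
  pointwise limit. Fatou's lemma then upgrades it to the L2 limit of the whole sequence. This is
  what produces the normal derivative from the truncated fluxes.\<close>

theorem (in finite_measure) Riesz_Fischer:
  fixes \<phi> :: "nat \<Rightarrow> 'a \<Rightarrow> complex"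
  assumes sq: "\<And>n. sqint M (\<phi> n)"
    and cau: "\<And>e. e > 0 \<Longrightarrow> \<exists>N. \<forall>m\<ge>N. \<forall>n\<ge>N. (\<integral>x. (cmod (\<phi> n x - \<phi> m x))\<^sup>2 \<partial>M) < e"
  obtains \<psi> where "sqint M \<psi>" "(\<lambda>n. \<integral>x. (cmod (\<phi> n x - \<psi> x))\<^sup>2 \<partial>M) \<longlonglongrightarrow> 0"
proof -
  have meas[measurable]: "\<phi> n \<in> borel_measurable M" for n using sq by (auto simp: sqint_def)
  have "\<exists>s. \<forall>k. \<forall>m\<ge>s k. \<forall>n\<ge>s k. (\<integral>x. (cmod (\<phi> n x - \<phi> m x))\<^sup>2 \<partial>M) < (1/4)^k"
    using cau[of "(1/4)^k" for k] by (intro choice) auto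
  then obtain s where s: "\<And>k m n. m \<ge> s k \<Longrightarrow> n \<ge> s k \<Longrightarrow> (\<integral>x. (cmod (\<phi> n x - \<phi> m x))\<^sup>2 \<partial>M) < (1/4)^k"
    by blast
  \<comment> \<open>Partial sums of \<open>s\<close> dominate \<open>s\<close>, and the added
    \<open>k\<close> makes the indices strictly increasing.\<close>
  define r where "r k = (\<Sum>i\<le>k. s i) + k" for k
  have r_s: "r k \<ge> s k" for k unfolding r_def by (simp add: trans_le_add1 member_le_sum)
  have r_mono: "strict_mono r" unfolding strict_mono_Suc_iff r_def by simp
  have r_Suc: "r (Suc k) \<ge> s k" for k
    using r_s[of k] strict_monoD[OF r_mono, of k "Suc k"] by simp
  define D where "D k x = cmod (\<phi> (r (Suc k)) x - \<phi> (r k) x)" for k x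
  have D_int: "integrable M (D k)" for k
    unfolding D_def using sqint_integrable[OF sqint_diff[OF sq sq]] by auto
  have D_bd: "(\<integral>x. D k x \<partial>M) \<le> sqrt (measure M (space M)) * (1/2)^k" for k
  proof -
    have "(\<integral>x. D k x \<partial>M)\<^sup>2 \<le> measure M (space M) * (\<integral>x. (cmod (\<phi> (r (Suc k)) x - \<phi> (r k) x))\<^sup>2 \<partial>M)"
      unfolding D_def by (rule L1_norm_le_sqint) (auto intro: sq)
    also have "\<dots> \<le> measure M (space M) * (1/4)^k"
      using s[OF r_s r_Suc, of k] by (intro mult_left_mono) auto
    also have "\<dots> = (sqrt (measure M (space M)) * (1/2)^k)\<^sup>2"
      by (simp add: power_mult_distrib power_divide flip: power_mult) (simp add: power_mult mult.commute[of k])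
    finally show ?thesis by (rule power2_le_imp_le) auto
  qed
  have "(\<integral>\<^sup>+x. (\<Sum>k. ennreal (D k x)) \<partial>M) = (\<Sum>k. \<integral>\<^sup>+x. ennreal (D k x) \<partial>M)"
    using D_int by (intro nn_integral_suminf) auto
  also have "\<dots> = (\<Sum>k. ennreal (\<integral>x. D k x \<partial>M))"
    by (intro suminf_cong nn_integral_eq_integral D_int) (simp add: D_def)
  also have "\<dots> \<le> (\<Sum>k. ennreal (sqrt (measure M (space M)) * (1/2)^k))"
    using D_bd by (intro suminf_le) auto
  also have "\<dots> < top"
    by (subst suminf_ennreal2) (auto intro!: summable_mult summable_geometric)
  finally have fin: "(\<integral>\<^sup>+x. (\<Sum>k. ennreal (D k x)) \<partial>M) \<noteq> \<infinity>" by simp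
  have "AE x in M. (\<Sum>k. ennreal (D k x)) \<noteq> \<infinity>"
    by (rule nn_integral_PInf_AE[OF _ fin]) (use D_int in auto)
  then have conv: "AE x in M. convergent (\<lambda>k. \<phi> (r k) x)"
  proof eventually_elim
    case (elim x)
    have "summable (\<lambda>k. D k x)"
      using elim by (intro summable_suminf_not_top) (auto simp: D_def)
    then have "summable (\<lambda>k. \<phi> (r (Suc k)) x - \<phi> (r k) x)"
      unfolding D_def by (rule summable_norm_cancel)
    then have "convergent (\<lambda>n. \<Sum>k<n. \<phi> (r (Suc k)) x - \<phi> (r k) x)"
      by (simp add: summable_iff_convergent)
    then have "convergent (\<lambda>n. \<phi> (r n) x - \<phi> (r 0) x)"
      by (simp add: sum_lessThan_telescope[where f = "\<lambda>k. \<phi> (r k) x"])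
    then have "convergent (\<lambda>n. (\<phi> (r n) x - \<phi> (r 0) x) + \<phi> (r 0) x)"
      by (intro convergent_add convergent_const)
    then show ?case by simp
  qed
  define \<psi> where "\<psi> x = lim (\<lambda>k. \<phi> (r k) x)" for x
  have [measurable]: "\<psi> \<in> borel_measurable M" unfolding \<psi>_def by measurable
  have lim: "AE x in M. (\<lambda>k. \<phi> (r k) x) \<longlonglongrightarrow> \<psi> x"
    using conv by eventually_elim (simp add: \<psi>_def convergent_LIMSEQ_iff)
  \<comment> \<open>Fatou along the subsequence with \<open>n\<close> held fixed: all distances from
    \<open>\<phi> n\<close> to late members are already below (1/4)^k.\<close>
  have est: "(\<integral>\<^sup>+x. ennreal ((cmod (\<phi> n x - \<psi> x))\<^sup>2) \<partial>M) \<le> ennreal ((1/4)^k)" if "n \<ge> s k" for n k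
  proof -
    have "(\<integral>\<^sup>+x. ennreal ((cmod (\<phi> n x - \<psi> x))\<^sup>2) \<partial>M)
        = (\<integral>\<^sup>+x. liminf (\<lambda>i. ennreal ((cmod (\<phi> n x - \<phi> (r i) x))\<^sup>2)) \<partial>M)"
    proof (rule nn_integral_cong_AE, use lim in eventually_elim)
      case (elim x)
      have "(\<lambda>i. ennreal ((cmod (\<phi> n x - \<phi> (r i) x))\<^sup>2)) \<longlonglongrightarrow> ennreal ((cmod (\<phi> n x - \<psi> x))\<^sup>2)"
        by (intro tendsto_intros elim)
      then show ?case by (rule lim_imp_Liminf[symmetric, rotated]) simp
    qed
    also have "\<dots> \<le> liminf (\<lambda>i. \<integral>\<^sup>+x. ennreal ((cmod (\<phi> n x - \<phi> (r i) x))\<^sup>2) \<partial>M)"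
      by (rule nn_integral_liminf) auto
    also have "\<dots> \<le> ennreal ((1/4)^k)"
    proof (rule Liminf_le)
      show "\<forall>\<^sub>F i in sequentially. (\<integral>\<^sup>+x. ennreal ((cmod (\<phi> n x - \<phi> (r i) x))\<^sup>2) \<partial>M) \<le> ennreal ((1/4)^k)"
        using eventually_ge_at_top[of "s k"]
      proof eventually_elim
        case (elim i)
        then have "r i \<ge> s k" using seq_suble[OF r_mono, of i] by simp
        then have "(\<integral>x. (cmod (\<phi> n x - \<phi> (r i) x))\<^sup>2 \<partial>M) \<le> (1/4)^k"
          using s[of k "r i" n] that by simp
        then show ?case
          using sqint_integrable_norm2[OF sqint_diff[OF sq sq]] by (simp add: nn_integral_eq_integral)
      qed
    qed simp
    finally show ?thesis .
  qed
  have sqd: "sqint M (\<lambda>x. \<phi> n x - \<psi> x)" if "n \<ge> s 0" for n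
    unfolding sqint_def integrable_iff_bounded using est[OF that] by (auto intro: le_less_trans)
  have "sqint M (\<lambda>x. \<phi> (s 0) x - (\<phi> (s 0) x - \<psi> x))"
    by (intro sqint_diff sq sqd) auto
  then have psi: "sqint M \<psi>" by simp
  have "(\<lambda>n. \<integral>x. (cmod (\<phi> n x - \<psi> x))\<^sup>2 \<partial>M) \<longlonglongrightarrow> 0"
  proof (rule LIMSEQ_I)
    fix e :: real assume "e > 0"
    then obtain k where k: "(1/4)^k < e" using real_arch_pow_inv[of e "1/4"] by auto
    have "norm ((\<integral>x. (cmod (\<phi> n x - \<psi> x))\<^sup>2 \<partial>M) - 0) < e" if "n \<ge> s k" for n
    proof -
      have "ennreal (\<integral>x. (cmod (\<phi> n x - \<psi> x))\<^sup>2 \<partial>M) \<le> ennreal ((1/4)^k)"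
        using est[OF that] sqint_integrable_norm2[OF sqint_diff[OF sq psi]]
        by (simp add: nn_integral_eq_integral)
      then show ?thesis using k by (simp add: integral_nonneg_AE)
    qed
    then show "\<exists>no. \<forall>n\<ge>no. norm ((\<integral>x. (cmod (\<phi> n x - \<psi> x))\<^sup>2 \<partial>M) - 0) < e" by blast
  qed
  with psi show ?thesis by (rule that)
qed

section \<open>Absolutely continuous functions\<close>

text \<open>Absolute continuity on [0,b] with density \<open>u'\<close>, encoded by the integral
  identity. This is the form in which \<open>H1\<close> in space and
  \<open>discrete_solution\<close> in time supply it, and it needs no statement about pointwise
  differentiability.\<close>

definition AC :: "real \<Rightarrow> (real \<Rightarrow> 'a::euclidean_space) \<Rightarrow> (real \<Rightarrow> 'a) \<Rightarrow> bool" where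
  "AC b u u' \<longleftrightarrow> integrable (lebesgue_on {0..b}) u'
      \<and> (\<forall>t\<in>{0..b}. u t = u 0 + integral\<^sup>L (lebesgue_on {0..t}) u')"

lemma finite_measure_lebesgue_on_Icc: "finite_measure (lebesgue_on {a..b::real})"
  by (simp add: finite_measure_restrict_space emeasure_lborel_Icc_eq finite_measureI emeasure_restrict_space)

lemma integrable_lebesgue_on_subset:
  fixes f :: "real \<Rightarrow> 'a::euclidean_space"
  assumes "integrable (lebesgue_on T) f" "S \<subseteq> T" "S \<in> sets lebesgue" "T \<in> sets lebesgue"
  shows "integrable (lebesgue_on S) f"
  using assms integrable_restrict_UNIV[of T f] integrable_restrict_UNIV[of S f]
    set_integrable_subset[of lebesgue T f S]
  by (simp add: set_integrable_def integrable_restrict_space)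

lemma measurable_lebesgue_on_subset:
  assumes "f \<in> borel_measurable (lebesgue_on T)" "S \<subseteq> T" "S \<in> sets lebesgue" "T \<in> sets lebesgue"
  shows "f \<in> borel_measurable (lebesgue_on S)"
  using measurable_restrict_mono[OF assms(1,2)] by simp

lemma AC_integrable: "AC b u u' \<Longrightarrow> integrable (lebesgue_on {0..b}) u'"
  by (simp add: AC_def)

lemma AC_eq: "AC b u u' \<Longrightarrow> t \<in> {0..b} \<Longrightarrow> u t = u 0 + integral\<^sup>L (lebesgue_on {0..t}) u'"
  unfolding AC_def by blast

lemma AC_integrable_subset: "AC b u u' \<Longrightarrow> t \<in> {0..b} \<Longrightarrow> integrable (lebesgue_on {0..t}) u'"
  by (rule integrable_lebesgue_on_subset[OF AC_integrable]) auto

lemma AC_integral: "AC b u u' \<Longrightarrow> t \<in> {0..b} \<Longrightarrow> integral\<^sup>L (lebesgue_on {0..t}) u' = u t - u 0"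
  using AC_eq[of b u u' t] by (metis add_diff_cancel_left')

lemma ACI:
  assumes "integrable (lebesgue_on {0..b}) u'"
    and "\<And>t. t \<in> {0..b} \<Longrightarrow> integral\<^sup>L (lebesgue_on {0..t}) u' = u t - u 0"
  shows "AC b u u'"
  unfolding AC_def using assms by auto

lemma AC_eq_HK: "AC b u u' \<Longrightarrow> t \<in> {0..b} \<Longrightarrow> u t = u 0 + integral {0..t} u'"
  using AC_eq[of b u u' t] AC_integrable_subset[of b u u' t] by (simp add: lebesgue_integral_eq_integral)

lemma AC_continuous_on:
  assumes "AC b u u'" shows "continuous_on {0..b} u"
proof (rule continuous_on_eq)
  show "continuous_on {0..b} (\<lambda>t. u 0 + integral {0..t} u')"
    using integrable_on_lebesgue_on[OF AC_integrable[OF assms]]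
    by (intro continuous_intros indefinite_integral_continuous_1) auto
qed (rule AC_eq_HK[OF assms, symmetric])

lemma continuous_on_integrable_Icc:
  fixes f :: "real \<Rightarrow> 'a::euclidean_space"
  assumes "continuous_on {a..b} f" shows "integrable (lebesgue_on {a..b}) f"
  using continuous_imp_integrable[of a b f] assms by simp

lemma AC_vector_derivative:
  fixes u :: "real \<Rightarrow> 'a::euclidean_space"
  assumes d: "\<And>t. t \<in> {0..b} \<Longrightarrow> (u has_vector_derivative u' t) (at t within {0..b})"
    and c: "continuous_on {0..b} u'"
  shows "AC b u u'"
  unfolding AC_def
proof (intro conjI ballI)
  show "integrable (lebesgue_on {0..b}) u'" by (rule continuous_on_integrable_Icc[OF c])
  fix t assume t: "t \<in> {0..b}"
  have "(u' has_integral (u t - u 0)) {0..t}"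
    using t by (intro fundamental_theorem_of_calculus has_vector_derivative_within_subset[OF d]) auto
  moreover have "integrable (lebesgue_on {0..t}) u'"
    using t c by (intro continuous_on_integrable_Icc) (auto intro: continuous_on_subset)
  ultimately show "u t = u 0 + integral\<^sup>L (lebesgue_on {0..t}) u'"
    by (simp add: lebesgue_integral_eq_integral integral_unique)
qed

lemma AC_const: "AC b (\<lambda>t. c) (\<lambda>t. 0)"
  by (simp add: AC_def)

lemma AC_add: "AC b u u' \<Longrightarrow> AC b v v' \<Longrightarrow> AC b (\<lambda>t. u t + v t) (\<lambda>t. u' t + v' t)"
  by (rule ACI) (auto simp: AC_integrable AC_integrable_subset AC_integral)

lemma AC_bounded_linear:
  assumes "bounded_linear L" "AC b u u'"
  shows "AC b (\<lambda>t. L (u t)) (\<lambda>t. L (u' t))"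
proof -
  interpret L: bounded_linear L by fact
  show ?thesis
    unfolding AC_def
  proof (intro conjI ballI)
    show "integrable (lebesgue_on {0..b}) (\<lambda>t. L (u' t))"
      using AC_integrable[OF assms(2)] by (rule integrable_bounded_linear[OF assms(1)])
    fix t assume t: "t \<in> {0..b}"
    show "L (u t) = L (u 0) + (\<integral>t. L (u' t) \<partial>lebesgue_on {0..t})"
      using integral_bounded_linear[OF assms(1) AC_integrable_subset[OF assms(2) t]]
      by (simp add: AC_integral[OF assms(2) t] L.diff)
  qed
qed

lemma AC_uminus: "AC b u u' \<Longrightarrow> AC b (\<lambda>t. - u t) (\<lambda>t. - u' t)"
  by (rule AC_bounded_linear[OF bounded_linear_minus[OF bounded_linear_ident]])

lemma AC_diff: "AC b u u' \<Longrightarrow> AC b v v' \<Longrightarrow> AC b (\<lambda>t. u t - v t) (\<lambda>t. u' t - v' t)"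
  using AC_add[OF _ AC_uminus] by force

lemma AC_cmult:
  fixes u :: "real \<Rightarrow> 'a::{euclidean_space, real_normed_algebra}"
  shows "AC b u u' \<Longrightarrow> AC b (\<lambda>t. c * u t) (\<lambda>t. c * u' t)"
  by (rule AC_bounded_linear[OF bounded_linear_mult_right])

lemma AC_cmult_right:
  fixes u :: "real \<Rightarrow> 'a::{euclidean_space, real_normed_algebra}"
  shows "AC b u u' \<Longrightarrow> AC b (\<lambda>t. u t * c) (\<lambda>t. u' t * c)"
  by (rule AC_bounded_linear[OF bounded_linear_mult_left])

lemma AC_sum: "(\<And>i. i \<in> I \<Longrightarrow> AC b (u i) (u' i)) \<Longrightarrow> AC b (\<lambda>t. \<Sum>i\<in>I. u i t) (\<lambda>t. \<Sum>i\<in>I. u' i t)"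
  by (induction I rule: infinite_finite_induct) (auto intro: AC_add AC_const)

lemma pair_sigma_finite_lebesgue_on:
  "pair_sigma_finite (lebesgue_on {a..b::real}) (lebesgue_on {c..d::real})"
  by (simp add: pair_sigma_finite_def finite_measure.axioms(1) finite_measure_lebesgue_on_Icc)

lemma integrable_mult_continuous:
  fixes f g :: "real \<Rightarrow> 'a::{euclidean_space, real_normed_field}"
  assumes f: "continuous_on {a..b} f" and g: "integrable (lebesgue_on {a..b}) g"
  shows "integrable (lebesgue_on {a..b}) (\<lambda>t. f t * g t)"
proof -
  obtain B where B: "\<forall>t\<in>{a..b}. norm (f t) \<le> B"
    using compact_imp_bounded[OF compact_continuous_image[OF f]] by (auto simp: bounded_iff)
  show ?thesis
  proof (rule Bochner_Integration.integrable_bound)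
    show "integrable (lebesgue_on {a..b}) (\<lambda>t. B *\<^sub>R g t)" using g by auto
    show "(\<lambda>t. f t * g t) \<in> borel_measurable (lebesgue_on {a..b})"
      using g continuous_imp_measurable_on_sets_lebesgue[OF f] by auto
    show "AE x in lebesgue_on {a..b}. norm (f x * g x) \<le> norm (B *\<^sub>R g x)"
    proof (rule AE_I2)
      fix x assume "x \<in> space (lebesgue_on {a..b})"
      then have "norm (f x) \<le> \<bar>B\<bar>" using B by force
      then show "norm (f x * g x) \<le> norm (B *\<^sub>R g x)" by (simp add: norm_mult mult_right_mono)
    qed
  qed
qed

text \<open>Fubini on the square, split along the diagonal.\<close>
lemma AC_mult:
  fixes u v :: "real \<Rightarrow> 'a::{euclidean_space, real_normed_field}"
  assumes u: "AC b u u'" and v: "AC b v v'"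
  shows "AC b (\<lambda>t. u t * v t) (\<lambda>t. u' t * v t + u t * v' t)"
  unfolding AC_def
proof (intro conjI ballI)
  have i1: "integrable (lebesgue_on {0..b}) (\<lambda>t. u' t * v t)"
    using integrable_mult_continuous[OF AC_continuous_on[OF v] AC_integrable[OF u]] by (simp add: mult.commute)
  have i2: "integrable (lebesgue_on {0..b}) (\<lambda>t. u t * v' t)"
    by (rule integrable_mult_continuous[OF AC_continuous_on[OF u] AC_integrable[OF v]])
  show "integrable (lebesgue_on {0..b}) (\<lambda>t. u' t * v t + u t * v' t)"
    using i1 i2 by simp
  fix t assume t: "t \<in> {0..b}"
  let ?M = "lebesgue_on {0..t}"
  interpret M: finite_measure ?M by (rule finite_measure_lebesgue_on_Icc)
  interpret P: pair_sigma_finite ?M ?M by (rule pair_sigma_finite_lebesgue_on)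
  note ui = AC_integrable_subset[OF u t] and vi = AC_integrable_subset[OF v t]
  have [measurable]: "u' \<in> borel_measurable ?M" "v' \<in> borel_measurable ?M"
    using ui vi by auto
  have id[measurable]: "(\<lambda>x. x) \<in> borel_measurable ?M"
    by (intro continuous_imp_measurable_on_sets_lebesgue) auto
  have pint: "integrable (?M \<Otimes>\<^sub>M ?M) (\<lambda>(x, y). u' x * v' y)"
  proof (rule P.Fubini_integrable)
    show "integrable ?M (\<lambda>x. \<integral>y. norm (case (x, y) of (x, y) \<Rightarrow> u' x * v' y) \<partial>?M)"
      using ui by (auto simp: norm_mult)
    show "AE x in ?M. integrable ?M (\<lambda>y. case (x, y) of (x, y) \<Rightarrow> u' x * v' y)"
      using vi by auto
  qed measurable
  \<comment> \<open>\<open>A\<close> carries the closed triangle y \<le> x and \<open>B\<close> the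
    open complementary one, so their sum is the full product without double counting the
    diagonal.\<close>
  define A where "A x y = (if y \<le> x then u' x * v' y else 0)" for x y
  define B where "B x y = (if x < y then u' x * v' y else 0)" for x y
  have Am[measurable]: "case_prod A \<in> borel_measurable (?M \<Otimes>\<^sub>M ?M)"
    unfolding A_def by measurable
  have Bm[measurable]: "case_prod B \<in> borel_measurable (?M \<Otimes>\<^sub>M ?M)"
    unfolding B_def by measurable
  have Ai: "integrable (?M \<Otimes>\<^sub>M ?M) (case_prod A)"
    by (rule Bochner_Integration.integrable_bound[OF pint]) (auto simp: A_def)
  have Bi: "integrable (?M \<Otimes>\<^sub>M ?M) (case_prod B)"
    by (rule Bochner_Integration.integrable_bound[OF pint]) (auto simp: B_def)
  have sub: "integral\<^sup>L ?M (\<lambda>y. if y \<le> x then c * f y else 0) = c * integral\<^sup>L (lebesgue_on {0..x}) f"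
    if "x \<in> {0..t}" "integrable ?M f" for x c and f :: "real \<Rightarrow> 'a"
  proof -
    have "integral\<^sup>L ?M (\<lambda>y. if y \<le> x then c * f y else 0) = integral\<^sup>L ?M (\<lambda>y. if y \<in> {0..x} then c * f y else 0)"
      by (intro Bochner_Integration.integral_cong) auto
    also have "\<dots> = integral\<^sup>L (lebesgue_on {0..x}) (\<lambda>y. c * f y)"
      using that by (intro integral_restrict) auto
    finally show ?thesis by simp
  qed
  have A_eq: "integral\<^sup>L (?M \<Otimes>\<^sub>M ?M) (case_prod A) = (\<integral>x. u' x * (v x - v 0) \<partial>?M)"
  proof -
    have "integral\<^sup>L (?M \<Otimes>\<^sub>M ?M) (case_prod A) = (\<integral>x. (\<integral>y. A x y \<partial>?M) \<partial>?M)"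
      using P.integral_fst[OF Ai] by simp
    also have "\<dots> = (\<integral>x. u' x * (v x - v 0) \<partial>?M)"
      using t AC_integral[OF v] unfolding A_def
      by (intro Bochner_Integration.integral_cong refl) (simp add: sub[OF _ vi])
    finally show ?thesis .
  qed
  have B_eq: "integral\<^sup>L (?M \<Otimes>\<^sub>M ?M) (case_prod B) = (\<integral>y. (u y - u 0) * v' y \<partial>?M)"
  proof -
    have "integral\<^sup>L (?M \<Otimes>\<^sub>M ?M) (case_prod B) = (\<integral>y. (\<integral>x. B x y \<partial>?M) \<partial>?M)"
      using P.integral_snd[OF Bi] by simp
    also have "\<dots> = (\<integral>y. (u y - u 0) * v' y \<partial>?M)"
    proof (intro Bochner_Integration.integral_cong refl)
      fix y assume y: "y \<in> space ?M"
      have "(\<integral>x. B x y \<partial>?M) = (\<integral>x. (if x \<le> y then v' y * u' x else 0) \<partial>?M)"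
      \<comment> \<open>Closing the open triangle changes the inner integrand only at the single
        point x = y.\<close>
      proof (rule integral_cong_AE)
        have "AE x in lebesgue. x \<noteq> y"
          by (rule AE_completion) (rule AE_lborel_singleton)
        then have "AE x in ?M. x \<noteq> y"
          by (subst AE_restrict_space_iff) auto
        then show "AE x in ?M. B x y = (if x \<le> y then v' y * u' x else 0)"
          by eventually_elim (auto simp: B_def)
      qed (auto simp: B_def)
      also have "\<dots> = v' y * (u y - u 0)"
        using y t AC_integral[OF u] by (simp add: sub[OF _ ui])
      finally show "(\<integral>x. B x y \<partial>?M) = (u y - u 0) * v' y" by (simp add: mult.commute)
    qed
    finally show ?thesis .
  qed
  have "(\<integral>x. u' x \<partial>?M) * (\<integral>y. v' y \<partial>?M) = (\<integral>x. (\<integral>y. u' x * v' y \<partial>?M) \<partial>?M)"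
    by simp
  also have "\<dots> = integral\<^sup>L (?M \<Otimes>\<^sub>M ?M) (\<lambda>(x, y). u' x * v' y)"
    using P.integral_fst[OF pint] by simp
  also have "\<dots> = integral\<^sup>L (?M \<Otimes>\<^sub>M ?M) (\<lambda>z. case_prod A z + case_prod B z)"
    by (intro Bochner_Integration.integral_cong) (auto simp: A_def B_def)
  also have "\<dots> = (\<integral>x. u' x * (v x - v 0) \<partial>?M) + (\<integral>y. (u y - u 0) * v' y \<partial>?M)"
    using Ai Bi by (simp add: A_eq B_eq)
  also have "\<dots> = (\<integral>x. u' x * v x \<partial>?M) - (\<integral>x. u' x \<partial>?M) * v 0
       + ((\<integral>y. u y * v' y \<partial>?M) - u 0 * (\<integral>y. v' y \<partial>?M))"
    using integrable_lebesgue_on_subset[OF i1, of "{0..t}"] integrable_lebesgue_on_subset[OF i2, of "{0..t}"] ui vi t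
    by (simp add: algebra_simps)
  finally have main: "(\<integral>x. u' x \<partial>?M) * (\<integral>y. v' y \<partial>?M) + (\<integral>x. u' x \<partial>?M) * v 0 + u 0 * (\<integral>y. v' y \<partial>?M)
     = (\<integral>x. u' x * v x \<partial>?M) + (\<integral>y. u y * v' y \<partial>?M)"
    by (simp add: algebra_simps)
  have "u t * v t = u 0 * v 0 + ((\<integral>x. u' x \<partial>?M) * (\<integral>y. v' y \<partial>?M) + (\<integral>x. u' x \<partial>?M) * v 0 + u 0 * (\<integral>y. v' y \<partial>?M))"
    by (simp add: AC_integral[OF u t] AC_integral[OF v t] algebra_simps)
  also have "\<dots> = u 0 * v 0 + (\<integral>x. u' x * v x + u x * v' x \<partial>?M)"
    using integrable_lebesgue_on_subset[OF i1, of "{0..t}"] integrable_lebesgue_on_subset[OF i2, of "{0..t}"] t main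
    by simp
  finally show "u t * v t = u 0 * v 0 + (\<integral>x. u' x * v x + u x * v' x \<partial>?M)" .
qed

lemma AC_by_parts:
  fixes u v :: "real \<Rightarrow> 'a::{euclidean_space, real_normed_field}"
  assumes u: "AC b u u'" and v: "AC b v v'" and "0 \<le> b"
  shows "(\<integral>t. u' t * v t \<partial>lebesgue_on {0..b})
      = u b * v b - u 0 * v 0 - (\<integral>t. u t * v' t \<partial>lebesgue_on {0..b})"
  using AC_integral[OF AC_mult[OF u v], of b] assms(3)
    integrable_mult_continuous[OF AC_continuous_on[OF u] AC_integrable[OF v]]
    integrable_mult_continuous[OF AC_continuous_on[OF v] AC_integrable[OF u]]
  by (simp add: mult.commute[of "u' _"] eq_diff_eq)

section \<open>The discrete energy and multiplier identities\<close>

lemma sum_by_parts_mean: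
  fixes V y :: "nat \<Rightarrow> real"
  shows "(\<Sum>j<n. V (Suc j) * (y j + y (Suc j))) = (\<Sum>j\<le>n. (V j + V (Suc j)) * y j) - V 0 * y 0 - V (Suc n) * y n"
  by (induction n) (auto simp: algebra_simps)

lemma sum_by_parts_difference:
  fixes V d :: "nat \<Rightarrow> real"
  shows "(\<Sum>j<n. V (Suc j) * (d j - d (Suc j))) = (\<Sum>j\<le>n. (V (Suc j) - V j) * d j) + V 0 * d 0 - V (Suc n) * d n"
  by (induction n) (auto simp: algebra_simps)

text \<open>The weight drops by h from node to node. For (n+1)h = 1 the right boundary term
  disappears, and what remains is the total of \<open>D\<close> minus its value in the first cell:
  this is how the multiplier isolates the trace at 0.\<close>

lemma sum_by_parts_weight:
  fixes D :: "nat \<Rightarrow> real"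
  shows "(\<Sum>j<n. (1 - real (Suc j) * h) * (D (Suc j) - D j)) = (1 - real (Suc n) * h) * D n - D 0 + h * (\<Sum>j\<le>n. D j)"
  by (induction n) (auto simp: algebra_simps)

lemma sum_lessThan_le_atMost:
  fixes f :: "nat \<Rightarrow> real"
  assumes "\<And>j. f j \<ge> 0"
  shows "(\<Sum>j<n. f j) \<le> (\<Sum>j\<le>n. f j)" "(\<Sum>j<n. f (Suc j)) \<le> (\<Sum>j\<le>n. f j)"
proof -
  show "(\<Sum>j<n. f j) \<le> (\<Sum>j\<le>n. f j)" using assms by (simp add: lessThan_Suc_atMost[symmetric])
  show "(\<Sum>j<n. f (Suc j)) \<le> (\<Sum>j\<le>n. f j)"
    using assms[of 0] by (subst sum.atMost_shift) simp
qed

lemma sum_mean_sq_le: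
  fixes f :: "nat \<Rightarrow> real"
  shows "(\<Sum>j<n. ((f j + f (Suc j)) / 2)\<^sup>2) \<le> (\<Sum>j\<le>n. (f j)\<^sup>2)"
proof -
  have "(\<Sum>j<n. ((f j + f (Suc j)) / 2)\<^sup>2) \<le> (\<Sum>j<n. (f j)\<^sup>2 / 2 + (f (Suc j))\<^sup>2 / 2)"
  proof (rule sum_mono)
    fix j
    have "0 \<le> (f j - f (Suc j))\<^sup>2" by simp
    then show "((f j + f (Suc j)) / 2)\<^sup>2 \<le> (f j)\<^sup>2 / 2 + (f (Suc j))\<^sup>2 / 2"
      by (simp add: power2_eq_square field_simps)
  qed
  also have "\<dots> = (\<Sum>j<n. (f j)\<^sup>2) / 2 + (\<Sum>j<n. (f (Suc j))\<^sup>2) / 2"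
    by (simp add: sum.distrib sum_divide_distrib)
  also have "\<dots> \<le> (\<Sum>j\<le>n. (f j)\<^sup>2)"
    using sum_lessThan_le_atMost[of "\<lambda>j. (f j)\<^sup>2" n] by simp
  finally show ?thesis .
qed

lemma mult_le_weighted_squares:
  fixes a b c :: real
  assumes "c > 0" shows "a * b \<le> a\<^sup>2 / (4 * c) + c * b\<^sup>2"
proof -
  have "0 \<le> (a - 2 * c * b)\<^sup>2 / (4 * c)" using assms by simp
  also have "\<dots> = a\<^sup>2 / (4 * c) + c * b\<^sup>2 - a * b"
    using assms by (simp add: power2_eq_square field_simps)
  finally show ?thesis by simp
qed

text \<open>Value on the cell between nodes j and j+1. Averaging twice gives the mass matrix: its
  row at node j+1 is h/2 times the sum of the means over the two adjacent cells.\<close>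

definition mean :: "(nat \<Rightarrow> real) \<Rightarrow> nat \<Rightarrow> real" where
  "mean v j = (v j + v (Suc j)) / 2"

definition dq :: "real \<Rightarrow> (nat \<Rightarrow> real) \<Rightarrow> nat \<Rightarrow> real" where
  "dq h v j = (v (Suc j) - v j) / h"

text \<open>The equation at the interior node j+1, at one instant. Two kinds of sources are kept
  apart: \<open>r\<close> lives on cells and enters averaged, like the mass term, while
  \<open>\<rho>\<close> lives on nodes. The acceleration \<open>v'\<close> is a separate vector
  because the equation will hold only at almost every time.\<close>

definition scheme :: "nat \<Rightarrow> real \<Rightarrow> (nat \<Rightarrow> real) \<Rightarrow> (nat \<Rightarrow> real) \<Rightarrow> (nat \<Rightarrow> real) \<Rightarrow> (nat \<Rightarrow> real) \<Rightarrow> (nat \<Rightarrow> real) \<Rightarrow> bool" where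
  "scheme N h \<alpha> w v' r \<rho> \<longleftrightarrow> (\<forall>j<N.
     h / 4 * (v' j + 2 * v' (Suc j) + v' (Suc (Suc j))) + (2 * w (Suc j) - w j - w (Suc (Suc j))) / h
       + h * \<alpha> (Suc j) * w (Suc j)
     = h / 2 * (r j + r (Suc j)) + h * \<rho> (Suc j))"

lemma scheme_alt:
  assumes "scheme N h \<alpha> w v' r \<rho>" "j < N"
  shows "h / 2 * (mean v' j + mean v' (Suc j)) =
    (dq h w (Suc j) - dq h w j) - h * \<alpha> (Suc j) * w (Suc j) + h / 2 * (r j + r (Suc j)) + h * \<rho> (Suc j)"
proof -
  have "h / 2 * (mean v' j + mean v' (Suc j)) = h / 4 * (v' j + 2 * v' (Suc j) + v' (Suc (Suc j)))"
    by (simp add: mean_def field_simps)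
  moreover have "(2 * w (Suc j) - w j - w (Suc (Suc j))) / h = dq h w j - dq h w (Suc j)"
    by (simp add: dq_def diff_divide_distrib[symmetric])
  moreover have "h / 4 * (v' j + 2 * v' (Suc j) + v' (Suc (Suc j))) + (2 * w (Suc j) - w j - w (Suc (Suc j))) / h
       + h * \<alpha> (Suc j) * w (Suc j) = h / 2 * (r j + r (Suc j)) + h * \<rho> (Suc j)"
    using assms unfolding scheme_def by blast
  ultimately show ?thesis by linarith
qed

text \<open>Each row is multiplied by the nodal value of \<open>v\<close> and summed by parts. The
  averaging passes to \<open>v\<close>, so \<open>r\<close> meets cell means, whereas
  \<open>\<rho>\<close> meets nodal values. \<open>v\<close> is any vector vanishing at the ends; it
  is the velocity in the evolution estimate and equals \<open>v'\<close> in
  \<open>static_mean_estimate\<close>.\<close>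

lemma energy_identity:
  assumes sch: "scheme N h \<alpha> w v' r \<rho>" and "h \<noteq> 0"
    and bd: "v 0 = 0" "v (Suc N) = 0"
  shows "h * (\<Sum>j\<le>N. mean v j * mean v' j) + h * (\<Sum>j\<le>N. dq h w j * dq h v j)
      + h * (\<Sum>j<N. \<alpha> (Suc j) * w (Suc j) * v (Suc j))
    = h * (\<Sum>j\<le>N. mean v j * r j) + h * (\<Sum>j<N. \<rho> (Suc j) * v (Suc j))"
proof -
  have "(\<Sum>j<N. v (Suc j) * (h / 2 * (mean v' j + mean v' (Suc j)))) =
      (\<Sum>j<N. v (Suc j) * ((dq h w (Suc j) - dq h w j) - h * \<alpha> (Suc j) * w (Suc j) + h / 2 * (r j + r (Suc j)) + h * \<rho> (Suc j)))"
    using scheme_alt[OF sch] by (intro sum.cong) auto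
  also have "\<dots> = - (\<Sum>j<N. v (Suc j) * (dq h w j - dq h w (Suc j))) - h * (\<Sum>j<N. \<alpha> (Suc j) * w (Suc j) * v (Suc j))
     + h / 2 * (\<Sum>j<N. v (Suc j) * (r j + r (Suc j))) + h * (\<Sum>j<N. \<rho> (Suc j) * v (Suc j))"
    by (simp add: sum.distrib sum_subtractf sum_negf[symmetric] sum_distrib_left algebra_simps)
  also have "(\<Sum>j<N. v (Suc j) * (h / 2 * (mean v' j + mean v' (Suc j)))) = h / 2 * (\<Sum>j<N. v (Suc j) * (mean v' j + mean v' (Suc j)))"
    by (simp add: sum_distrib_left algebra_simps)
  finally have *: "h / 2 * (\<Sum>j\<le>N. (v j + v (Suc j)) * mean v' j) = - (\<Sum>j\<le>N. (v (Suc j) - v j) * dq h w j)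
     - h * (\<Sum>j<N. \<alpha> (Suc j) * w (Suc j) * v (Suc j))
     + h / 2 * (\<Sum>j\<le>N. (v j + v (Suc j)) * r j) + h * (\<Sum>j<N. \<rho> (Suc j) * v (Suc j))"
    by (simp add: sum_by_parts_mean sum_by_parts_difference bd)
  have eq: "h / 2 * (\<Sum>j\<le>N. (v j + v (Suc j)) * y j) = h * (\<Sum>j\<le>N. mean v j * y j)" for y
    by (simp add: mean_def sum_distrib_left)
  note eq[of "mean v'"] eq[of r]
  moreover have "(\<Sum>j\<le>N. (v (Suc j) - v j) * dq h w j) = h * (\<Sum>j\<le>N. dq h w j * dq h v j)"
    using \<open>h \<noteq> 0\<close> by (simp add: dq_def sum_distrib_left mult.commute)
  ultimately show ?thesis using * by linarith
qed

text \<open>The difference of neighbouring means of \<open>w\<close> is h times the centred slope,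
  that is, the multiplier of the overview. Against it the stiffness term becomes a difference of
  squares of \<open>dq h w\<close>; the second product on the left, coming from the time derivative
  of the multiplier, is a difference of squares of \<open>mean v\<close>. Both are then summed by
  parts against the weight.\<close>

lemma multiplier_identity:
  assumes sch: "scheme N h \<alpha> w v' r \<rho>" and h: "real (Suc N) * h = 1"
  shows "(\<Sum>j<N. (1 - real (Suc j) * h) * (1/2) *
      ((mean v' j + mean v' (Suc j)) * (mean w (Suc j) - mean w j) + (mean v j + mean v (Suc j)) * (mean v (Suc j) - mean v j)))
    = 1/2 * (h * (\<Sum>j\<le>N. (dq h w j)\<^sup>2) + h * (\<Sum>j\<le>N. (mean v j)\<^sup>2)) - 1/2 * ((dq h w 0)\<^sup>2 + (mean v 0)\<^sup>2)
     + h * (\<Sum>j<N. (1 - real (Suc j) * h) * mean (dq h w) j * (mean r j + \<rho> (Suc j) - \<alpha> (Suc j) * w (Suc j)))"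
proof -
  have h0: "h \<noteq> 0" using h by auto
  \<comment> \<open>Energy density of a cell. Its value in cell 0 is the boundary term: for
    \<open>w\<close> and \<open>v\<close> vanishing at node 0 it is half of the square of w_1/h plus
    half of the square of v_1/2.\<close>
  define D where "D j = ((dq h w j)\<^sup>2 + (mean v j)\<^sup>2) / 2" for j
  have "(1 - real (Suc j) * h) * (1/2) *
      ((mean v' j + mean v' (Suc j)) * (mean w (Suc j) - mean w j) + (mean v j + mean v (Suc j)) * (mean v (Suc j) - mean v j))
    = (1 - real (Suc j) * h) * (D (Suc j) - D j)
      + h * ((1 - real (Suc j) * h) * mean (dq h w) j * (mean r j + \<rho> (Suc j) - \<alpha> (Suc j) * w (Suc j)))" if "j < N" for j
  proof -
    have "mean w (Suc j) - mean w j = h * mean (dq h w) j"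
      using h0 by (simp add: mean_def dq_def field_simps)
    then have "(1/2) * ((mean v' j + mean v' (Suc j)) * (mean w (Suc j) - mean w j)) = (h / 2 * (mean v' j + mean v' (Suc j))) * mean (dq h w) j"
      by simp
    also have "\<dots> = ((dq h w (Suc j) - dq h w j) + h * (mean r j + \<rho> (Suc j) - \<alpha> (Suc j) * w (Suc j))) * mean (dq h w) j"
      unfolding scheme_alt[OF sch that] by (simp add: mean_def[of r] algebra_simps add_divide_distrib)
    also have "\<dots> = ((dq h w (Suc j))\<^sup>2 - (dq h w j)\<^sup>2) / 2 + h * (mean (dq h w) j * (mean r j + \<rho> (Suc j) - \<alpha> (Suc j) * w (Suc j)))"
      by (simp add: mean_def[of "dq h w"] power2_eq_square field_simps)
    finally have 1: "(1/2) * ((mean v' j + mean v' (Suc j)) * (mean w (Suc j) - mean w j)) = \<dots>" .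
    have 2: "(1/2) * ((mean v j + mean v (Suc j)) * (mean v (Suc j) - mean v j)) = ((mean v (Suc j))\<^sup>2 - (mean v j)\<^sup>2) / 2"
      by (simp add: power2_eq_square algebra_simps)
    have "D (Suc j) - D j = ((dq h w (Suc j))\<^sup>2 - (dq h w j)\<^sup>2) / 2 + ((mean v (Suc j))\<^sup>2 - (mean v j)\<^sup>2) / 2"
      by (simp add: D_def field_simps)
    then show ?thesis
      unfolding mult.assoc distrib_left[of "1/2"] 1 2 by (simp add: algebra_simps)
  qed
  then have "(\<Sum>j<N. (1 - real (Suc j) * h) * (1/2) *
      ((mean v' j + mean v' (Suc j)) * (mean w (Suc j) - mean w j) + (mean v j + mean v (Suc j)) * (mean v (Suc j) - mean v j)))
    = (\<Sum>j<N. (1 - real (Suc j) * h) * (D (Suc j) - D j))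
      + h * (\<Sum>j<N. (1 - real (Suc j) * h) * mean (dq h w) j * (mean r j + \<rho> (Suc j) - \<alpha> (Suc j) * w (Suc j)))"
    unfolding sum_distrib_left sum.distrib[symmetric] by (intro sum.cong refl) simp_all
  also have "(\<Sum>j<N. (1 - real (Suc j) * h) * (D (Suc j) - D j)) = h * (\<Sum>j\<le>N. D j) - D 0"
    using h by (subst sum_by_parts_weight) simp
  also have "(\<Sum>j\<le>N. D j) = 1/2 * ((\<Sum>j\<le>N. (dq h w j)\<^sup>2) + (\<Sum>j\<le>N. (mean v j)\<^sup>2))"
    by (simp add: D_def sum.distrib sum_divide_distrib[symmetric])
  also have "h * (1/2 * ((\<Sum>j\<le>N. (dq h w j)\<^sup>2) + (\<Sum>j\<le>N. (mean v j)\<^sup>2))) - D 0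
    = 1/2 * (h * (\<Sum>j\<le>N. (dq h w j)\<^sup>2) + h * (\<Sum>j\<le>N. (mean v j)\<^sup>2)) - 1/2 * ((dq h w 0)\<^sup>2 + (mean v 0)\<^sup>2)"
    by (simp add: D_def field_simps)
  finally show ?thesis .
qed

text \<open>Cauchy-Schwarz for the telescoping sum of the increments, whose number times h is the
  length 1 of the interval.\<close>

lemma discrete_Poincare:
  assumes h: "real (Suc N) * h = 1" and w0: "w 0 = 0" and j: "j \<le> Suc N"
  shows "(w j)\<^sup>2 \<le> h * (\<Sum>i\<le>N. (dq h w i)\<^sup>2)"
proof -
  have h0: "h > 0" using h by (metis mult_eq_0_iff of_nat_0_le_iff zero_less_mult_pos zero_less_one not_less_iff_gr_or_eq of_nat_0_less_iff zero_less_Suc)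
  have "w j = (\<Sum>i<j. h * dq h w i)"
    using h0 w0 by (simp add: dq_def sum_lessThan_telescope)
  then have "(w j)\<^sup>2 \<le> real (card {..<j}) * (\<Sum>i<j. (h * dq h w i)\<^sup>2)"
    using sum_squared_le_sum_of_squares[of "\<lambda>i. h * dq h w i" "{..<j}"] by (simp add: mult.commute)
  also have "\<dots> \<le> real (Suc N) * (\<Sum>i\<le>N. (h * dq h w i)\<^sup>2)"
    using j by (intro mult_mono sum_mono2 sum_nonneg) auto
  also have "\<dots> = (real (Suc N) * h) * (h * (\<Sum>i\<le>N. (dq h w i)\<^sup>2))"
    by (simp add: power_mult_distrib sum_distrib_left power2_eq_square algebra_simps)
  finally show ?thesis unfolding h by simp
qed

text \<open>Written with products instead of squares so that \<open>AC_mult\<close> differentiates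
  it term by term.\<close>

definition energy :: "nat \<Rightarrow> real \<Rightarrow> (nat \<Rightarrow> real) \<Rightarrow> (nat \<Rightarrow> real) \<Rightarrow> (nat \<Rightarrow> real) \<Rightarrow> real" where
  "energy N h \<alpha> w v = h / 2 * (\<Sum>j\<le>N. mean v j * mean v j) + h / 2 * (\<Sum>j\<le>N. dq h w j * dq h w j)
     + h / 2 * (\<Sum>j<N. \<alpha> (Suc j) * (w (Suc j) * w (Suc j)))"


lemma energy_bounds:
  assumes h: "real (Suc N) * h = 1" and w0: "w 0 = 0" and \<alpha>: "\<And>j. j < N \<Longrightarrow> \<alpha> (Suc j) \<ge> 0"
  shows "energy N h \<alpha> w v \<ge> 0" "h * (\<Sum>j\<le>N. (mean v j)\<^sup>2) + h * (\<Sum>j\<le>N. (dq h w j)\<^sup>2) \<le> 2 * energy N h \<alpha> w v"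
    "h * (\<Sum>j\<le>N. (mean v j)\<^sup>2) \<le> 2 * energy N h \<alpha> w v"
    "h * (\<Sum>j\<le>N. (dq h w j)\<^sup>2) \<le> 2 * energy N h \<alpha> w v"
    "h * (\<Sum>j<N. (w (Suc j))\<^sup>2) \<le> 2 * energy N h \<alpha> w v"
proof -
  have h0: "h > 0" using h by (metis zero_less_mult_pos zero_less_one of_nat_0_less_iff zero_less_Suc)
  have "0 \<le> \<alpha> (Suc j) * (w (Suc j) * w (Suc j))" if "j < N" for j
    using \<alpha>[OF that] by simp
  note pos = this
  have a: "h / 2 * (\<Sum>j<N. \<alpha> (Suc j) * (w (Suc j) * w (Suc j))) \<ge> 0"
    using h0 by (intro mult_nonneg_nonneg sum_nonneg pos) simp_all
  have b: "0 \<le> h * (\<Sum>j\<le>N. (mean v j)\<^sup>2)" "0 \<le> h * (\<Sum>j\<le>N. (dq h w j)\<^sup>2)"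
    using h0 by (auto intro!: mult_nonneg_nonneg sum_nonneg)
  show *: "h * (\<Sum>j\<le>N. (mean v j)\<^sup>2) + h * (\<Sum>j\<le>N. (dq h w j)\<^sup>2) \<le> 2 * energy N h \<alpha> w v"
    using a by (simp add: energy_def power2_eq_square)
  show "energy N h \<alpha> w v \<ge> 0" "h * (\<Sum>j\<le>N. (mean v j)\<^sup>2) \<le> 2 * energy N h \<alpha> w v"
    and d: "h * (\<Sum>j\<le>N. (dq h w j)\<^sup>2) \<le> 2 * energy N h \<alpha> w v" using * b by linarith+
  have "h * (\<Sum>j<N. (w (Suc j))\<^sup>2) \<le> h * (\<Sum>j<N. 2 * energy N h \<alpha> w v)"
    using h0 d discrete_Poincare[where w = w, OF h w0] by (intro mult_left_mono sum_mono order_trans[OF _ d]) auto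
  also have "\<dots> = (real N * h) * (2 * energy N h \<alpha> w v)" by simp
  also have "\<dots> \<le> 1 * (2 * energy N h \<alpha> w v)"
    using h h0 \<open>energy N h \<alpha> w v \<ge> 0\<close> by (intro mult_right_mono) (auto simp: algebra_simps)
  finally show "h * (\<Sum>j<N. (w (Suc j))\<^sup>2) \<le> 2 * energy N h \<alpha> w v" by simp
qed

section \<open>A priori estimates for the real semidiscrete system\<close>

locale semidiscrete =
  fixes N :: nat and h T A \<kappa> :: real and \<alpha> :: "nat \<Rightarrow> real"
    and W V V' r \<rho> \<rho>' :: "nat \<Rightarrow> real \<Rightarrow> real" and q :: "real \<Rightarrow> real"
  assumes h: "real (Suc N) * h = 1" and T: "T > 0"
    and W_bd: "\<And>t. W 0 t = 0" "\<And>t. W (Suc N) t = 0"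
    and V_bd: "\<And>t. V 0 t = 0" "\<And>t. V (Suc N) t = 0"
    and W_AC: "\<And>j. j \<le> Suc N \<Longrightarrow> AC T (W j) (V j)"
    and V_AC: "\<And>j. j \<le> Suc N \<Longrightarrow> AC T (V j) (V' j)"
    and \<rho>_AC: "\<And>j. j < N \<Longrightarrow> AC T (\<rho> (Suc j)) (\<rho>' (Suc j))"
    and \<rho>_le: "\<And>j t. j < N \<Longrightarrow> t \<in> {0..T} \<Longrightarrow> \<bar>\<rho> (Suc j) t\<bar> \<le> \<kappa>"
    and \<rho>'_le: "\<And>j t. j < N \<Longrightarrow> t \<in> {0..T} \<Longrightarrow> \<bar>\<rho>' (Suc j) t\<bar> \<le> \<kappa>"
    and \<alpha>_ge: "\<And>j. j < N \<Longrightarrow> 0 \<le> \<alpha> (Suc j)" and \<alpha>_le: "\<And>j. j < N \<Longrightarrow> \<alpha> (Suc j) \<le> A"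
    and q_int: "integrable (lebesgue_on {0..T}) q"
    and q_ge: "AE t in lebesgue_on {0..T}. h * (\<Sum>j\<le>N. (r j t)\<^sup>2) \<le> q t"
    and sch: "AE t in lebesgue_on {0..T}. scheme N h \<alpha> (\<lambda>j. W j t) (\<lambda>j. V' j t) (\<lambda>j. r j t) (\<lambda>j. \<rho> j t)"
begin

abbreviation "w t \<equiv> (\<lambda>j. W j t)"
abbreviation "v t \<equiv> (\<lambda>j. V j t)"
abbreviation "v' t \<equiv> (\<lambda>j. V' j t)"
abbreviation "En t \<equiv> energy N h \<alpha> (w t) (v t)"
abbreviation "Q \<equiv> integral\<^sup>L (lebesgue_on {0..T}) q"

lemma h_pos: "h > 0"
  using h by (metis zero_less_mult_pos zero_less_one of_nat_0_less_iff zero_less_Suc)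

lemma Nh_le_1: "real N * h \<le> 1"
  using h h_pos by (simp add: algebra_simps)

lemma mean_AC: "j \<le> N \<Longrightarrow> AC T (\<lambda>t. mean (w t) j) (\<lambda>t. mean (v t) j)"
  "j \<le> N \<Longrightarrow> AC T (\<lambda>t. mean (v t) j) (\<lambda>t. mean (v' t) j)"
  using AC_cmult[OF AC_add[OF W_AC W_AC], of j "Suc j" "1/2"] AC_cmult[OF AC_add[OF V_AC V_AC], of j "Suc j" "1/2"]
  by (auto simp: mean_def)

lemma dq_AC: "j \<le> N \<Longrightarrow> AC T (\<lambda>t. dq h (w t) j) (\<lambda>t. dq h (v t) j)"
  using AC_cmult[OF AC_diff[OF W_AC W_AC], of "Suc j" j "1/h"] by (auto simp: dq_def)

lemma energy_AC: "AC T En (\<lambda>t. h * (\<Sum>j\<le>N. mean (v t) j * mean (v' t) j) + h * (\<Sum>j\<le>N. dq h (w t) j * dq h (v t) j)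
      + h * (\<Sum>j<N. \<alpha> (Suc j) * W (Suc j) t * V (Suc j) t))"
proof -
  have eq: "h / 2 * (\<Sum>j\<in>I. x j * y j + y j * x j) = h * (\<Sum>j\<in>I. y j * x j)" for I and x y :: "nat \<Rightarrow> real"
    by (simp add: sum_distrib_left algebra_simps)
  have eq3: "h / 2 * (\<Sum>j\<in>I. a j * (x j * y j + y j * x j)) = h * (\<Sum>j\<in>I. a j * y j * x j)" for I and a x y :: "nat \<Rightarrow> real"
    by (simp add: sum_distrib_left algebra_simps)
  have "AC T En (\<lambda>t. h / 2 * (\<Sum>j\<le>N. mean (v' t) j * mean (v t) j + mean (v t) j * mean (v' t) j)
     + h / 2 * (\<Sum>j\<le>N. dq h (v t) j * dq h (w t) j + dq h (w t) j * dq h (v t) j)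
     + h / 2 * (\<Sum>j<N. \<alpha> (Suc j) * (V (Suc j) t * W (Suc j) t + W (Suc j) t * V (Suc j) t)))"
    unfolding energy_def
    by (intro AC_add AC_cmult AC_sum AC_mult mean_AC dq_AC W_AC) auto
  then show ?thesis unfolding eq eq3 .
qed

lemma \<rho>W_AC: "AC T (\<lambda>t. h * (\<Sum>j<N. \<rho> (Suc j) t * W (Suc j) t))
    (\<lambda>t. h * (\<Sum>j<N. \<rho>' (Suc j) t * W (Suc j) t + \<rho> (Suc j) t * V (Suc j) t))"
  by (intro AC_cmult AC_sum AC_mult W_AC \<rho>_AC) auto

lemma w_bounds:
  shows "En t \<ge> 0" "h * (\<Sum>j\<le>N. (mean (v t) j)\<^sup>2) + h * (\<Sum>j\<le>N. (dq h (w t) j)\<^sup>2) \<le> 2 * En t"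
    "h * (\<Sum>j\<le>N. (mean (v t) j)\<^sup>2) \<le> 2 * En t"
    "h * (\<Sum>j\<le>N. (dq h (w t) j)\<^sup>2) \<le> 2 * En t"
    "h * (\<Sum>j<N. (W (Suc j) t)\<^sup>2) \<le> 2 * En t"
  using energy_bounds[where w = "w t" and v = "v t" and \<alpha> = \<alpha>, OF h] W_bd(1) \<alpha>_ge by auto

lemma \<kappa>_sum: "(\<And>j. j < N \<Longrightarrow> \<bar>x j\<bar> \<le> \<kappa>) \<Longrightarrow> h * (\<Sum>j<N. (x j)\<^sup>2) \<le> \<kappa>\<^sup>2"
proof -
  assume "\<And>j. j < N \<Longrightarrow> \<bar>x j\<bar> \<le> \<kappa>"
  then have "h * (\<Sum>j<N. (x j)\<^sup>2) \<le> h * (\<Sum>j<N. \<kappa>\<^sup>2)"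
    using h_pos by (intro mult_left_mono sum_mono) (auto intro: power2_le_iff_abs_le[THEN iffD2] order_trans[OF abs_ge_zero])
  also have "\<dots> = (real N * h) * \<kappa>\<^sup>2" by simp
  also have "\<dots> \<le> 1 * \<kappa>\<^sup>2" by (intro mult_right_mono Nh_le_1) auto
  finally show ?thesis by simp
qed

lemma weighted_sum_le:
  assumes "c > 0"
  shows "h * (\<Sum>j\<in>I. x j * y j) \<le> h * (\<Sum>j\<in>I. (x j)\<^sup>2) / (4 * c) + c * (h * (\<Sum>j\<in>I. (y j)\<^sup>2))"
proof -
  have "h * (\<Sum>j\<in>I. x j * y j) \<le> h * (\<Sum>j\<in>I. (x j)\<^sup>2 / (4 * c) + c * (y j)\<^sup>2)"
    using h_pos by (intro mult_left_mono sum_mono mult_le_weighted_squares[OF assms]) auto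
  then show ?thesis
    by (simp add: sum.distrib sum_divide_distrib[symmetric] sum_distrib_left[symmetric] algebra_simps)
qed

text \<open>The maximal energy. Every occurrence of the energy on the right of an estimate is
  replaced by \<open>m\<close> with a small factor and absorbed, so no Gronwall argument is
  needed.\<close>

definition m :: real where "m = (SUP t\<in>{0..T}. En t)"

lemma En_le_m: "t \<in> {0..T} \<Longrightarrow> En t \<le> m"
  unfolding m_def
  by (intro cSUP_upper bounded_imp_bdd_above compact_imp_bounded compact_continuous_image AC_continuous_on[OF energy_AC]) auto

lemma m_attained: "\<exists>t\<in>{0..T}. m = En t"
proof -
  obtain t where t: "t \<in> {0..T}" "\<And>s. s \<in> {0..T} \<Longrightarrow> En s \<le> En t"
    using continuous_attains_sup[OF compact_Icc _ AC_continuous_on[OF energy_AC]] T by auto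
  have "m \<le> En t" unfolding m_def using t T by (intro cSUP_least) auto
  then show ?thesis using t En_le_m by (meson antisym)
qed

lemma m_nonneg: "m \<ge> 0"
  using En_le_m[of 0] w_bounds(1)[of 0] T by auto

text \<open>Subtracting the coupling of \<open>\<rho>\<close> with \<open>W\<close> from the energy
  turns the uncontrolled product of \<open>\<rho>\<close> with nodal velocities into one of
  \<open>\<rho>'\<close> with nodal values of \<open>W\<close>, which the discrete Poincare
  inequality controls. Young's inequality with weight 4T leaves m/(4T) in the integrand, hence m/4
  after integration; the coupling at the two end times costs m/8 each. Altogether m/2 is absorbed,
  which doubles all other constants.\<close>

lemma energy_estimate: "m \<le> 2 * En 0 + (16 + 8 * T\<^sup>2) * \<kappa>\<^sup>2 + 8 * T * Q"
proof -
  obtain t where t: "t \<in> {0..T}" "m = En t" using m_attained by blast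
  define X where "X s = En s - h * (\<Sum>j<N. \<rho> (Suc j) s * W (Suc j) s)" for s
  define X' where "X' s = h * (\<Sum>j\<le>N. mean (v s) j * mean (v' s) j) + h * (\<Sum>j\<le>N. dq h (w s) j * dq h (v s) j)
      + h * (\<Sum>j<N. \<alpha> (Suc j) * W (Suc j) s * V (Suc j) s)
      - h * (\<Sum>j<N. \<rho>' (Suc j) s * W (Suc j) s + \<rho> (Suc j) s * V (Suc j) s)" for s
  have X_AC: "AC T X X'"
    unfolding X_def X'_def by (intro AC_diff energy_AC \<rho>W_AC)
  have bound: "AE s in lebesgue_on {0..T}. X' s \<le> m / (4 * T) + 4 * T * \<kappa>\<^sup>2 + 4 * T * q s"
    using sch q_ge AE_space
  proof eventually_elim
    case (elim s)
    then have s: "s \<in> {0..T}" by simp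
    have "X' s = h * (\<Sum>j\<le>N. mean (v s) j * r j s) - h * (\<Sum>j<N. \<rho>' (Suc j) s * W (Suc j) s)"
      unfolding X'_def using energy_identity[OF elim(1), of "v s"] h_pos V_bd[of s]
      by (simp add: sum.distrib algebra_simps)
    also have "\<dots> = h * (\<Sum>j\<le>N. mean (v s) j * r j s) + h * (\<Sum>j<N. W (Suc j) s * (- \<rho>' (Suc j) s))"
      by (simp add: sum_negf mult.commute)
    also have "\<dots> \<le> (h * (\<Sum>j\<le>N. (mean (v s) j)\<^sup>2) / (4 * (4 * T)) + (4 * T) * (h * (\<Sum>j\<le>N. (r j s)\<^sup>2)))
        + (h * (\<Sum>j<N. (W (Suc j) s)\<^sup>2) / (4 * (4 * T)) + (4 * T) * (h * (\<Sum>j<N. (- \<rho>' (Suc j) s)\<^sup>2)))"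
      using T by (intro add_mono weighted_sum_le) auto
    also have "\<dots> \<le> (2 * m / (4 * (4 * T)) + (4 * T) * q s) + (2 * m / (4 * (4 * T)) + (4 * T) * \<kappa>\<^sup>2)"
      using T elim(2) En_le_m[OF s] w_bounds(3,5)[of s] \<rho>'_le[OF _ s]
      by (intro add_mono mult_left_mono divide_right_mono \<kappa>_sum) auto
    also have "\<dots> = m / (4 * T) + 4 * T * \<kappa>\<^sup>2 + 4 * T * q s" by (simp add: field_simps)
    finally show ?case .
  qed
  \<comment> \<open>A nonnegative majorant allows the integral up to \<open>t\<close> to be enlarged
    to the whole interval.\<close>
  have nn: "AE s in lebesgue_on {0..T}. 0 \<le> m / (4 * T) + 4 * T * \<kappa>\<^sup>2 + 4 * T * q s"
    using q_ge
  proof eventually_elim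
    case (elim s)
    have "0 \<le> h * (\<Sum>j\<le>N. (r j s)\<^sup>2)" using h_pos by (intro mult_nonneg_nonneg sum_nonneg) auto
    then show ?case using elim T m_nonneg by (intro add_nonneg_nonneg) auto
  qed
  interpret F: finite_measure "lebesgue_on {0..T}" by (rule finite_measure_lebesgue_on_Icc)
  have ci: "integrable (lebesgue_on {0..T}) (\<lambda>s. m / (4 * T) + 4 * T * \<kappa>\<^sup>2 + 4 * T * q s)"
    using q_int by simp
  have "X t - X 0 = integral\<^sup>L (lebesgue_on {0..t}) X'"
    by (rule AC_integral[OF X_AC t(1), symmetric])
  also have "\<dots> \<le> (\<integral>s. m / (4 * T) + 4 * T * \<kappa>\<^sup>2 + 4 * T * q s \<partial>lebesgue_on {0..T})"
  proof (rule integral_mono_lebesgue_on_AE[OF ci _ nn])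
    have "AE s in lebesgue. s \<in> {0..T} \<longrightarrow> X' s \<le> m / (4 * T) + 4 * T * \<kappa>\<^sup>2 + 4 * T * q s"
      using bound by (subst (asm) AE_restrict_space_iff) auto
    then show "AE s in lebesgue_on {0..t}. X' s \<le> m / (4 * T) + 4 * T * \<kappa>\<^sup>2 + 4 * T * q s"
      using t by (subst AE_restrict_space_iff) auto
  qed (use t in auto)
  also have "\<dots> = m / 4 + 4 * T\<^sup>2 * \<kappa>\<^sup>2 + 4 * T * Q"
    using q_int T by (simp add: measure_restrict_space power2_eq_square field_simps)
  finally have X: "X t \<le> X 0 + m / 4 + 4 * T\<^sup>2 * \<kappa>\<^sup>2 + 4 * T * Q" by simp
  have \<rho>W: "\<bar>h * (\<Sum>j<N. \<rho> (Suc j) s * W (Suc j) s)\<bar> \<le> m / 8 + 4 * \<kappa>\<^sup>2" if s: "s \<in> {0..T}" for s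
  proof -
    have "h * (\<Sum>j<N. W (Suc j) s * (c * \<rho> (Suc j) s)) \<le> m / 8 + 4 * \<kappa>\<^sup>2" if c: "\<bar>c\<bar> = 1" for c
    proof -
      have "h * (\<Sum>j<N. W (Suc j) s * (c * \<rho> (Suc j) s))
         \<le> h * (\<Sum>j<N. (W (Suc j) s)\<^sup>2) / (4 * 4) + 4 * (h * (\<Sum>j<N. (c * \<rho> (Suc j) s)\<^sup>2))"
        by (rule weighted_sum_le) simp
      also have "\<dots> \<le> (2 * m) / (4 * 4) + 4 * \<kappa>\<^sup>2"
        using En_le_m[OF s] w_bounds(5)[of s] \<rho>_le[OF _ s] c
        by (intro add_mono mult_left_mono divide_right_mono \<kappa>_sum) (auto simp: abs_mult)
      finally show ?thesis by simp
    qed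
    from this[of 1] this[of "-1"] show ?thesis by (simp add: sum_negf mult.commute abs_le_iff)
  qed
  have "m \<le> En 0 + m / 8 + 4 * \<kappa>\<^sup>2 + m / 8 + 4 * \<kappa>\<^sup>2 + m / 4 + 4 * T\<^sup>2 * \<kappa>\<^sup>2 + 4 * T * Q"
    using X \<rho>W[OF t(1)] \<rho>W[of 0] T unfolding X_def t(2) by (simp add: abs_le_iff)
  then show ?thesis by (simp add: algebra_simps)
qed

lemma mean_mean_le: "h * (\<Sum>j<N. (mean x j)\<^sup>2) \<le> h * (\<Sum>j\<le>N. (x j)\<^sup>2)"
  using sum_mean_sq_le[of x N] h_pos by (simp add: mean_def)

lemma weight_bounds: "j < N \<Longrightarrow> 0 \<le> 1 - real (Suc j) * h \<and> 1 - real (Suc j) * h \<le> 1"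
proof -
  assume "j < N"
  then have "real (Suc j) * h \<le> real (Suc N) * h" using h_pos by (intro mult_right_mono) auto
  then show ?thesis using h h_pos by (metis diff_ge_0_iff_ge diff_le_eq le_add_same_cancel1 less_imp_le mult_nonneg_nonneg of_nat_0_le_iff)
qed

text \<open>The multiplier identity is solved for the boundary term and integrated in time. Doubling
  it, the energy contributes 2m, the source and potential terms (6 + 2A^2)m plus q and \<kappa>^2
  pointwise, and the time derivative integrates to the values of \<open>Y\<close> at the two ends,
  at most 4m in all.\<close>

lemma boundary_estimate:
  "(\<integral>t. (dq h (w t) 0)\<^sup>2 + (mean (v t) 0)\<^sup>2 \<partial>lebesgue_on {0..T}) \<le> (2 * (4 + A\<^sup>2) * T + 4) * m + Q + T * \<kappa>\<^sup>2"
proof -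
  define c where "c j = 1 - real (Suc j) * h" for j
  have c: "0 \<le> c j" "c j \<le> 1" "\<bar>c j\<bar> \<le> 1" if "j < N" for j using weight_bounds[OF that] by (auto simp: c_def)
  \<comment> \<open>Discrete counterpart of the integral of (1 - x) w_t w_x, with velocity and slope
    averaged to the nodes.\<close>
  define Y where "Y t = (\<Sum>j<N. c j * (1/2) * ((mean (v t) j + mean (v t) (Suc j)) * (mean (w t) (Suc j) - mean (w t) j)))" for t
  define Y' where "Y' t = (\<Sum>j<N. c j * (1/2) * ((mean (v' t) j + mean (v' t) (Suc j)) * (mean (w t) (Suc j) - mean (w t) j)
      + (mean (v t) j + mean (v t) (Suc j)) * (mean (v t) (Suc j) - mean (v t) j)))" for t
  have Y_AC: "AC T Y Y'"
    unfolding Y_def Y'_def by (intro AC_sum AC_cmult AC_mult AC_add AC_diff mean_AC) auto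
  have Y_le: "\<bar>Y t\<bar> \<le> m" if t: "t \<in> {0..T}" for t
  proof -
    have "\<bar>Y t\<bar> \<le> (\<Sum>j<N. h * ((mean (mean (v t)) j)\<^sup>2 / 2 + (mean (dq h (w t)) j)\<^sup>2 / 2))"
      unfolding Y_def
    proof (rule order_trans[OF sum_abs sum_mono])
      fix j assume "j \<in> {..<N}"
      then have j: "j < N" by simp
      have "mean (w t) (Suc j) - mean (w t) j = h * mean (dq h (w t)) j"
        using h_pos by (simp add: mean_def dq_def field_simps)
      then have "c j * (1/2) * ((mean (v t) j + mean (v t) (Suc j)) * (mean (w t) (Suc j) - mean (w t) j))
        = c j * (h * (mean (mean (v t)) j * mean (dq h (w t)) j))"
        by (simp add: mean_def[of "mean (v t)"])
      also have "\<bar>\<dots>\<bar> \<le> 1 * (h * (\<bar>mean (mean (v t)) j * mean (dq h (w t)) j\<bar>))"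
        using c(3)[OF j] h_pos unfolding abs_mult by (intro mult_mono) auto
      also have "\<dots> \<le> h * ((mean (mean (v t)) j)\<^sup>2 / 2 + (mean (dq h (w t)) j)\<^sup>2 / 2)"
        using sum_squares_bound[of "\<bar>mean (mean (v t)) j\<bar>" "\<bar>mean (dq h (w t)) j\<bar>"] h_pos
        by (simp add: abs_mult)
      finally show "\<bar>c j * (1/2) * ((mean (v t) j + mean (v t) (Suc j)) * (mean (w t) (Suc j) - mean (w t) j))\<bar>
        \<le> h * ((mean (mean (v t)) j)\<^sup>2 / 2 + (mean (dq h (w t)) j)\<^sup>2 / 2)" .
    qed
    also have "\<dots> = (h * (\<Sum>j<N. (mean (mean (v t)) j)\<^sup>2) + h * (\<Sum>j<N. (mean (dq h (w t)) j)\<^sup>2)) / 2"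
      by (simp add: sum_distrib_left sum.distrib sum_divide_distrib add_divide_distrib distrib_left)
    also have "\<dots> \<le> (h * (\<Sum>j\<le>N. (mean (v t) j)\<^sup>2) + h * (\<Sum>j\<le>N. (dq h (w t) j)\<^sup>2)) / 2"
      by (intro divide_right_mono add_mono mean_mean_le) auto
    also have "\<dots> \<le> m" using w_bounds(2)[of t] En_le_m[OF t] by simp
    finally show ?thesis .
  qed
  have A_sq: "(\<alpha> (Suc j) * x)\<^sup>2 \<le> A\<^sup>2 * x\<^sup>2" if "j < N" for j x
    using \<alpha>_ge[OF that] \<alpha>_le[OF that] by (auto simp: power_mult_distrib intro!: mult_right_mono power_mono)
  have bound: "AE t in lebesgue_on {0..T}. (dq h (w t) 0)\<^sup>2 + (mean (v t) 0)\<^sup>2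
      \<le> 2 * (4 + A\<^sup>2) * m + \<kappa>\<^sup>2 + q t - 2 * Y' t"
    using sch q_ge AE_space
  proof eventually_elim
    case (elim t)
    then have t: "t \<in> {0..T}" by simp
    have "h * (\<Sum>j<N. c j * mean (dq h (w t)) j * (mean (\<lambda>j. r j t) j + \<rho> (Suc j) t - \<alpha> (Suc j) * W (Suc j) t))
      \<le> h * (\<Sum>j<N. 3 / 2 * (mean (dq h (w t)) j)\<^sup>2 + (mean (\<lambda>j. r j t) j)\<^sup>2 / 2 + (\<rho> (Suc j) t)\<^sup>2 / 2 + A\<^sup>2 * (W (Suc j) t)\<^sup>2 / 2)"
    proof (intro mult_left_mono sum_mono)
      fix j assume "j \<in> {..<N}"
      then have j: "j < N" by simp
      have key: "c j * a * (b1 + b2 - b3) \<le> 3 / 2 * a\<^sup>2 + b1\<^sup>2 / 2 + b2\<^sup>2 / 2 + b3\<^sup>2 / 2" for a b1 b2 b3 :: real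
      proof -
        have ab: "a * b \<le> a\<^sup>2 / 2 + b\<^sup>2 / 2" for a b :: real
          using sum_squares_bound[of a b] by simp
        have b: "c j * (a * b) \<le> a\<^sup>2 / 2 + b\<^sup>2 / 2" for b
        proof -
          have "c j * (a * b) \<le> c j * (a\<^sup>2 / 2 + b\<^sup>2 / 2)" by (intro mult_left_mono ab c j)
          also have "\<dots> \<le> 1 * (a\<^sup>2 / 2 + b\<^sup>2 / 2)" by (intro mult_right_mono c j) auto
          finally show ?thesis by simp
        qed
        have "c j * a * (b1 + b2 - b3) = c j * (a * b1) + c j * (a * b2) + c j * (a * (- b3))"
          by (simp add: algebra_simps)
        then show ?thesis using b[of b1] b[of b2] b[of "- b3"] by simp
      qed
      show "c j * mean (dq h (w t)) j * (mean (\<lambda>j. r j t) j + \<rho> (Suc j) t - \<alpha> (Suc j) * W (Suc j) t)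
         \<le> 3 / 2 * (mean (dq h (w t)) j)\<^sup>2 + (mean (\<lambda>j. r j t) j)\<^sup>2 / 2 + (\<rho> (Suc j) t)\<^sup>2 / 2 + A\<^sup>2 * (W (Suc j) t)\<^sup>2 / 2"
        using A_sq[OF j, of "W (Suc j) t"] by (intro order_trans[OF key]) simp
    qed (use h_pos in auto)
    also have "\<dots> = 3 / 2 * (h * (\<Sum>j<N. (mean (dq h (w t)) j)\<^sup>2)) + h * (\<Sum>j<N. (mean (\<lambda>j. r j t) j)\<^sup>2) / 2
        + h * (\<Sum>j<N. (\<rho> (Suc j) t)\<^sup>2) / 2 + A\<^sup>2 * (h * (\<Sum>j<N. (W (Suc j) t)\<^sup>2)) / 2"
      by (simp add: sum.distrib sum_distrib_left sum_divide_distrib algebra_simps)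
    also have "\<dots> \<le> 3 / 2 * (2 * m) + q t / 2 + \<kappa>\<^sup>2 / 2 + A\<^sup>2 * (2 * m) / 2"
      using w_bounds(4,5)[of t] En_le_m[OF t] elim(2) mean_mean_le[of "dq h (w t)"] mean_mean_le[of "\<lambda>j. r j t"] \<rho>_le[OF _ t]
      by (intro add_mono mult_left_mono divide_right_mono \<kappa>_sum) auto
    finally have 1: "h * (\<Sum>j<N. c j * mean (dq h (w t)) j * (mean (\<lambda>j. r j t) j + \<rho> (Suc j) t - \<alpha> (Suc j) * W (Suc j) t))
      \<le> (3 + A\<^sup>2) * m + q t / 2 + \<kappa>\<^sup>2 / 2" by (simp add: algebra_simps)
    have 2: "Y' t = 1/2 * (h * (\<Sum>j\<le>N. (dq h (w t) j)\<^sup>2) + h * (\<Sum>j\<le>N. (mean (v t) j)\<^sup>2)) - 1/2 * ((dq h (w t) 0)\<^sup>2 + (mean (v t) 0)\<^sup>2)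
     + h * (\<Sum>j<N. c j * mean (dq h (w t)) j * (mean (\<lambda>j. r j t) j + \<rho> (Suc j) t - \<alpha> (Suc j) * W (Suc j) t))"
      unfolding Y'_def c_def by (rule multiplier_identity[OF elim(1) h])
    show ?case using 1 2 w_bounds(2)[of t] En_le_m[OF t] by (simp add: algebra_simps)
  qed
  interpret F: finite_measure "lebesgue_on {0..T}" by (rule finite_measure_lebesgue_on_Icc)
  have "(\<integral>t. (dq h (w t) 0)\<^sup>2 + (mean (v t) 0)\<^sup>2 \<partial>lebesgue_on {0..T})
     \<le> (\<integral>t. 2 * (4 + A\<^sup>2) * m + \<kappa>\<^sup>2 + q t - 2 * Y' t \<partial>lebesgue_on {0..T})"
  proof (rule integral_mono_AE[OF _ _ bound])
    show "integrable (lebesgue_on {0..T}) (\<lambda>t. (dq h (w t) 0)\<^sup>2 + (mean (v t) 0)\<^sup>2)"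
      by (intro continuous_on_integrable_Icc continuous_intros AC_continuous_on[OF dq_AC] AC_continuous_on[OF mean_AC(2)]) auto
    show "integrable (lebesgue_on {0..T}) (\<lambda>t. 2 * (4 + A\<^sup>2) * m + \<kappa>\<^sup>2 + q t - 2 * Y' t)"
      using q_int AC_integrable[OF Y_AC] by simp
  qed
  also have "\<dots> = T * (2 * (4 + A\<^sup>2) * m + \<kappa>\<^sup>2) + Q - 2 * (Y T - Y 0)"
    using q_int AC_integrable[OF Y_AC] AC_integral[OF Y_AC, of T] T
    by (simp add: measure_restrict_space)
  also have "\<dots> \<le> T * (2 * (4 + A\<^sup>2) * m + \<kappa>\<^sup>2) + Q + 4 * m"
    using Y_le[of T] Y_le[of 0] T by (simp add: abs_le_iff)
  finally show ?thesis by (simp add: algebra_simps)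
qed

theorem direct_inequality:
  assumes "E0 \<ge> En 0"
  shows "(\<integral>t. (dq h (w t) 0)\<^sup>2 + (mean (v t) 0)\<^sup>2 \<partial>lebesgue_on {0..T})
    \<le> ((2 * (4 + A\<^sup>2) * T + 4) * (18 + 8 * T\<^sup>2 + 8 * T) + 1 + T) * (E0 + \<kappa>\<^sup>2 + Q)"
proof -
  have Q: "Q \<ge> 0"
  proof (rule integral_nonneg_AE)
    show "AE t in lebesgue_on {0..T}. 0 \<le> q t"
      using q_ge
    proof eventually_elim
      case (elim t)
      have "0 \<le> h * (\<Sum>j\<le>N. (r j t)\<^sup>2)" using h_pos by (intro mult_nonneg_nonneg sum_nonneg) auto
      then show ?case using elim by linarith
    qed
  qed
  have E0: "E0 \<ge> 0" using assms w_bounds(1)[of 0] by simp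
  define S where "S = E0 + \<kappa>\<^sup>2 + Q"
  have S: "E0 \<le> S" "\<kappa>\<^sup>2 \<le> S" "Q \<le> S" "0 \<le> S" using E0 Q unfolding S_def by auto
  have "m \<le> 2 * E0 + (16 + 8 * T\<^sup>2) * \<kappa>\<^sup>2 + 8 * T * Q" using energy_estimate assms by simp
  also have "\<dots> \<le> 2 * S + (16 + 8 * T\<^sup>2) * S + 8 * T * S"
    using S T by (intro add_mono mult_left_mono) auto
  finally have m: "m \<le> (18 + 8 * T\<^sup>2 + 8 * T) * S" by (simp add: algebra_simps)
  have "(2 * (4 + A\<^sup>2) * T + 4) * m + Q + T * \<kappa>\<^sup>2 \<le> (2 * (4 + A\<^sup>2) * T + 4) * ((18 + 8 * T\<^sup>2 + 8 * T) * S) + S + T * S"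
    using m S T by (intro add_mono mult_left_mono) auto
  then show ?thesis using boundary_estimate unfolding S_def by (simp add: algebra_simps)
qed

end

section \<open>Sine and cosine expansions\<close>

abbreviation (input) "unitM \<equiv> lebesgue_on {0..1::real}"

lemma L2norm2_nonneg: "0 \<le> L2norm2 S f"
  by (simp add: L2norm2_def integral_nonneg_AE)

lemma L2on_integrable_mult: "L2on S u \<Longrightarrow> L2on S v \<Longrightarrow> integrable (lebesgue_on S) (\<lambda>x. u x * v x)"
  by (simp add: L2on_iff_sqint sqint_integrable_mult)

lemma L2on_integrable_ip: "L2on S u \<Longrightarrow> L2on S v \<Longrightarrow> integrable (lebesgue_on S) (\<lambda>x. u x * cnj (v x))"
  by (auto simp: L2on_iff_sqint intro: sqint_integrable_mult)

lemma L2on_add [intro]: "L2on S u \<Longrightarrow> L2on S v \<Longrightarrow> L2on S (\<lambda>x. u x + v x)"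
  and L2on_diff [intro]: "L2on S u \<Longrightarrow> L2on S v \<Longrightarrow> L2on S (\<lambda>x. u x - v x)"
  and L2on_cmult [intro]: "L2on S u \<Longrightarrow> L2on S (\<lambda>x. c * u x)"
  by (auto simp: L2on_iff_sqint)

lemma L2on_sum [intro]: "(\<And>i. i \<in> I \<Longrightarrow> L2on S (u i)) \<Longrightarrow> L2on S (\<lambda>x. \<Sum>i\<in>I. u i x)"
  by (auto simp: L2on_iff_sqint)

lemma L2on_continuous:
  assumes "continuous_on {a..b} u" shows "L2on {a..b} u"
  unfolding L2on_def
  by (intro conjI continuous_imp_measurable_on_sets_lebesgue continuous_on_integrable_Icc continuous_intros assms) auto

lemma L2on_subset:
  assumes "L2on T f" "S \<subseteq> T" "S \<in> sets lebesgue" "T \<in> sets lebesgue"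
  shows "L2on S f"
  unfolding L2on_def
proof
  show "f \<in> borel_measurable (lebesgue_on S)"
    by (rule measurable_lebesgue_on_subset[OF _ assms(2-4)]) (use assms(1) in \<open>simp add: L2on_def\<close>)
  show "integrable (lebesgue_on S) (\<lambda>x. (cmod (f x))\<^sup>2)"
    by (rule integrable_lebesgue_on_subset[OF _ assms(2-4)]) (use assms(1) in \<open>simp add: L2on_def\<close>)
qed

lemma L2on_integrable: "L2on {a..b} u \<Longrightarrow> integrable (lebesgue_on {a..b}) u"
  using finite_measure.sqint_integrable[OF finite_measure_lebesgue_on_Icc] by (auto simp: L2on_iff_sqint)

lemma L2norm2_add_le: "L2on S u \<Longrightarrow> L2on S v \<Longrightarrow> L2norm2 S (\<lambda>x. u x + v x) \<le> 2 * L2norm2 S u + 2 * L2norm2 S v"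
  by (simp add: L2on_iff_sqint L2norm2_def sqint_norm2_add_le)

lemma L2norm2_triangle:
  assumes "L2on S u" "L2on S v" "L2on S w"
  shows "L2norm2 S (\<lambda>x. u x - w x) \<le> 2 * L2norm2 S (\<lambda>x. u x - v x) + 2 * L2norm2 S (\<lambda>x. v x - w x)"
  using L2norm2_add_le[OF L2on_diff[OF assms(1,2)] L2on_diff[OF assms(2,3)]] by simp

lemma L2ip_Cauchy_Schwarz: "L2on {0..1} u \<Longrightarrow> L2on {0..1} v \<Longrightarrow> (cmod (L2ip u v))\<^sup>2 \<le> L2norm2 {0..1} u * L2norm2 {0..1} v"
  using Cauchy_Schwarz_sqint[of unitM u "\<lambda>x. cnj (v x)"] by (auto simp: L2on_iff_sqint L2ip_def L2norm2_def)

lemma L2ip_diff_left: "L2on {0..1} u \<Longrightarrow> L2on {0..1} v \<Longrightarrow> L2on {0..1} w \<Longrightarrow> L2ip (\<lambda>x. u x - v x) w = L2ip u w - L2ip v w"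
  by (simp add: L2ip_def left_diff_distrib L2on_integrable_ip)

lemma L2ip_cmult_left: "L2ip (\<lambda>x. c * u x) v = c * L2ip u v"
  by (simp add: L2ip_def mult.assoc)

lemma L2ip_cmult_right: "L2ip u (\<lambda>x. r * v x) = cnj r * L2ip u v"
  by (simp add: L2ip_def mult.left_commute)

lemma L2ip_cnj: "cnj (L2ip u v) = L2ip v u"
proof -
  have "cnj (L2ip u v) = (\<integral>x. cnj (u x * cnj (v x)) \<partial>unitM)"
    unfolding L2ip_def
    by (rule integral_bounded_linear'[OF bounded_linear_cnj bounded_linear_cnj, symmetric]) simp
  then show ?thesis by (simp add: L2ip_def mult.commute)
qed

lemma L2ip_sum_left:
  assumes "\<And>i. i \<in> I \<Longrightarrow> L2on {0..1} (u i)" "L2on {0..1} v"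
  shows "L2ip (\<lambda>x. \<Sum>i\<in>I. u i x) v = (\<Sum>i\<in>I. L2ip (u i) v)"
  unfolding L2ip_def using assms
  by (simp add: sum_distrib_right L2on_integrable_ip Bochner_Integration.integral_sum)

lemma L2ip_self: "L2on {0..1} u \<Longrightarrow> L2ip u u = complex_of_real (L2norm2 {0..1} u)"
  unfolding L2ip_def L2norm2_def complex_norm_square[symmetric]
  by (simp add: complex_norm_square[symmetric] flip: of_real_power)

lemma L2norm2_diff_expand:
  assumes "L2on {0..1} u" "L2on {0..1} v"
  shows "L2norm2 {0..1} (\<lambda>x. u x - v x) = L2norm2 {0..1} u - 2 * Re (L2ip u v) + L2norm2 {0..1} v"
proof -
  have "L2norm2 {0..1} (\<lambda>x. u x - v x) = (\<integral>x. (cmod (u x))\<^sup>2 - 2 * Re (u x * cnj (v x)) + (cmod (v x))\<^sup>2 \<partial>unitM)"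
    unfolding L2norm2_def
    by (intro Bochner_Integration.integral_cong refl, subst (1 2 3) cmod_power2)
      (simp add: power2_eq_square algebra_simps)
  also have "\<dots> = L2norm2 {0..1} u - 2 * Re (L2ip u v) + L2norm2 {0..1} v"
    using assms integrable_Re[OF L2on_integrable_ip[OF assms]]
    unfolding L2norm2_def L2ip_def L2on_def integral_Re[OF L2on_integrable_ip[OF assms], symmetric]
    by (simp del: times_complex.sel)
  finally show ?thesis .
qed

section \<open>Projections onto orthonormal systems\<close>

locale orthonormal_L2 =
  fixes \<phi> :: "nat \<Rightarrow> real \<Rightarrow> complex"
  assumes L2: "\<And>k. L2on {0..1} (\<phi> k)"
    and orthonormal: "\<And>j k. L2ip (\<phi> j) (\<phi> k) = (if j = k then 1 else 0)"
begin

definition proj :: "nat \<Rightarrow> (real \<Rightarrow> complex) \<Rightarrow> real \<Rightarrow> complex" where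
  "proj n u x = (\<Sum>k<n. L2ip u (\<phi> k) * \<phi> k x)"

lemma L2_lincomb: "L2on {0..1} (\<lambda>x. \<Sum>k<n. b k * \<phi> k x)"
  by (intro L2on_sum L2on_cmult L2)

lemma L2_proj: "L2on {0..1} (proj n u)"
  unfolding proj_def[abs_def] by (rule L2_lincomb)

lemma ip_lincomb_left:
  assumes "L2on {0..1} v"
  shows "L2ip (\<lambda>x. \<Sum>k<n. b k * \<phi> k x) v = (\<Sum>k<n. b k * L2ip (\<phi> k) v)"
  by (subst L2ip_sum_left) (auto intro: L2 assms simp: L2ip_cmult_left)

lemma norm2_lincomb: "L2norm2 {0..1} (\<lambda>x. \<Sum>k<n. b k * \<phi> k x) = (\<Sum>k<n. (cmod (b k))\<^sup>2)"
proof -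
  have "L2ip (\<phi> k) (\<lambda>x. \<Sum>k<n. b k * \<phi> k x) = cnj (b k)" if "k < n" for k
  proof -
    have "L2ip (\<lambda>x. \<Sum>k<n. b k * \<phi> k x) (\<phi> k) = b k"
      using that by (simp add: ip_lincomb_left L2 orthonormal if_distrib[of "\<lambda>x. _ * x"] cong: if_cong)
    then show ?thesis using L2ip_cnj by metis
  qed
  then have "complex_of_real (L2norm2 {0..1} (\<lambda>x. \<Sum>k<n. b k * \<phi> k x)) = (\<Sum>k<n. b k * cnj (b k))"
    by (subst L2ip_self[symmetric]) (auto simp: L2_lincomb ip_lincomb_left)
  then have "complex_of_real (L2norm2 {0..1} (\<lambda>x. \<Sum>k<n. b k * \<phi> k x)) = complex_of_real (\<Sum>k<n. (cmod (b k))\<^sup>2)"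
    by (simp only: complex_norm_square[symmetric] of_real_sum of_real_power)
  then show ?thesis using of_real_eq_iff by blast
qed

text \<open>Completing the square in each coefficient. With the Fourier coefficients the last sum
  vanishes, giving the projection error; with arbitrary ones it shows that the projection is the
  best approximation.\<close>

lemma norm2_minus_lincomb:
  assumes u: "L2on {0..1} u"
  shows "L2norm2 {0..1} (\<lambda>x. u x - (\<Sum>k<n. b k * \<phi> k x))
    = L2norm2 {0..1} u - (\<Sum>k<n. (cmod (L2ip u (\<phi> k)))\<^sup>2) + (\<Sum>k<n. (cmod (b k - L2ip u (\<phi> k)))\<^sup>2)"
proof -
  have "L2ip u (\<lambda>x. \<Sum>k<n. b k * \<phi> k x) = cnj (\<Sum>k<n. b k * L2ip (\<phi> k) u)"
    by (metis L2ip_cnj ip_lincomb_left[OF u])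
  also have "\<dots> = (\<Sum>k<n. cnj (b k) * L2ip u (\<phi> k))"
    by (simp add: L2ip_cnj)
  finally have "L2norm2 {0..1} (\<lambda>x. u x - (\<Sum>k<n. b k * \<phi> k x))
    = L2norm2 {0..1} u - 2 * Re (\<Sum>k<n. cnj (b k) * L2ip u (\<phi> k)) + (\<Sum>k<n. (cmod (b k))\<^sup>2)"
    using L2norm2_diff_expand[OF u L2_lincomb[of b n]] by (simp add: norm2_lincomb)
  moreover have "(cmod (b k - L2ip u (\<phi> k)))\<^sup>2 = (cmod (b k))\<^sup>2 - 2 * Re (cnj (b k) * L2ip u (\<phi> k)) + (cmod (L2ip u (\<phi> k)))\<^sup>2" for k
    by (subst (1 2 3) cmod_power2) (simp add: power2_eq_square algebra_simps)
  ultimately show ?thesis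
    by (simp add: sum.distrib sum_subtractf sum_distrib_left)
qed

lemma norm2_minus_proj:
  "L2on {0..1} u \<Longrightarrow> L2norm2 {0..1} (\<lambda>x. u x - proj n u x) = L2norm2 {0..1} u - (\<Sum>k<n. (cmod (L2ip u (\<phi> k)))\<^sup>2)"
  unfolding proj_def by (subst norm2_minus_lincomb) auto

lemma norm2_minus_proj_le: "L2on {0..1} u \<Longrightarrow> L2norm2 {0..1} (\<lambda>x. u x - proj n u x) \<le> L2norm2 {0..1} u"
  by (simp add: norm2_minus_proj sum_nonneg)

lemma norm2_proj_le: "L2on {0..1} u \<Longrightarrow> L2norm2 {0..1} (proj n u) \<le> L2norm2 {0..1} u"
  using norm2_minus_proj[of u n] L2norm2_nonneg[of "{0..1}" "\<lambda>x. u x - proj n u x"]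
  unfolding proj_def[abs_def] norm2_lincomb by simp

end

definition in_span :: "(nat \<Rightarrow> real \<Rightarrow> complex) \<Rightarrow> (real \<Rightarrow> complex) \<Rightarrow> bool" where
  "in_span \<phi> f \<longleftrightarrow> (\<exists>n b. \<forall>x. f x = (\<Sum>k<n. b k * \<phi> k x))"

lemma in_span_base: "in_span \<phi> (\<phi> k)"
  unfolding in_span_def
  by (rule exI[of _ "Suc k"], rule exI[of _ "\<lambda>j. if j = k then 1 else 0"]) (simp add: if_distrib[of "\<lambda>x. x * _"] cong: if_cong)

lemma in_span_cmult: "in_span \<phi> f \<Longrightarrow> in_span \<phi> (\<lambda>x. c * f x)"
proof -
  assume "in_span \<phi> f"
  then obtain n b where "\<And>x. f x = (\<Sum>k<n. b k * \<phi> k x)" unfolding in_span_def by blast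
  then have "\<forall>x. c * f x = (\<Sum>k<n. (c * b k) * \<phi> k x)" by (simp add: sum_distrib_left mult.assoc)
  then show ?thesis unfolding in_span_def by (intro exI)
qed

lemma in_span_pad:
  fixes n m :: nat
  assumes "n \<le> m" shows "(\<Sum>k<n. b k * \<phi> k x) = (\<Sum>k<m. (if k < n then b k else 0) * (\<phi> k x :: complex))"
proof (rule sum.mono_neutral_cong_left)
  show "{..<n} \<subseteq> {..<m}" using assms by auto
qed auto

lemma in_span_add: "in_span \<phi> f \<Longrightarrow> in_span \<phi> g \<Longrightarrow> in_span \<phi> (\<lambda>x. f x + g x)"
proof -
  assume "in_span \<phi> f" "in_span \<phi> g"
  then obtain n b m c where *: "\<And>x. f x = (\<Sum>k<n. b k * \<phi> k x)" "\<And>x. g x = (\<Sum>k<m. c k * \<phi> k x)"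
    unfolding in_span_def by metis
  have "f x + g x = (\<Sum>k<max n m. ((if k < n then b k else 0) + (if k < m then c k else 0)) * \<phi> k x)" for x
    unfolding * in_span_pad[of n "max n m", OF max.cobounded1] in_span_pad[of m "max n m", OF max.cobounded2]
    by (simp add: sum.distrib distrib_right)
  then show ?thesis unfolding in_span_def by (intro exI allI)
qed

lemma in_span_zero: "in_span \<phi> (\<lambda>x. 0)"
  unfolding in_span_def by (rule exI[of _ 0]) simp

lemma in_span_sum: "(\<And>i. i \<in> I \<Longrightarrow> in_span \<phi> (f i)) \<Longrightarrow> in_span \<phi> (\<lambda>x. \<Sum>i\<in>I. f i x)"
  by (induction I rule: infinite_finite_induct) (auto intro: in_span_add in_span_zero)

lemma in_span_mult_closed:
  assumes "\<And>k. in_span \<psi> (\<lambda>x. g x * \<phi> k x)" "in_span \<phi> f"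
  shows "in_span \<psi> (\<lambda>x. g x * f x)"
proof -
  obtain n b where f: "\<And>x. f x = (\<Sum>k<n. b k * \<phi> k x)" using assms(2) unfolding in_span_def by blast
  have "in_span \<psi> (\<lambda>x. \<Sum>k<n. b k * (g x * \<phi> k x))"
    by (intro in_span_sum in_span_cmult assms)
  then show ?thesis by (simp add: f sum_distrib_left algebra_simps)
qed

locale complete_orthonormal_L2 = orthonormal_L2 +
  assumes dense: "\<And>u e. L2on {0..1} u \<Longrightarrow> e > 0 \<Longrightarrow> \<exists>f. in_span \<phi> f \<and> L2norm2 {0..1} (\<lambda>x. u x - f x) < e"
begin

text \<open>The projection of rank m beats every combination of the first n \<le> m members, because
  its error decreases with the rank and is minimal at each rank; density supplies a good
  combination.\<close>

lemma proj_tendsto: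
  assumes u: "L2on {0..1} u"
  shows "(\<lambda>n. L2norm2 {0..1} (\<lambda>x. u x - proj n u x)) \<longlonglongrightarrow> 0"
proof (rule LIMSEQ_I)
  fix e :: real assume "e > 0"
  then obtain f where f: "in_span \<phi> f" "L2norm2 {0..1} (\<lambda>x. u x - f x) < e" using dense[OF u] by blast
  then obtain n b where b: "\<And>x. f x = (\<Sum>k<n. b k * \<phi> k x)" unfolding in_span_def by blast
  have "norm (L2norm2 {0..1} (\<lambda>x. u x - proj m u x) - 0) < e" if m: "m \<ge> n" for m
  proof -
    have "L2norm2 {0..1} (\<lambda>x. u x - proj m u x) \<le> L2norm2 {0..1} u - (\<Sum>k<n. (cmod (L2ip u (\<phi> k)))\<^sup>2)"
      unfolding norm2_minus_proj[OF u] using m by (intro diff_left_mono sum_mono2) auto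
    also have "\<dots> \<le> L2norm2 {0..1} (\<lambda>x. u x - f x)"
      unfolding b norm2_minus_lincomb[OF u] by (simp add: sum_nonneg)
    finally show ?thesis using f L2norm2_nonneg[of "{0..1}" "\<lambda>x. u x - proj m u x"] by simp
  qed
  then show "\<exists>no. \<forall>n\<ge>no. norm (L2norm2 {0..1} (\<lambda>x. u x - proj n u x) - 0) < e" by blast
qed

lemma ip_proj_tendsto:
  assumes u: "L2on {0..1} u" and v: "L2on {0..1} v"
  shows "(\<lambda>n. L2ip (proj n u) v) \<longlonglongrightarrow> L2ip u v"
proof -
  have "(\<lambda>n. L2norm2 {0..1} (\<lambda>x. u x - proj n u x) * L2norm2 {0..1} v) \<longlonglongrightarrow> 0 * L2norm2 {0..1} v"
    by (intro tendsto_intros proj_tendsto u)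
  then have "(\<lambda>n. L2norm2 {0..1} (\<lambda>x. u x - proj n u x) * L2norm2 {0..1} v) \<longlonglongrightarrow> 0" by simp
  then have "(\<lambda>n. (cmod (L2ip (proj n u) v - L2ip u v))\<^sup>2) \<longlonglongrightarrow> 0"
  proof (rule tendsto_sandwich[OF _ _ tendsto_const, rotated 2])
    show "\<forall>\<^sub>F n in sequentially. (cmod (L2ip (proj n u) v - L2ip u v))\<^sup>2 \<le> L2norm2 {0..1} (\<lambda>x. u x - proj n u x) * L2norm2 {0..1} v"
      using L2ip_Cauchy_Schwarz[OF L2on_diff[OF u L2_proj] v]
      by (simp add: L2ip_diff_left[OF u L2_proj v] norm_minus_commute)
  qed simp
  then have "(\<lambda>n. sqrt ((cmod (L2ip (proj n u) v - L2ip u v))\<^sup>2)) \<longlonglongrightarrow> sqrt 0"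
    by (intro tendsto_intros)
  then show ?thesis by (simp add: LIM_zero_iff tendsto_norm_zero_iff)
qed

end


section \<open>Orthonormality and completeness of sines and cosines\<close>

lemma integral_cos_int:
  "(\<integral>x. cos (real_of_int k * pi * x) \<partial>lebesgue_on {0..1}) = (if k = 0 then 1 else 0)"
proof (cases "k = 0")
  case True then show ?thesis by (simp add: measure_restrict_space)
next
  case False
  have "((\<lambda>x. cos (real_of_int k * pi * x)) has_integral
      (sin (real_of_int k * pi * 1) / (real_of_int k * pi) - sin (real_of_int k * pi * 0) / (real_of_int k * pi))) {0..1}"
    using False
    by (intro fundamental_theorem_of_calculus) (auto intro!: derivative_eq_intros simp: has_real_derivative_iff_has_vector_derivative[symmetric])
  then have "integral {0..1} (\<lambda>x. cos (real_of_int k * pi * x)) = 0"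
    by (simp add: integral_unique sin_times_pi_eq_0)
  then show ?thesis
    using False by (subst lebesgue_integral_eq_integral)
      (auto intro!: continuous_on_integrable_Icc continuous_intros)
qed

definition freq :: "nat \<Rightarrow> real" where "freq k = real (Suc k) * pi"

definition sn :: "nat \<Rightarrow> real \<Rightarrow> complex" where
  "sn k x = complex_of_real (sqrt 2 * sin (freq k * x))"

text \<open>The shift of index makes \<open>cs (Suc k)\<close> the partner of \<open>sn k\<close>
  under differentiation, with frequency (k+1) pi; \<open>cs 0\<close> spans the constants, which are
  orthogonal to derivatives of functions vanishing at both ends.\<close>

definition cs :: "nat \<Rightarrow> real \<Rightarrow> complex" where
  "cs k x = (case k of 0 \<Rightarrow> 1 | Suc i \<Rightarrow> complex_of_real (sqrt 2 * cos (freq i * x)))"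

lemma cs_0 [simp]: "cs 0 x = 1" and cs_Suc: "cs (Suc k) x = complex_of_real (sqrt 2 * cos (freq k * x))"
  by (auto simp: cs_def)

lemma cnj_sn [simp]: "cnj (sn k x) = sn k x" and cnj_cs [simp]: "cnj (cs k x) = cs k x"
  by (auto simp: sn_def cs_def split: nat.split)

lemma continuous_on_sn: "continuous_on S (sn k)"
  unfolding sn_def[abs_def] by (intro continuous_intros)

lemma continuous_on_cs: "continuous_on S (cs k)"
  unfolding cs_def[abs_def] by (cases k) (auto intro!: continuous_intros)

lemma freq_pos: "freq k > 0"
  by (simp add: freq_def)

lemma integrable_cos_int: "integrable (lebesgue_on {0..1}) (\<lambda>x. cos (real_of_int k * pi * x))"
  by (intro continuous_on_integrable_Icc continuous_intros)

interpretation SN: orthonormal_L2 sn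
proof
  show "L2on {0..1} (sn k)" for k by (intro L2on_continuous continuous_on_sn)
  show "L2ip (sn j) (sn k) = (if j = k then 1 else 0)" for j k
  proof -
    have "sn j x * cnj (sn k x) = complex_of_real (cos (real_of_int (int j - int k) * pi * x) - cos (real_of_int (int j + int k + 2) * pi * x))" for x
    proof -
      have "sn j x * cnj (sn k x) = complex_of_real (2 * (sin (freq j * x) * sin (freq k * x)))"
        by (simp add: sn_def flip: of_real_mult)
      also have "2 * (sin (freq j * x) * sin (freq k * x)) = cos (freq j * x - freq k * x) - cos (freq j * x + freq k * x)"
        by (simp add: cos_diff cos_add)
      also have "freq j * x - freq k * x = real_of_int (int j - int k) * pi * x" by (simp add: freq_def algebra_simps)
      also have "freq j * x + freq k * x = real_of_int (int j + int k + 2) * pi * x" by (simp add: freq_def algebra_simps)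
      finally show ?thesis .
    qed
    then have "L2ip (sn j) (sn k) = complex_of_real (\<integral>x. cos (real_of_int (int j - int k) * pi * x) - cos (real_of_int (int j + int k + 2) * pi * x) \<partial>lebesgue_on {0..1})"
      unfolding L2ip_def by (simp only: integral_complex_of_real)
    also have "\<dots> = (if j = k then 1 else 0)"
      by (subst Bochner_Integration.integral_diff[OF integrable_cos_int integrable_cos_int]) (simp only: integral_cos_int, auto)
    finally show ?thesis .
  qed
qed

interpretation CS: orthonormal_L2 cs
proof
  show "L2on {0..1} (cs k)" for k by (intro L2on_continuous continuous_on_cs)
  show "L2ip (cs j) (cs k) = (if j = k then 1 else 0)" for j k
  proof -
    define d where "d k = (if k = 0 then 1 else sqrt 2)" for k :: nat
    have cs: "cs k x = complex_of_real (d k * cos (real k * pi * x))" for k x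
      by (cases k) (auto simp: cs_Suc d_def freq_def)
    have "cs j x * cnj (cs k x) = complex_of_real (d j * d k / 2 * (cos (real_of_int (int j - int k) * pi * x) + cos (real_of_int (int j + int k) * pi * x)))" for x
    proof -
      have "cs j x * cnj (cs k x) = complex_of_real (d j * d k / 2 * (2 * (cos (real j * pi * x) * cos (real k * pi * x))))"
        unfolding cs by simp
      also have "2 * (cos (real j * pi * x) * cos (real k * pi * x)) = cos (real j * pi * x - real k * pi * x) + cos (real j * pi * x + real k * pi * x)"
        by (simp add: cos_diff cos_add)
      also have "real j * pi * x - real k * pi * x = real_of_int (int j - int k) * pi * x" by (simp add: algebra_simps)
      also have "real j * pi * x + real k * pi * x = real_of_int (int j + int k) * pi * x" by (simp add: algebra_simps)
      finally show ?thesis .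
    qed
    then have "L2ip (cs j) (cs k) = complex_of_real (\<integral>x. d j * d k / 2 * (cos (real_of_int (int j - int k) * pi * x) + cos (real_of_int (int j + int k) * pi * x)) \<partial>lebesgue_on {0..1})"
      unfolding L2ip_def by (simp only: integral_complex_of_real)
    also have "(\<integral>x. d j * d k / 2 * (cos (real_of_int (int j - int k) * pi * x) + cos (real_of_int (int j + int k) * pi * x)) \<partial>lebesgue_on {0..1})
       = d j * d k / 2 * ((if int j - int k = 0 then 1 else 0) + (if int j + int k = 0 then 1 else 0))"
      using integrable_cos_int[of "int j - int k"] integrable_cos_int[of "int j + int k"]
      by (subst Bochner_Integration.integral_mult_right_zero, subst Bochner_Integration.integral_add) (simp_all only: integral_cos_int)
    also have "complex_of_real \<dots> = (if j = k then 1 else 0)"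
      by (auto simp: d_def simp flip: of_real_mult)
    finally show ?thesis .
  qed
qed

text \<open>Product-to-sum shifts the frequency up and down by one. The cases are separated because
  the constant function is normalised without the factor sqrt 2.\<close>

lemma cos_span_mult_cos:
  assumes "in_span cs f" shows "in_span cs (\<lambda>x. complex_of_real (cos (pi * x)) * f x)"
proof (rule in_span_mult_closed[OF _ assms])
  fix k
  show "in_span cs (\<lambda>x. complex_of_real (cos (pi * x)) * cs k x)"
  proof (cases k)
    case 0
    have "complex_of_real (cos (pi * x)) * cs k x = complex_of_real (1 / sqrt 2) * cs 1 x" for x
      using 0 cs_Suc[of 0 x] by (simp add: freq_def)
    then show ?thesis using in_span_cmult[OF in_span_base[of cs 1], of "complex_of_real (1 / sqrt 2)"] by simp
  next
    case (Suc i)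
    have s: "cos (pi * x) * cos (freq i * x) = (cos (freq (Suc i) * x) + cos (real i * pi * x)) / 2" for x
      using cos_times_cos[of "freq i * x" "pi * x"] by (simp add: freq_def algebra_simps)
    show ?thesis
    proof (cases i)
      case 0
      have eq: "complex_of_real (cos (pi * x)) * cs k x = complex_of_real (1/2) * cs 2 x + complex_of_real (sqrt 2 / 2) * cs 0 x" for x
      proof -
        have "cos (pi * x) * (sqrt 2 * cos (freq i * x)) = 1/2 * (sqrt 2 * cos (freq 1 * x)) + sqrt 2 / 2 * 1"
          using arg_cong[OF s[of x], of "\<lambda>z. sqrt 2 * z"] 0 by (simp add: field_simps)
        then have "complex_of_real (cos (pi * x) * (sqrt 2 * cos (freq i * x))) = complex_of_real (1/2 * (sqrt 2 * cos (freq 1 * x)) + sqrt 2 / 2 * 1)"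
          by simp
        then show ?thesis unfolding \<open>k = Suc i\<close> cs_Suc numeral_2_eq_2 One_nat_def[symmetric] of_real_mult of_real_add of_real_1 cs_0 .
      qed
      show ?thesis unfolding eq by (intro in_span_add in_span_cmult in_span_base)
    next
      case (Suc l)
      have eq: "complex_of_real (cos (pi * x)) * cs k x = complex_of_real (1/2) * cs (Suc k) x + complex_of_real (1/2) * cs i x" for x
      proof -
        have "cos (real i * pi * x) = cos (freq l * x)" using Suc by (simp add: freq_def)
        then have "cos (pi * x) * (sqrt 2 * cos (freq i * x)) = 1/2 * (sqrt 2 * cos (freq (Suc i) * x)) + 1/2 * (sqrt 2 * cos (freq l * x))"
          using arg_cong[OF s[of x], of "\<lambda>z. sqrt 2 * z"] by (simp add: field_simps)
        then have "complex_of_real (cos (pi * x) * (sqrt 2 * cos (freq i * x))) = complex_of_real (1/2 * (sqrt 2 * cos (freq (Suc i) * x)) + 1/2 * (sqrt 2 * cos (freq l * x)))"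
          by simp
        then show ?thesis unfolding \<open>k = Suc i\<close> Suc cs_Suc of_real_mult of_real_add .
      qed
      show ?thesis unfolding eq by (intro in_span_add in_span_cmult in_span_base)
    qed
  qed
qed

text \<open>Here product-to-sum yields differences of sines. This is the bridge by which density of
  cosines is transferred to sines.\<close>

lemma sin_mult_cos_span:
  assumes "in_span cs f" shows "in_span sn (\<lambda>x. complex_of_real (sin (pi * x)) * f x)"
proof (rule in_span_mult_closed[OF _ assms])
  fix k
  show "in_span sn (\<lambda>x. complex_of_real (sin (pi * x)) * cs k x)"
  proof (cases k)
    case 0
    have "complex_of_real (sin (pi * x)) * cs k x = complex_of_real (1 / sqrt 2) * sn 0 x" for x
      using 0 by (simp add: sn_def freq_def)
    then show ?thesis using in_span_cmult[OF in_span_base[of sn 0], of "complex_of_real (1 / sqrt 2)"] by simp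
  next
    case (Suc i)
    have s: "sin (pi * x) * cos (freq i * x) = (sin (freq (Suc i) * x) - sin (real i * pi * x)) / 2" for x
      using sin_times_cos[of "pi * x" "freq i * x"] sin_minus[of "real i * pi * x"] by (simp add: freq_def algebra_simps)
    show ?thesis
    proof (cases i)
      case 0
      have eq: "complex_of_real (sin (pi * x)) * cs k x = complex_of_real (1/2) * sn 1 x" for x
      proof -
        have "sin (pi * x) * (sqrt 2 * cos (freq i * x)) = 1/2 * (sqrt 2 * sin (freq 1 * x))"
          using s[of x] 0 by simp
        then have "complex_of_real (sin (pi * x) * (sqrt 2 * cos (freq i * x))) = complex_of_real (1/2 * (sqrt 2 * sin (freq 1 * x)))"
          by (simp only:)
        then show ?thesis unfolding \<open>k = Suc i\<close> cs_Suc sn_def of_real_mult .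
      qed
      show ?thesis unfolding eq by (intro in_span_cmult in_span_base)
    next
      case (Suc l)
      have eq: "complex_of_real (sin (pi * x)) * cs k x = complex_of_real (1/2) * sn k x + complex_of_real (-1/2) * sn l x" for x
      proof -
        have "sin (real i * pi * x) = sin (freq l * x)" using Suc by (simp add: freq_def)
        then have "sin (pi * x) * (sqrt 2 * cos (freq i * x)) = 1/2 * (sqrt 2 * sin (freq (Suc i) * x)) + (-1/2) * (sqrt 2 * sin (freq l * x))"
          using arg_cong[OF s[of x], of "\<lambda>z. sqrt 2 * z"] by (simp add: field_simps)
        then have "complex_of_real (sin (pi * x) * (sqrt 2 * cos (freq i * x))) = complex_of_real (1/2 * (sqrt 2 * sin (freq (Suc i) * x)) + (-1/2) * (sqrt 2 * sin (freq l * x)))"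
          by simp
        then show ?thesis unfolding \<open>k = Suc i\<close> cs_Suc sn_def of_real_mult of_real_add .
      qed
      show ?thesis unfolding eq by (intro in_span_add in_span_cmult in_span_base)
    qed
  qed
qed

lemma cos_power_in_span: "in_span cs (\<lambda>x. complex_of_real (cos (pi * x) ^ i))"
proof (induction i)
  case 0 then show ?case using in_span_base[of cs 0] unfolding in_span_def by simp
next
  case (Suc i) then show ?case using cos_span_mult_cos[OF Suc] by simp
qed

text \<open>The substitution y = cos(pi x) maps [0,1] bijectively onto [-1,1] and turns polynomials
  in y into cosine polynomials, so Weierstrass' theorem applies to real and imaginary parts.\<close>

lemma cos_span_uniformly_dense:
  assumes G: "continuous_on {0..1} G" and e: "e > 0"
  shows "\<exists>f. in_span cs f \<and> (\<forall>x\<in>{0..1}. cmod (G x - f x) < e)"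
proof -
  have real: "\<exists>f. in_span cs (\<lambda>x. complex_of_real (f x)) \<and> (\<forall>x\<in>{0..1}. \<bar>g x - f x\<bar> < e / 2)"
    if g: "continuous_on {0..1} g" for g :: "real \<Rightarrow> real"
  proof -
    have "continuous_on {-1..1} (\<lambda>y. g (arccos y / pi))"
      by (intro continuous_on_compose2[OF g] continuous_intros) (auto simp: arccos_lbound arccos_ubound)
    then obtain p where p: "real_polynomial_function p" "\<And>y. y \<in> {-1..1} \<Longrightarrow> \<bar>g (arccos y / pi) - p y\<bar> < e / 2"
      using Stone_Weierstrass_real_polynomial_function[of "{-1..1::real}" _ "e/2"] e by (metis compact_Icc half_gt_zero)
    obtain a n where an: "p = (\<lambda>x. \<Sum>i\<le>n. a i * x ^ i)" using p(1) unfolding real_polynomial_function_iff_sum by blast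
    have "in_span cs (\<lambda>x. \<Sum>i\<le>n. complex_of_real (a i) * complex_of_real (cos (pi * x) ^ i))"
      by (intro in_span_sum in_span_cmult cos_power_in_span)
    then have "in_span cs (\<lambda>x. complex_of_real (p (cos (pi * x))))"
      by (simp add: an)
    moreover have "\<bar>g x - p (cos (pi * x))\<bar> < e / 2" if "x \<in> {0..1}" for x
      using p(2)[of "cos (pi * x)"] that by (simp add: arccos_cos mult_left_le)
    ultimately show ?thesis by (intro exI[of _ "\<lambda>x. p (cos (pi * x))"]) auto
  qed
  obtain f1 where f1: "in_span cs (\<lambda>x. complex_of_real (f1 x))" "\<And>x. x\<in>{0..1} \<Longrightarrow> \<bar>Re (G x) - f1 x\<bar> < e / 2"
    using real[OF continuous_on_Re[OF G]] by blast
  obtain f2 where f2: "in_span cs (\<lambda>x. complex_of_real (f2 x))" "\<And>x. x\<in>{0..1} \<Longrightarrow> \<bar>Im (G x) - f2 x\<bar> < e / 2"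
    using real[OF continuous_on_Im[OF G]] by blast
  show ?thesis
  proof (intro exI conjI ballI)
    show "in_span cs (\<lambda>x. complex_of_real (f1 x) + \<i> * complex_of_real (f2 x))"
      by (intro in_span_add in_span_cmult f1 f2)
    fix x :: real assume "x \<in> {0..1}"
    then have "\<bar>Re (G x - (complex_of_real (f1 x) + \<i> * complex_of_real (f2 x)))\<bar> + \<bar>Im (G x - (complex_of_real (f1 x) + \<i> * complex_of_real (f2 x)))\<bar> < e"
      using f1(2)[of x] f2(2)[of x] by simp
    then show "cmod (G x - (complex_of_real (f1 x) + \<i> * complex_of_real (f2 x))) < e"
      using cmod_le by (meson le_less_trans)
  qed
qed

lemma L2norm2_tendsto_dominated:
  assumes meas: "\<And>n. f n \<in> borel_measurable (lebesgue_on S)"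
    and lim: "AE x in lebesgue_on S. (\<lambda>n. f n x) \<longlonglongrightarrow> 0"
    and dom: "integrable (lebesgue_on S) g" "\<And>n. AE x in lebesgue_on S. (cmod (f n x))\<^sup>2 \<le> g x"
  shows "(\<lambda>n. L2norm2 S (f n)) \<longlonglongrightarrow> 0"
proof -
  have "(\<lambda>n. \<integral>x. (cmod (f n x))\<^sup>2 \<partial>lebesgue_on S) \<longlonglongrightarrow> (\<integral>x. 0 \<partial>lebesgue_on S)"
  proof (rule integral_dominated_convergence[where w = g])
    show "AE x in lebesgue_on S. (\<lambda>n. (cmod (f n x))\<^sup>2) \<longlonglongrightarrow> 0"
      using lim
    proof eventually_elim
      case (elim x)
      have "(\<lambda>n. (cmod (f n x))\<^sup>2) \<longlonglongrightarrow> (cmod 0)\<^sup>2" by (intro tendsto_intros elim)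
      then show ?case by simp
    qed
  qed (use meas dom in auto)
  then show ?thesis by (simp add: L2norm2_def)
qed

text \<open>Truncation makes the function bounded at small L2 cost. A measurable function is an
  almost everywhere limit of continuous ones; forcing these into a fixed ball supplies the majorant
  for dominated convergence.\<close>

lemma continuous_dense_L2:
  assumes u: "L2on {a..b} u" and e: "e > 0"
  shows "\<exists>G. continuous_on UNIV G \<and> L2norm2 {a..b} (\<lambda>x. u x - G x) < e"
proof -
  have um[measurable]: "u \<in> borel_measurable (lebesgue_on {a..b})" using u by (simp add: L2on_def)
  define tr where "tr n x = (if cmod (u x) \<le> real n then u x else 0)" for n :: nat and x
  have "(\<lambda>n. L2norm2 {a..b} (\<lambda>x. u x - tr n x)) \<longlonglongrightarrow> 0"
  proof (rule L2norm2_tendsto_dominated)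
    show "AE x in lebesgue_on {a..b}. (\<lambda>n. u x - tr n x) \<longlonglongrightarrow> 0"
    proof (rule AE_I2)
      fix x
      have "\<forall>\<^sub>F n in sequentially. u x - tr n x = 0"
        using eventually_ge_at_top[of "nat \<lceil>cmod (u x)\<rceil>"] by eventually_elim (auto simp: tr_def)
      then show "(\<lambda>n. u x - tr n x) \<longlonglongrightarrow> 0" by (rule tendsto_eventually)
    qed
    show "integrable (lebesgue_on {a..b}) (\<lambda>x. (cmod (u x))\<^sup>2)" using u by (simp add: L2on_def)
  qed (auto simp: tr_def)
  then have "\<forall>\<^sub>F n in sequentially. L2norm2 {a..b} (\<lambda>x. u x - tr n x) < e / 4"
    using e by (intro order_tendstoD(2)) auto
  then obtain n where n: "L2norm2 {a..b} (\<lambda>x. u x - tr n x) < e / 4"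
    by (auto simp: eventually_sequentially)
  define B where "B = real n + 1"
  have B: "B > 0" by (simp add: B_def)
  have tr_le: "cmod (tr n x) \<le> B" for x by (simp add: tr_def B_def)
  have trm[measurable]: "tr n \<in> borel_measurable (lebesgue_on {a..b})" unfolding tr_def[abs_def] by measurable
  \<comment> \<open>Radial retraction onto the closed ball of radius B; the denominator is at least
    1, so it is continuous, and it fixes the values of the truncated function.\<close>
  define clip where "clip z = z / complex_of_real (max 1 (cmod z / B))" for z
  have clip_le: "cmod (clip z) \<le> B" for z
  proof -
    have "cmod z \<le> B * max 1 (cmod z / B)" using B by (simp add: max_def field_simps)
    then show ?thesis by (simp add: clip_def norm_divide divide_le_eq)
  qed
  have clip_id: "cmod z \<le> B \<Longrightarrow> clip z = z" for z using B by (simp add: clip_def max_def)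
  have clip_cont: "continuous_on UNIV clip"
    unfolding clip_def[abs_def] using B by (intro continuous_intros) (auto simp: max_def)
  obtain Z G where Z: "negligible Z" and G: "\<And>k. continuous_on UNIV (G k)"
    and lim: "\<And>x. x \<notin> Z \<Longrightarrow> (\<lambda>k. G k x) \<longlonglongrightarrow> (if x \<in> {a..b} then tr n x else 0)"
    using measurable_on_iff_borel_measurable[of "{a..b}" "tr n"] trm unfolding measurable_on_def by auto
  have cG: "continuous_on UNIV (\<lambda>x. clip (G k x))" for k
    using continuous_on_compose2[OF clip_cont G] by auto
  have "(\<lambda>k. L2norm2 {a..b} (\<lambda>x. tr n x - clip (G k x))) \<longlonglongrightarrow> 0"
  proof (rule L2norm2_tendsto_dominated)
    have Gm: "(\<lambda>x. clip (G k x)) \<in> borel_measurable (lebesgue_on {a..b})" for k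
      by (intro continuous_imp_measurable_on_sets_lebesgue continuous_on_subset[OF cG]) auto
    then show "(\<lambda>x. tr n x - clip (G k x)) \<in> borel_measurable (lebesgue_on {a..b})" for k by measurable
    have "AE x in lebesgue. x \<notin> Z" using Z by (simp add: negligible_iff_null_sets AE_not_in)
    then have "AE x in lebesgue_on {a..b}. x \<notin> Z" by (subst AE_restrict_space_iff) auto
    then show "AE x in lebesgue_on {a..b}. (\<lambda>k. tr n x - clip (G k x)) \<longlonglongrightarrow> 0"
      using AE_space
    proof eventually_elim
      case (elim x)
      have "(\<lambda>k. clip (G k x)) \<longlonglongrightarrow> clip (tr n x)"
        using lim[OF elim(1)] elim(2) clip_cont
        by (intro isCont_tendsto_compose[of _ clip]) (auto simp: continuous_on_eq_continuous_at)
      then have "(\<lambda>k. tr n x - clip (G k x)) \<longlonglongrightarrow> tr n x - clip (tr n x)" by (intro tendsto_intros)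
      then show ?case by (simp add: clip_id[OF tr_le])
    qed
    show "integrable (lebesgue_on {a..b}) (\<lambda>x. (2 * B)\<^sup>2)"
      by (intro continuous_on_integrable_Icc continuous_intros)
    show "AE x in lebesgue_on {a..b}. (cmod (tr n x - clip (G k x)))\<^sup>2 \<le> (2 * B)\<^sup>2" for k
    proof (intro AE_I2 power_mono)
      show "cmod (tr n x - clip (G k x)) \<le> 2 * B" for x
        using norm_triangle_ineq4[of "tr n x" "clip (G k x)"] tr_le[of x] clip_le[of "G k x"] by simp
    qed auto
  qed
  then have "\<forall>\<^sub>F k in sequentially. L2norm2 {a..b} (\<lambda>x. tr n x - clip (G k x)) < e / 4"
    using e by (intro order_tendstoD(2)) auto
  then obtain k where k: "L2norm2 {a..b} (\<lambda>x. tr n x - clip (G k x)) < e / 4"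
    by (auto simp: eventually_sequentially)
  have "L2on {a..b} (tr n)"
    using sqint_dominated[OF trm, of "\<lambda>x. (cmod (u x))\<^sup>2"] u by (auto simp: L2on_iff_sqint sqint_def tr_def)
  then have "L2norm2 {a..b} (\<lambda>x. u x - clip (G k x)) < e"
    using L2norm2_triangle[OF u _ L2on_continuous[OF continuous_on_subset[OF cG]], of "tr n" k] n k by simp
  then show ?thesis using cG by blast
qed

lemma L2norm2_le_of_uniform:
  assumes "\<And>x. x \<in> {0..1} \<Longrightarrow> cmod (f x) \<le> e"
  shows "L2norm2 {0..1} f \<le> e\<^sup>2"
proof -
  have "L2norm2 {0..1} f \<le> (\<integral>x. e\<^sup>2 \<partial>unitM)"
    unfolding L2norm2_def using assms
    by (intro integral_mono_AE' AE_I2) (auto intro!: continuous_on_integrable_Icc power_mono)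
  then show ?thesis by (simp add: measure_restrict_space)
qed

lemma L2on_in_span:
  assumes "in_span \<phi> f" "\<And>k. L2on S (\<phi> k)" shows "L2on S f"
proof -
  obtain n b where "\<And>x. f x = (\<Sum>k<n. b k * \<phi> k x)" using assms(1) unfolding in_span_def by blast
  then have "f = (\<lambda>x. \<Sum>k<n. b k * \<phi> k x)" by auto
  then show ?thesis using assms(2) by (auto intro!: L2on_sum L2on_cmult)
qed

interpretation CS: complete_orthonormal_L2 cs
proof
  fix u e assume u: "L2on {0..1} u" and e: "(e::real) > 0"
  obtain G where G: "continuous_on UNIV G" "L2norm2 {0..1} (\<lambda>x. u x - G x) < e / 4"
    using continuous_dense_L2[OF u, of "e/4"] e by auto
  have G01: "continuous_on {0..1} G" by (rule continuous_on_subset[OF G(1)]) auto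
  obtain f where f: "in_span cs f" "\<forall>x\<in>{0..1}. cmod (G x - f x) < sqrt (e/8)"
    using cos_span_uniformly_dense[OF G01, of "sqrt (e/8)"] e by auto
  have "L2norm2 {0..1} (\<lambda>x. G x - f x) \<le> (sqrt (e/8))\<^sup>2" by (rule L2norm2_le_of_uniform) (use f in \<open>auto intro: less_imp_le\<close>)
  then have "L2norm2 {0..1} (\<lambda>x. u x - f x) < e"
    using L2norm2_triangle[OF u L2on_continuous[OF G01] L2on_in_span[OF f(1) CS.L2]] G e by simp
  then show "\<exists>f. in_span cs f \<and> L2norm2 {0..1} (\<lambda>x. u x - f x) < e" using f by blast
qed

text \<open>Sine polynomials vanish at 0 and 1, so uniform approximation of a general continuous
  function is impossible. It is first approximated in L2 by a product of sin(pi x) with a continuous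
  function; that second factor is uniformly close to a cosine polynomial, and sin(pi x) times a
  cosine polynomial lies in the sine span.\<close>

interpretation SN: complete_orthonormal_L2 sn
proof
  fix u e assume u: "L2on {0..1} u" and e: "(e::real) > 0"
  obtain G where G: "continuous_on UNIV G" "L2norm2 {0..1} (\<lambda>x. u x - G x) < e / 16"
    using continuous_dense_L2[OF u, of "e/16"] e by auto
  have G01: "continuous_on {0..1} G" by (rule continuous_on_subset[OF G(1)]) auto
  \<comment> \<open>Division by sin(pi x), with the denominator cut off from below. At each interior
    point the cutoff is inactive for large \<open>m\<close>, so multiplying back by the sine
    recovers \<open>G\<close> exactly there.\<close>
  define H where "H m x = G x / complex_of_real (max (sin (pi * x)) (1 / real (Suc m)))" for m x
  have mpos: "max s (1 / real (Suc m)) > 0" for s m by (simp add: less_max_iff_disj)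
  have H: "continuous_on {0..1} (H m)" for m
    unfolding H_def[abs_def] using mpos by (intro continuous_intros G01) (auto simp: less_le)
  have sH: "continuous_on {0..1} (\<lambda>x. complex_of_real (sin (pi * x)) * H m x)" for m
    by (intro continuous_intros H)
  have "(\<lambda>m. L2norm2 {0..1} (\<lambda>x. G x - complex_of_real (sin (pi * x)) * H m x)) \<longlonglongrightarrow> 0"
  proof (rule L2norm2_tendsto_dominated)
    show "(\<lambda>x. G x - complex_of_real (sin (pi * x)) * H m x) \<in> borel_measurable (lebesgue_on {0..1})" for m
      by (intro continuous_imp_measurable_on_sets_lebesgue continuous_intros sH G01) auto
    have "AE x in lebesgue. x \<noteq> 0 \<and> x \<noteq> (1::real)"
      by (intro AE_conjI AE_completion AE_lborel_singleton)
    then have "AE x in lebesgue_on {0..1::real}. x \<noteq> 0 \<and> x \<noteq> 1"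
      by (subst AE_restrict_space_iff) auto
    then show "AE x in lebesgue_on {0..1}. (\<lambda>m. G x - complex_of_real (sin (pi * x)) * H m x) \<longlonglongrightarrow> 0"
      using AE_space
    proof eventually_elim
      case (elim x)
      then have s: "sin (pi * x) > 0" by (intro sin_gt_zero) (auto simp: less_le)
      obtain m where m: "inverse (real (Suc m)) < sin (pi * x)" using reals_Archimedean[OF s] by blast
      have "\<forall>\<^sub>F m in sequentially. G x - complex_of_real (sin (pi * x)) * H m x = 0"
        using eventually_ge_at_top[of m]
      proof eventually_elim
        case (elim k)
        have "1 / real (Suc k) \<le> sin (pi * x)"
          using m elim by (intro order_trans[OF _ less_imp_le[OF m]]) (simp add: field_simps)
        then show ?case using s by (simp add: H_def max_def)
      qed
      then show ?case by (rule tendsto_eventually)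
    qed
    show "integrable (lebesgue_on {0..1}) (\<lambda>x. (cmod (G x))\<^sup>2)"
      by (intro continuous_on_integrable_Icc continuous_intros G01)
    show "AE x in lebesgue_on {0..1}. (cmod (G x - complex_of_real (sin (pi * x)) * H m x))\<^sup>2 \<le> (cmod (G x))\<^sup>2" for m
    proof (intro AE_I2 power_mono)
      fix x assume x: "x \<in> space (lebesgue_on {0..1::real})"
      define M where "M = max (sin (pi * x)) (1 / real (Suc m))"
      have M: "M > 0" "sin (pi * x) \<le> M" using mpos by (auto simp: M_def)
      have s: "sin (pi * x) \<ge> 0" using x by (intro sin_ge_zero) (auto simp: mult_left_le)
      have "G x - complex_of_real (sin (pi * x)) * H m x = G x * complex_of_real (1 - sin (pi * x) / M)"
        using M(1) unfolding H_def M_def[symmetric] by (simp add: algebra_simps)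
      then have "cmod (G x - complex_of_real (sin (pi * x)) * H m x) = cmod (G x) * \<bar>1 - sin (pi * x) / M\<bar>"
        by (simp only: norm_mult norm_of_real)
      also have "\<dots> \<le> cmod (G x) * 1" using M s by (intro mult_left_mono) (auto simp: abs_le_iff field_simps)
      finally show "cmod (G x - complex_of_real (sin (pi * x)) * H m x) \<le> cmod (G x)" by simp
    qed auto
  qed
  then have "\<forall>\<^sub>F m in sequentially. L2norm2 {0..1} (\<lambda>x. G x - complex_of_real (sin (pi * x)) * H m x) < e / 16"
    using e by (intro order_tendstoD(2)) auto
  then obtain m where m: "L2norm2 {0..1} (\<lambda>x. G x - complex_of_real (sin (pi * x)) * H m x) < e / 16"
    by (auto simp: eventually_sequentially)
  obtain f where f: "in_span cs f" "\<forall>x\<in>{0..1}. cmod (H m x - f x) < sqrt (e/16)"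
    using cos_span_uniformly_dense[OF H, of "sqrt (e/16)"] e by auto
  define F where "F x = complex_of_real (sin (pi * x)) * f x" for x
  have F: "in_span sn F" unfolding F_def[abs_def] by (rule sin_mult_cos_span[OF f(1)])
  have "L2norm2 {0..1} (\<lambda>x. complex_of_real (sin (pi * x)) * H m x - F x) \<le> (sqrt (e/16))\<^sup>2"
  proof (rule L2norm2_le_of_uniform)
    fix x :: real assume x: "x \<in> {0..1}"
    have "cmod (complex_of_real (sin (pi * x)) * H m x - F x) = \<bar>sin (pi * x)\<bar> * cmod (H m x - f x)"
      by (simp add: F_def norm_mult flip: right_diff_distrib)
    also have "\<dots> \<le> 1 * sqrt (e/16)" using f x by (intro mult_mono) (auto intro: less_imp_le)
    finally show "cmod (complex_of_real (sin (pi * x)) * H m x - F x) \<le> sqrt (e/16)" by simp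
  qed
  moreover note L2norm2_triangle[OF u L2on_continuous[OF G01] L2on_in_span[OF F SN.L2]]
    L2norm2_triangle[OF L2on_continuous[OF G01] L2on_continuous[OF sH[of m]] L2on_in_span[OF F SN.L2]]
  ultimately have "L2norm2 {0..1} (\<lambda>x. u x - F x) < e"
    using G m e by simp
  then show "\<exists>f. in_span sn f \<and> L2norm2 {0..1} (\<lambda>x. u x - f x) < e" using F by blast
qed

section \<open>Smooth test functions\<close>

text \<open>The family P(1/x) exp(-1/x), extended by zero to x \<le> 0: it contains the standard
  flat function (P = 1) and all its derivatives.\<close>

definition flat :: "real poly \<Rightarrow> real \<Rightarrow> real" where
  "flat P x = (if x > 0 then poly P (1 / x) * exp (- (1 / x)) else 0)"

lemma flat_tendsto_0: "(flat P \<longlongrightarrow> 0) (at 0)"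
proof -
  have "((\<lambda>y. \<Sum>i\<le>degree P. coeff P i * (y ^ i / exp y)) \<longlongrightarrow> (\<Sum>i\<le>degree P. coeff P i * 0)) at_top"
    by (intro tendsto_intros tendsto_power_div_exp_0)
  then have "((\<lambda>y. poly P y * exp (- y)) \<longlongrightarrow> 0) at_top"
    by (simp add: poly_altdef sum_divide_distrib exp_minus divide_inverse[symmetric])
  then have "((\<lambda>x. poly P (inverse x) * exp (- inverse x)) \<longlongrightarrow> 0) (at_right 0)"
    using filterlim_compose filterlim_inverse_at_top_right by blast
  then have r: "(flat P \<longlongrightarrow> 0) (at_right 0)"
    by (rule Lim_transform_eventually) (auto simp: eventually_at_filter flat_def inverse_eq_divide)
  have l: "(flat P \<longlongrightarrow> 0) (at_left 0)"
    by (rule tendsto_eventually) (auto simp: eventually_at_filter flat_def)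
  show ?thesis using r l by (simp add: filterlim_split_at)
qed

text \<open>With y = 1/x, differentiating P(y) exp(-y) with respect to x gives y^2 (P(y) - P'(y))
  exp(-y).\<close>

definition flat_deriv :: "real poly \<Rightarrow> real poly" where
  "flat_deriv P = [:0, 0, 1:] * (P - pderiv P)"

lemma flat_has_derivative: "(flat P has_real_derivative flat (flat_deriv P) x) (at x)"
proof (cases x "0 :: real" rule: linorder_cases)
  case greater
  have "((\<lambda>x. poly P (1 / x) * exp (- (1 / x))) has_real_derivative flat (flat_deriv P) x) (at x)"
    using greater
    by (auto intro!: derivative_eq_intros DERIV_chain2[OF poly_DERIV] simp: flat_def flat_deriv_def field_simps power2_eq_square)
  moreover have "\<forall>\<^sub>F y in nhds x. flat P y = poly P (1 / y) * exp (- (1 / y))"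
    using eventually_nhds_in_open[of "{0<..}" x] greater by (auto elim: eventually_mono simp: flat_def)
  ultimately show ?thesis by (subst DERIV_cong_ev[OF refl _ refl]) auto
next
  case less
  have "((\<lambda>x. 0) has_real_derivative flat (flat_deriv P) x) (at x)"
    using less by (auto intro!: derivative_eq_intros simp: flat_def)
  moreover have "\<forall>\<^sub>F y in nhds x. flat P y = 0"
    using eventually_nhds_in_open[of "{..<0}" x] less by (auto elim: eventually_mono simp: flat_def)
  ultimately show ?thesis by (subst DERIV_cong_ev[OF refl _ refl]) auto
next
  case equal
  \<comment> \<open>The difference quotient at 0 is again of the family, with P multiplied by its
    variable, so its limit is known.\<close>
  have "(\<lambda>y. (flat P y - flat P 0) / (y - 0)) = flat ([:0, 1:] * P)"
    by (auto simp: flat_def fun_eq_iff field_simps)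
  then have "((\<lambda>y. (flat P y - flat P 0) / (y - 0)) \<longlongrightarrow> 0) (at 0)"
    by (simp add: flat_tendsto_0)
  then show ?thesis using equal by (simp add: has_field_derivative_iff flat_def)
qed

text \<open>A set closed under every operation used to build bumps and under differentiation;
  smoothness of all orders then follows from one induction on the order.\<close>

inductive_set flat_algebra :: "(real \<Rightarrow> real) set" where
  base: "(\<lambda>x. flat P (\<alpha> * x + \<beta>)) \<in> flat_algebra"
| cmult: "f \<in> flat_algebra \<Longrightarrow> (\<lambda>x. c * f x) \<in> flat_algebra"
| add: "f \<in> flat_algebra \<Longrightarrow> g \<in> flat_algebra \<Longrightarrow> (\<lambda>x. f x + g x) \<in> flat_algebra"
| mult: "f \<in> flat_algebra \<Longrightarrow> g \<in> flat_algebra \<Longrightarrow> (\<lambda>x. f x * g x) \<in> flat_algebra"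

lemma flat_algebra_deriv:
  assumes "f \<in> flat_algebra"
  shows "\<exists>f'\<in>flat_algebra. \<forall>x. (f has_real_derivative f' x) (at x)"
  using assms
proof induction
  case (base P \<alpha> \<beta>)
  have "((\<lambda>x. flat P (\<alpha> * x + \<beta>)) has_real_derivative \<alpha> * flat (flat_deriv P) (\<alpha> * x + \<beta>)) (at x)" for x
  proof -
    have "((\<lambda>x. \<alpha> * x + \<beta>) has_real_derivative \<alpha>) (at x)" by (auto intro!: derivative_eq_intros)
    from DERIV_chain2[OF flat_has_derivative this] show ?thesis by (simp add: mult.commute)
  qed
  then show ?case by (intro bexI[of _ "\<lambda>x. \<alpha> * flat (flat_deriv P) (\<alpha> * x + \<beta>)"] flat_algebra.intros) auto
next
  case (cmult f c)
  then obtain f' where "f' \<in> flat_algebra" "\<And>x. (f has_real_derivative f' x) (at x)" by blast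
  then show ?case by (intro bexI[of _ "\<lambda>x. c * f' x"] flat_algebra.intros) (auto intro!: derivative_eq_intros)
next
  case (add f g)
  then obtain f' g' where "f' \<in> flat_algebra" "\<And>x. (f has_real_derivative f' x) (at x)"
    "g' \<in> flat_algebra" "\<And>x. (g has_real_derivative g' x) (at x)" by blast
  then show ?case by (intro bexI[of _ "\<lambda>x. f' x + g' x"] flat_algebra.intros) (auto intro!: derivative_eq_intros)
next
  case (mult f g)
  then obtain f' g' where "f' \<in> flat_algebra" "\<And>x. (f has_real_derivative f' x) (at x)"
    "g' \<in> flat_algebra" "\<And>x. (g has_real_derivative g' x) (at x)" by blast
  then show ?case using mult
    by (intro bexI[of _ "\<lambda>x. f' x * g x + f x * g' x"] flat_algebra.intros) (auto intro!: derivative_eq_intros)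
qed

lemma flat_algebra_smooth: "f \<in> flat_algebra \<Longrightarrow> (deriv ^^ k) f differentiable (at t)"
proof (induction k arbitrary: f)
  case 0 then show ?case using flat_algebra_deriv[OF 0] by (auto simp: real_differentiable_def)
next
  case (Suc k)
  obtain f' where f': "f' \<in> flat_algebra" "\<And>x. (f has_real_derivative f' x) (at x)"
    using flat_algebra_deriv[OF Suc.prems] by blast
  then have "deriv f = f'" by (auto simp: fun_eq_iff DERIV_imp_deriv)
  then show ?case using Suc.IH[OF f'(1)] by (simp add: funpow_swap1)
qed

text \<open>A primitive of a bump is constant to the right of the bump's support, so the difference
  of two translates of the primitive has compact support while its derivative is the difference of
  two translated bumps.\<close>

lemma bump_difference:
  fixes s t d T :: real
  assumes "0 < s" "s \<le> t" "0 < d" "t + d < T"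
  obtains p b where "test_fun T p" "\<And>x. (p has_real_derivative b (x - s) - b (x - t)) (at x)"
    "continuous_on UNIV b" "\<And>x. b x \<ge> 0" "\<And>x. x \<notin> {0<..<d} \<Longrightarrow> b x = 0" "\<And>x. x \<in> {0<..<d} \<Longrightarrow> b x > 0"
    "\<And>x. x \<notin> {s..t+d} \<Longrightarrow> p x = 0"
proof -
  define b where "b x = flat 1 x * flat 1 (d - x)" for x
  have b_in: "(\<lambda>x. b (x - u)) \<in> flat_algebra" for u
    using flat_algebra.mult[OF flat_algebra.base[of 1 1 "-u"] flat_algebra.base[of 1 "-1" "d + u"]]
    by (simp add: b_def algebra_simps)
  have cont: "continuous_on UNIV b"
  proof -
    obtain b' where "\<And>x. (b has_real_derivative b' x) (at x)" using flat_algebra_deriv[OF b_in[of 0]] by auto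
    then show ?thesis using DERIV_continuous_on[of UNIV b b'] by simp
  qed
  have b_out: "b x = 0" if "x \<notin> {0<..<d}" for x using that by (auto simp: b_def flat_def)
  have b_in_pos: "b x > 0" if "x \<in> {0<..<d}" for x using that by (auto simp: b_def flat_def)
  have b_nn: "b x \<ge> 0" for x using b_out[of x] b_in_pos[of x] by fastforce
  \<comment> \<open>Any base point left of 0 would do: the bump vanishes there, and points x \<ge> 0
    become interior to the interval of integration.\<close>
  define F where "F x = integral {-1..x} b" for x
  have F_neg: "F x = 0" if "x \<le> 0" for x
    unfolding F_def using that b_out by (intro integral_unique has_integral_is_0) auto
  have F_deriv: "(F has_real_derivative b x) (at x)" for x
  proof (cases "x < 0")
    case True
    have "\<forall>\<^sub>F y in nhds x. F y = 0"
      using eventually_nhds_in_open[of "{..<0}" x] True by (auto elim: eventually_mono simp: F_neg)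
    then show ?thesis using b_out[of x] True by (subst DERIV_cong_ev[OF refl _ refl]) auto
  next
    case False
    have "(F has_real_derivative b x) (at x within {-1..x+1})"
      unfolding F_def[abs_def] using False
      by (intro integral_has_real_derivative continuous_on_subset[OF cont]) auto
    then show ?thesis using False by (subst (asm) at_within_interior) auto
  qed
  have F_const: "F x = F d" if "x \<ge> d" for x
  proof (rule ccontr)
    assume "F x \<noteq> F d"
    then have "d < x" using that by (cases "x = d") auto
    then obtain z where "z > d" "F x - F d = (x - d) * b z"
      using MVT2[of d x F b] F_deriv by auto
    then show False using b_out[of z] \<open>F x \<noteq> F d\<close> by auto
  qed
  define p where "p x = F (x - s) - F (x - t)" for x
  have p_deriv: "(p has_real_derivative b (x - s) - b (x - t)) (at x)" for x
    unfolding p_def[abs_def] by (auto intro!: derivative_eq_intros DERIV_chain2[OF F_deriv])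
  have p_out: "p x = 0" if "x \<notin> {s..t+d}" for x
    using that assms F_neg[of "x - s"] F_neg[of "x - t"] F_const[of "x - s"] F_const[of "x - t"] by (auto simp: p_def)
  have "deriv p = (\<lambda>x. b (x - s) + (-1) * b (x - t))" using p_deriv by (auto simp: fun_eq_iff DERIV_imp_deriv)
  then have dp: "deriv p \<in> flat_algebra"
    using flat_algebra.add[OF b_in[of s] flat_algebra.cmult[OF b_in[of t], of "-1"]] by simp
  have "(deriv ^^ k) p differentiable (at x)" for k x
  proof (cases k)
    case 0 then show ?thesis using p_deriv by (auto simp: real_differentiable_def)
  next
    case (Suc l) then show ?thesis using flat_algebra_smooth[OF dp] by (simp add: funpow_swap1)
  qed
  then have "test_fun T p"
    unfolding test_fun_def using p_out assms by (intro conjI allI exI[of _ s] exI[of _ "t+d"]) auto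
  then show ?thesis using that p_deriv cont b_nn b_out b_in_pos p_out by blast
qed

lemma test_fun_continuous: "test_fun T p \<Longrightarrow> continuous_on S p" "test_fun T p \<Longrightarrow> continuous_on S (deriv p)"
proof -
  assume p: "test_fun T p"
  have d: "(deriv ^^ k) p differentiable (at t)" for k t using p by (auto simp: test_fun_def)
  show "continuous_on S p" "continuous_on S (deriv p)"
    using d[of 0] d[of 1]
    by (auto intro!: continuous_at_imp_continuous_on differentiable_imp_continuous_within)
qed

lemma test_fun_deriv: "test_fun T p \<Longrightarrow> (p has_real_derivative deriv p t) (at t)"
  unfolding test_fun_def using DERIV_deriv_iff_real_differentiable by (metis funpow_0)

lemma test_fun_endpoints: "test_fun T p \<Longrightarrow> p 0 = 0" "test_fun T p \<Longrightarrow> p T = 0"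
  unfolding test_fun_def by (metis atLeastAtMost_iff linorder_not_le)+

lemma test_fun_AC:
  assumes p: "test_fun T p"
  shows "AC T (\<lambda>t. complex_of_real (p t)) (\<lambda>t. complex_of_real (deriv p t))"
proof (rule AC_vector_derivative)
  fix t
  have "(p has_vector_derivative deriv p t) (at t within {0..T})"
    using test_fun_deriv[OF p, of t]
    by (simp add: has_real_derivative_iff_has_vector_derivative has_vector_derivative_at_within)
  then show "((\<lambda>t. complex_of_real (p t)) has_vector_derivative complex_of_real (deriv p t)) (at t within {0..T})"
    by (rule bounded_linear.has_vector_derivative[OF bounded_linear_of_real])
qed (intro continuous_intros test_fun_continuous[OF p])

text \<open>Testing with a difference of two narrow bumps shows that \<open>u\<close> has equal local averages everywhere.\<close>
lemma du_Bois_Reymond_const: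
  fixes u :: "real \<Rightarrow> complex"
  assumes u: "continuous_on {0..T} u" and T: "0 < T"
    and z: "\<And>p. test_fun T p \<Longrightarrow> (\<integral>t. u t * complex_of_real (deriv p t) \<partial>lebesgue_on {0..T}) = 0"
    and t: "t \<in> {0..T}"
  shows "u t = u 0"
proof -
  have uc: "uniformly_continuous_on {0..T} u" by (intro compact_uniformly_continuous u) auto
  have interior: "cmod (u s - u t) \<le> 2 * e" if st: "0 < s" "s \<le> t" "t < T" and e: "e > 0" for s t e
  proof -
    obtain d0 where d0: "d0 > 0" "\<And>x y. x \<in> {0..T} \<Longrightarrow> y \<in> {0..T} \<Longrightarrow> dist x y < d0 \<Longrightarrow> dist (u x) (u y) < e"
      using uc e unfolding uniformly_continuous_on_def by metis
    \<comment> \<open>The width is below the modulus of continuity for \<open>e\<close> and small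
      enough that both bumps stay inside (0,T).\<close>
    define d where "d = min (d0 / 2) ((T - t) / 2)"
    have d: "0 < d" "d < d0" "t + d < T" using d0 st by (auto simp: d_def min_def field_simps)
    obtain p b where p: "test_fun T p" "\<And>x. (p has_real_derivative b (x - s) - b (x - t)) (at x)"
      and b: "continuous_on UNIV b" "\<And>x. b x \<ge> 0" "\<And>x. x \<notin> {0<..<d} \<Longrightarrow> b x = 0" "\<And>x. x \<in> {0<..<d} \<Longrightarrow> b x > 0"
      using bump_difference[OF st(1,2) d(1,3)] by metis
    have dp: "deriv p x = b (x - s) - b (x - t)" for x using p(2) by (simp add: DERIV_imp_deriv)
    let ?M = "lebesgue_on {0..T}"
    define c where "c r = (\<integral>x. b (x - r) \<partial>?M)" for r
    define I where "I r = (\<integral>x. u x * complex_of_real (b (x - r)) \<partial>?M)" for r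
    have bc: "continuous_on S (\<lambda>x. b (x - r))" for S r
      by (intro continuous_on_compose2[OF b(1)] continuous_intros) auto
    have bi: "integrable ?M (\<lambda>x. b (x - r))" for r by (intro continuous_on_integrable_Icc bc)
    have ui: "integrable ?M (\<lambda>x. u x * complex_of_real (b (x - r)))" for r
      by (intro continuous_on_integrable_Icc continuous_intros u bc)
    have cc: "integrable ?M (\<lambda>x. complex_of_real (b (x - r)))" for r
      by (intro continuous_on_integrable_Icc continuous_intros bc)
    have "I s - I t = (\<integral>x. u x * complex_of_real (deriv p x) \<partial>?M)"
      unfolding I_def dp using ui by (simp add: right_diff_distrib)
    then have I: "I s = I t" using z[OF p(1)] by simp
    have "complex_of_real (c s - c t) = (\<integral>x. complex_of_real (deriv p x) \<partial>?M)"
      unfolding dp c_def using cc by simp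
    also have "\<dots> = 0" using AC_integral[OF test_fun_AC[OF p(1)], of T] T test_fun_endpoints[OF p(1)] by simp
    finally have c_eq: "c s = c t" by simp
    \<comment> \<open>Relative to the mass \<open>c r\<close>, the integral \<open>I r\<close> is a
      weighted mean of \<open>u\<close> over (r, r+d), hence within \<open>e\<close> of
      \<open>u r\<close>.\<close>
    have near: "cmod (I r - u r * complex_of_real (c r)) \<le> e * c r" if r: "0 < r" "r + d < T" for r
    proof -
      have "I r - u r * complex_of_real (c r) = (\<integral>x. (u x - u r) * complex_of_real (b (x - r)) \<partial>?M)"
        unfolding I_def c_def using ui cc by (simp add: left_diff_distrib flip: integral_complex_of_real)
      also have "cmod \<dots> \<le> (\<integral>x. e * b (x - r) \<partial>?M)"
      proof (rule order_trans[OF integral_norm_bound], rule integral_mono)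
        show "integrable ?M (\<lambda>x. cmod ((u x - u r) * complex_of_real (b (x - r))))"
          by (intro continuous_on_integrable_Icc continuous_intros u bc)
        fix x assume "x \<in> space ?M"
        then have x: "x \<in> {0..T}" by simp
        show "cmod ((u x - u r) * complex_of_real (b (x - r))) \<le> e * b (x - r)"
        proof (cases "x - r \<in> {0<..<d}")
          case True
          then have "dist (u x) (u r) < e" using x r d by (intro d0(2)) (auto simp: dist_real_def)
          then show ?thesis using b(2)[of "x - r"] by (simp add: norm_mult dist_norm mult_right_mono)
        qed (use b in simp)
      qed (use bi in simp)
      also have "\<dots> = e * c r" by (simp add: c_def)
      finally show ?thesis .
    qed
    have "c s > 0"
    proof -
      have "c s \<ge> 0" unfolding c_def using b by (intro integral_nonneg_AE) auto
      moreover have "c s \<noteq> 0"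
        unfolding c_def using integralL_eq_0_iff[OF bc T, of s] b(2) b(4)[of "d/2"] st d
        by (auto intro!: bexI[of _ "s + d/2"] simp: less_le)
      ultimately show ?thesis by simp
    qed
    have "u s * complex_of_real (c s) - u t * complex_of_real (c t)
       = (I t - u t * complex_of_real (c t)) - (I s - u s * complex_of_real (c s))" by (simp add: I)
    also have "cmod \<dots> \<le> e * c t + e * c s"
      by (rule order_trans[OF norm_triangle_ineq4], rule add_mono; rule near) (use st d in auto)
    finally have "cmod ((u s - u t) * complex_of_real (c s)) \<le> (2 * e) * c s"
      by (simp add: c_eq left_diff_distrib)
    then show ?thesis using \<open>c s > 0\<close> by (simp add: norm_mult)
  qed
  have eq: "u s = u (T/2)" if s: "s \<in> {0<..<T}" for s
  proof -
    have "cmod (u s - u (T/2)) \<le> e" if "e > 0" for e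
      using interior[of s "T/2" "e/2"] interior[of "T/2" s "e/2"] s that T
      by (cases "s \<le> T/2") (auto simp: norm_minus_commute)
    then have "cmod (u s - u (T/2)) \<le> 0" by (rule field_le_epsilon) simp
    then show ?thesis by simp
  qed
  have "u s = u (T/2)" if "s \<in> {0..T}" for s
  proof (rule continuous_constant_on_closure[of "{0<..<T}" u "u (T/2)" s])
    show "continuous_on (closure {0<..<T}) u" using u T by simp
    show "s \<in> closure {0<..<T}" using that T by simp
  qed (rule eq)
  from this[OF t] this[of 0] show ?thesis using T by simp
qed

lemma integral_lebesgue_on_singleton [simp]:
  fixes f :: "real \<Rightarrow> 'a::euclidean_space"
  shows "integral\<^sup>L (lebesgue_on {x}) f = 0"
  by (rule integral_eq_zero_null_sets) (simp add: null_sets_completionI)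

text \<open>Subtracting a primitive of \<open>q\<close> reduces the claim to a function with
  vanishing weak derivative. It converts the weak formulation, tested with one sine, into an
  ordinary differential equation for a Fourier coefficient.\<close>

theorem du_Bois_Reymond:
  fixes v q :: "real \<Rightarrow> complex"
  assumes v: "continuous_on {0..T} v" and q: "integrable (lebesgue_on {0..T}) q" and T: "0 < T"
    and weak: "\<And>p. test_fun T p \<Longrightarrow> - (\<integral>t. v t * complex_of_real (deriv p t) \<partial>lebesgue_on {0..T})
       = (\<integral>t. q t * complex_of_real (p t) \<partial>lebesgue_on {0..T})"
  shows "AC T v q"
proof (rule ACI[OF q])
  define Q where "Q t = integral\<^sup>L (lebesgue_on {0..t}) q" for t
  have Q: "AC T Q q" by (rule ACI[OF q]) (auto simp: Q_def)
  fix t assume t: "t \<in> {0..T}"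
  have "v t - Q t = v 0 - Q 0"
  proof (rule du_Bois_Reymond_const[OF _ T _ t])
    show "continuous_on {0..T} (\<lambda>t. v t - Q t)" by (intro continuous_intros v AC_continuous_on[OF Q])
    fix p assume p: "test_fun T p"
    have i: "integrable (lebesgue_on {0..T}) (\<lambda>t. v t * complex_of_real (deriv p t))"
      "integrable (lebesgue_on {0..T}) (\<lambda>t. Q t * complex_of_real (deriv p t))"
      by (intro continuous_on_integrable_Icc continuous_intros v AC_continuous_on[OF Q] test_fun_continuous[OF p])+
    have "(\<integral>t. q t * complex_of_real (p t) \<partial>lebesgue_on {0..T}) = - (\<integral>t. Q t * complex_of_real (deriv p t) \<partial>lebesgue_on {0..T})"
      using AC_by_parts[OF Q test_fun_AC[OF p]] T test_fun_endpoints[OF p] by simp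
    then show "(\<integral>t. (v t - Q t) * complex_of_real (deriv p t) \<partial>lebesgue_on {0..T}) = 0"
      using weak[OF p] i by (simp add: left_diff_distrib)
  qed
  moreover have "Q 0 = 0" by (simp add: Q_def)
  ultimately show "integral\<^sup>L (lebesgue_on {0..t}) q = v t - v 0" by (simp add: Q_def diff_eq_eq eq_diff_eq add.commute)
qed

section \<open>Square-integrable functions on the time-space rectangle\<close>

text \<open>Completeness of Lebesgue measure. It lets measurability pass from a well-behaved
  representative to a function known only up to null sets.\<close>

lemma borel_measurable_lebesgue_on_AE:
  fixes f g :: "'a::euclidean_space \<Rightarrow> 'b::euclidean_space"
  assumes f: "f \<in> borel_measurable (lebesgue_on S)" and S: "S \<in> sets lebesgue"
    and eq: "AE x in lebesgue_on S. f x = g x"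
  shows "g \<in> borel_measurable (lebesgue_on S)"
proof -
  have "(\<lambda>x. if x \<in> S then g x else 0) \<in> borel_measurable lebesgue"
  proof (rule borel_measurable_AE[OF borel_measurable_if_I[OF f S]])
    show "AE x in lebesgue. (if x \<in> S then f x else 0) = (if x \<in> S then g x else 0)"
      using eq by (subst (asm) AE_restrict_space_iff) (use S in auto)
  qed
  then show ?thesis using S by (simp add: borel_measurable_if)
qed

lemma integral_lebesgue_on_cong_AE:
  fixes f g :: "'a::euclidean_space \<Rightarrow> 'b::euclidean_space"
  assumes f: "f \<in> borel_measurable (lebesgue_on S)" and S: "S \<in> sets lebesgue"
    and eq: "AE x in lebesgue_on S. f x = g x"
  shows "integral\<^sup>L (lebesgue_on S) f = integral\<^sup>L (lebesgue_on S) g"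
  by (rule integral_cong_AE[OF f borel_measurable_lebesgue_on_AE[OF f S eq] eq])

lemma AE_lebesgue_on_subset:
  assumes "AE x in lebesgue_on T. P x" "S \<subseteq> T" "S \<in> sets lebesgue" "T \<in> sets lebesgue"
  shows "AE x in lebesgue_on S. P x"
proof -
  have "AE x in lebesgue. x \<in> T \<longrightarrow> P x" using assms by (subst (asm) AE_restrict_space_iff) auto
  then show ?thesis using assms by (subst AE_restrict_space_iff) (auto elim: eventually_mono)
qed

abbreviation rectM :: "real \<Rightarrow> (real \<times> real) measure" where
  "rectM T \<equiv> lebesgue_on {0..T} \<Otimes>\<^sub>M lebesgue_on {0..1}"

lemma ident_measurable_lebesgue_on: "(\<lambda>x. x) \<in> borel_measurable (lebesgue_on {a..b::real})"
  by (intro continuous_imp_measurable_on_sets_lebesgue) auto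

lemma borel_measurable_rectM:
  fixes f :: "real \<times> real \<Rightarrow> 'b::topological_space"
  assumes "f \<in> borel_measurable borel" shows "f \<in> borel_measurable (rectM T)"
proof -
  note [measurable] = ident_measurable_lebesgue_on
  have "(\<lambda>p. (fst p, snd p)) \<in> measurable (rectM T) (borel \<Otimes>\<^sub>M borel)"
    by (intro measurable_Pair measurable_compose[OF measurable_fst ident_measurable_lebesgue_on]
        measurable_compose[OF measurable_snd ident_measurable_lebesgue_on])
  then have "(\<lambda>p. p) \<in> measurable (rectM T) borel" by (simp add: borel_prod)
  then show ?thesis using measurable_compose assms by fastforce
qed

definition L2prod :: "real \<Rightarrow> (real \<Rightarrow> real \<Rightarrow> complex) \<Rightarrow> bool" where
  "L2prod T F \<longleftrightarrow> sqint (rectM T) (\<lambda>p. F (fst p) (snd p))"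

text \<open>Lebesgue measure on the plane is the completion of the product measure, so a Lebesgue
  measurable \<open>g\<close> may have exceptional sections and Fubini does not apply to it
  directly. Real and imaginary parts are replaced by Borel functions equal almost everywhere in the
  plane, hence equal on almost every section.\<close>

lemma L2_time_space_representative:
  assumes "L2_time_space T g"
  obtains G where "L2prod T G" "AE t in lebesgue_on {0..T}. AE x in lebesgue_on {0..1}. g t x = G t x"
proof -
  let ?R = "{0..T} \<times> {0..1::real}"
  have R: "?R \<in> sets lebesgue"
    using borel_closed[OF closed_Times[OF closed_atLeastAtMost closed_atLeastAtMost], of 0 T 0 "1::real"] by simp
  define f where "f p = (if p \<in> ?R then g (fst p) (snd p) else 0)" for p
  have fm: "f \<in> borel_measurable lebesgue"
    unfolding f_def using assms R by (intro borel_measurable_if_I) (auto simp: L2_time_space_def)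
  have f2: "integrable lebesgue (\<lambda>p. (cmod (f p))\<^sup>2)"
    using assms Lebesgue_Measure.integrable_restrict_UNIV[OF R, of "\<lambda>p. (cmod (g (fst p) (snd p)))\<^sup>2"]
    by (simp add: L2_time_space_def f_def if_distrib[of "\<lambda>z. (cmod z)\<^sup>2"] cong: if_cong)
  have "(\<lambda>p. Re (f p)) \<in> borel_measurable lebesgue" "(\<lambda>p. Im (f p)) \<in> borel_measurable lebesgue"
    using fm by auto
  note this[THEN completion_ex_borel_measurable_real]
  then obtain gr gi where gr: "gr \<in> borel_measurable lborel" "AE p in lborel. Re (f p) = gr p"
    and gi: "gi \<in> borel_measurable lborel" "AE p in lborel. Im (f p) = gi p"
    by blast
  define G where "G t x = complex_of_real (gr (t, x)) + \<i> * complex_of_real (gi (t, x))" for t x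
  have Gm: "(\<lambda>p. G (fst p) (snd p)) \<in> borel_measurable borel"
    using gr(1) gi(1) unfolding G_def by simp
  have eq: "AE p in lborel. f p = G (fst p) (snd p)"
    using gr(2) gi(2) by eventually_elim (simp add: G_def complex_eq_iff)
  then have "AE t in lborel. AE x in lborel. f (t, x) = G t x"
    using lborel_pair.AE_pair[of "\<lambda>p. f p = G (fst p) (snd p)"] unfolding lborel_prod by simp
  then have eq2: "AE t in lebesgue_on {0..T}. AE x in lebesgue_on {0..1}. g t x = G t x"
  proof -
    assume *: "AE t in lborel. AE x in lborel. f (t, x) = G t x"
    have "AE t in lebesgue. AE x in lborel. f (t, x) = G t x" by (rule AE_completion[OF *])
    then have "AE t in lebesgue_on {0..T}. AE x in lborel. f (t, x) = G t x"
      by (subst AE_restrict_space_iff) (auto elim: eventually_mono)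
    then show ?thesis using AE_space
    proof eventually_elim
      case (elim t)
      have "AE x in lebesgue. f (t, x) = G t x" by (rule AE_completion[OF elim(1)])
      then have "AE x in lebesgue. x \<in> {0..1} \<longrightarrow> g t x = G t x"
        by eventually_elim (use elim(2) in \<open>auto simp: f_def\<close>)
      then show ?case by (subst AE_restrict_space_iff) auto
    qed
  qed
  have "(\<integral>\<^sup>+p. ennreal ((cmod (G (fst p) (snd p)))\<^sup>2) \<partial>rectM T) < \<infinity>"
  proof -
    interpret P: pair_sigma_finite "lebesgue_on {0..T}" "lebesgue_on {0..1::real}"
      by (rule pair_sigma_finite_lebesgue_on)
    let ?h = "\<lambda>p. ennreal ((cmod (G (fst p) (snd p)))\<^sup>2)"
    have hm: "?h \<in> borel_measurable borel" using Gm by measurable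
    have "(\<integral>\<^sup>+p. ?h p \<partial>rectM T) = (\<integral>\<^sup>+t. \<integral>\<^sup>+x. ?h (t, x) \<partial>lebesgue_on {0..1} \<partial>lebesgue_on {0..T})"
      by (rule P.M2.nn_integral_fst[OF borel_measurable_rectM[OF hm], symmetric])
    also have "\<dots> \<le> (\<integral>\<^sup>+t. \<integral>\<^sup>+x. ?h (t, x) \<partial>lborel \<partial>lebesgue_on {0..T})"
      by (intro nn_integral_mono) (simp add: nn_integral_restrict_space nn_integral_completion indicator_def nn_integral_mono)
    also have "\<dots> \<le> (\<integral>\<^sup>+t. \<integral>\<^sup>+x. ?h (t, x) \<partial>lborel \<partial>lborel)"
      by (simp add: nn_integral_restrict_space nn_integral_completion indicator_def nn_integral_mono)
    also have "\<dots> = (\<integral>\<^sup>+p. ?h p \<partial>lborel)"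
      unfolding lborel_prod[symmetric] by (rule lborel.nn_integral_fst) (use hm in \<open>simp add: lborel_prod\<close>)
    also have "\<dots> = (\<integral>\<^sup>+p. ennreal ((cmod (f p))\<^sup>2) \<partial>lebesgue)"
      unfolding nn_integral_completion by (rule nn_integral_cong_AE) (use eq in eventually_elim, simp)
    also have "\<dots> < \<infinity>" using f2 by (simp add: integrable_iff_bounded)
    finally show ?thesis .
  qed
  then have "L2prod T G"
    unfolding L2prod_def sqint_def integrable_iff_bounded
    using borel_measurable_rectM[OF Gm] by auto
  then show ?thesis using eq2 that by blast
qed

lemma L2prod_continuous:
  assumes "continuous_on ({0..T} \<times> {0..1}) (\<lambda>p. F (fst p) (snd p))"
  shows "L2prod T F"
proof -
  let ?R = "{0..T} \<times> {0..1::real}"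
  interpret F1: finite_measure "lebesgue_on {0..T}" by (rule finite_measure_lebesgue_on_Icc)
  interpret F2: finite_measure "lebesgue_on {0..1::real}" by (rule finite_measure_lebesgue_on_Icc)
  interpret P: finite_measure "rectM T" by (rule finite_measure_pair_measure) unfold_locales
  have cl: "?R \<in> sets borel" by (intro borel_closed closed_Times closed_atLeastAtMost)
  have "(\<lambda>p. indicator ?R p *\<^sub>R F (fst p) (snd p)) \<in> borel_measurable borel"
    by (rule borel_measurable_continuous_on_indicator[OF cl assms])
  then have "(\<lambda>p. indicator ?R p *\<^sub>R F (fst p) (snd p)) \<in> borel_measurable (rectM T)"
    by (rule borel_measurable_rectM)
  then have m: "(\<lambda>p. F (fst p) (snd p)) \<in> borel_measurable (rectM T)"
    by (subst measurable_cong[where g = "\<lambda>p. indicator ?R p *\<^sub>R F (fst p) (snd p)"]) (auto simp: space_pair_measure)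
  have "compact ((\<lambda>p. F (fst p) (snd p)) ` ?R)"
    by (intro compact_continuous_image assms compact_Times compact_Icc)
  then obtain B where B: "\<And>p. p \<in> ?R \<Longrightarrow> cmod (F (fst p) (snd p)) \<le> B"
    using compact_imp_bounded bounded_iff by (metis (no_types, lifting) imageI)
  show ?thesis
    unfolding L2prod_def
    by (rule sqint_dominated[OF m, of "\<lambda>_. B\<^sup>2"]) (use B in \<open>auto simp: space_pair_measure intro!: AE_I2 power_mono\<close>)
qed

lemma L2prod_add: "L2prod T F \<Longrightarrow> L2prod T G \<Longrightarrow> L2prod T (\<lambda>t x. F t x + G t x)"
  and L2prod_diff: "L2prod T F \<Longrightarrow> L2prod T G \<Longrightarrow> L2prod T (\<lambda>t x. F t x - G t x)"
  unfolding L2prod_def by auto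

lemma L2prod_section:
  assumes F: "L2prod T F"
  shows "AE t in lebesgue_on {0..T}. L2on {0..1} (F t)"
    and "integrable (lebesgue_on {0..T}) (\<lambda>t. L2norm2 {0..1} (F t))"
proof -
  interpret P: pair_sigma_finite "lebesgue_on {0..T}" "lebesgue_on {0..1::real}"
    by (rule pair_sigma_finite_lebesgue_on)
  have i: "integrable (rectM T) (\<lambda>(t, x). (cmod (F t x))\<^sup>2)"
    using F by (simp add: L2prod_def sqint_def case_prod_unfold)
  have "AE t in lebesgue_on {0..T}. integrable (lebesgue_on {0..1}) (\<lambda>x. (cmod (F t x))\<^sup>2)"
    using P.AE_integrable_fst[of "\<lambda>t x. (cmod (F t x))\<^sup>2"] i by simp
  then show "AE t in lebesgue_on {0..T}. L2on {0..1} (F t)"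
    using AE_space
  proof eventually_elim
    case (elim t)
    have "(\<lambda>p. F (fst p) (snd p)) \<in> borel_measurable (rectM T)" using F by (simp add: L2prod_def sqint_def)
    from measurable_Pair2[OF this elim(2)] show ?case using elim(1) by (simp add: L2on_def)
  qed
  show "integrable (lebesgue_on {0..T}) (\<lambda>t. L2norm2 {0..1} (F t))"
    unfolding L2norm2_def using P.integrable_fst[of "\<lambda>t x. (cmod (F t x))\<^sup>2"] i by simp
qed

lemma L2prod_ip_measurable:
  assumes F: "L2prod T F" and \<phi>: "L2on {0..1} \<phi>"
  shows "(\<lambda>t. L2ip (F t) \<phi>) \<in> borel_measurable (lebesgue_on {0..T})"
proof -
  interpret P: pair_sigma_finite "lebesgue_on {0..T}" "lebesgue_on {0..1::real}"
    by (rule pair_sigma_finite_lebesgue_on)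
  have Fm[measurable]: "(\<lambda>p. F (fst p) (snd p)) \<in> borel_measurable (rectM T)" using F by (simp add: L2prod_def sqint_def)
  have [measurable]: "\<phi> \<in> borel_measurable (lebesgue_on {0..1})" using \<phi> by (simp add: L2on_def)
  have [measurable]: "(\<lambda>x. cnj (\<phi> x)) \<in> borel_measurable (lebesgue_on {0..1})"
    by (rule measurable_compose[OF _ borel_measurable_cnj]) measurable
  have "(\<lambda>(t, x). F t x * cnj (\<phi> x)) \<in> borel_measurable (rectM T)"
    unfolding case_prod_beta by measurable
  then show ?thesis unfolding L2ip_def by (rule P.M2.borel_measurable_lebesgue_integral)
qed

lemma L2prod_ip_L2on:
  assumes F: "L2prod T F" and \<phi>: "L2on {0..1} \<phi>"
  shows "L2on {0..T} (\<lambda>t. L2ip (F t) \<phi>)"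
  unfolding L2on_iff_sqint
proof (rule sqint_dominated[OF L2prod_ip_measurable[OF F \<phi>]])
  show "integrable (lebesgue_on {0..T}) (\<lambda>t. L2norm2 {0..1} (F t) * L2norm2 {0..1} \<phi>)"
    using L2prod_section(2)[OF F] by simp
  show "AE t in lebesgue_on {0..T}. (cmod (L2ip (F t) \<phi>))\<^sup>2 \<le> L2norm2 {0..1} (F t) * L2norm2 {0..1} \<phi>"
    using L2prod_section(1)[OF F] by eventually_elim (rule L2ip_Cauchy_Schwarz[OF _ \<phi>])
qed

text \<open>At almost every time the projection error tends to zero, and Bessel's inequality bounds
  it by the squared norm of the section: dominated convergence in time.\<close>

lemma (in complete_orthonormal_L2) L2prod_minus_proj_tendsto:
  assumes F: "L2prod T F"
  shows "(\<lambda>n. \<integral>t. L2norm2 {0..1} (\<lambda>x. F t x - proj n (F t) x) \<partial>lebesgue_on {0..T}) \<longlonglongrightarrow> 0"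
    and "integrable (lebesgue_on {0..T}) (\<lambda>t. L2norm2 {0..1} (\<lambda>x. F t x - proj n (F t) x))"
proof -
  note s = L2prod_section[OF F]
  have [measurable]: "(\<lambda>t. L2norm2 {0..1} (F t)) \<in> borel_measurable (lebesgue_on {0..T})" using s(2) by auto
  have [measurable]: "(\<lambda>t. L2ip (F t) (\<phi> k)) \<in> borel_measurable (lebesgue_on {0..T})" for k
    by (rule L2prod_ip_measurable[OF F L2])
  \<comment> \<open>Measurability in time is visible from this expression in the coefficients; it
    agrees with the projection error only at times whose section is square-integrable.\<close>
  define e where "e n t = L2norm2 {0..1} (F t) - (\<Sum>k<n. (cmod (L2ip (F t) (\<phi> k)))\<^sup>2)" for n t
  have em[measurable]: "e n \<in> borel_measurable (lebesgue_on {0..T})" for n unfolding e_def by measurable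
  have eq: "AE t in lebesgue_on {0..T}. e n t = L2norm2 {0..1} (\<lambda>x. F t x - proj n (F t) x)" for n
    using s(1) by eventually_elim (simp add: e_def norm2_minus_proj)
  have m[measurable]: "(\<lambda>t. L2norm2 {0..1} (\<lambda>x. F t x - proj n (F t) x)) \<in> borel_measurable (lebesgue_on {0..T})" for n
    by (rule borel_measurable_lebesgue_on_AE[OF em _ eq]) simp
  have le: "AE t in lebesgue_on {0..T}. norm (L2norm2 {0..1} (\<lambda>x. F t x - proj n (F t) x)) \<le> L2norm2 {0..1} (F t)" for n
    using s(1) by eventually_elim (simp add: L2norm2_nonneg norm2_minus_proj_le)
  show "integrable (lebesgue_on {0..T}) (\<lambda>t. L2norm2 {0..1} (\<lambda>x. F t x - proj n (F t) x))"
    by (rule Bochner_Integration.integrable_bound[OF s(2)]) (use le[of n] in \<open>auto simp: L2norm2_nonneg\<close>)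
  have "(\<lambda>n. \<integral>t. L2norm2 {0..1} (\<lambda>x. F t x - proj n (F t) x) \<partial>lebesgue_on {0..T}) \<longlonglongrightarrow> (\<integral>t. 0 \<partial>lebesgue_on {0..T})"
  proof (rule integral_dominated_convergence[where w = "\<lambda>t. L2norm2 {0..1} (F t)"])
    show "AE t in lebesgue_on {0..T}. (\<lambda>n. L2norm2 {0..1} (\<lambda>x. F t x - proj n (F t) x)) \<longlonglongrightarrow> 0"
      using s(1) by eventually_elim (rule proj_tendsto)
  qed (use le s(2) in auto)
  then show "(\<lambda>n. \<integral>t. L2norm2 {0..1} (\<lambda>x. F t x - proj n (F t) x) \<partial>lebesgue_on {0..T}) \<longlonglongrightarrow> 0" by simp
qed

text \<open>The hypotheses ask only for measurability of inner products in time, not joint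
  measurability, because \<open>wt\<close> and \<open>wx\<close> are given as L2-valued continuous
  maps.\<close>

lemma (in complete_orthonormal_L2) integral_ip_proj_tendsto:
  fixes p :: "real \<Rightarrow> complex"
  assumes u: "AE t in lebesgue_on {0..T}. L2on {0..1} (u t)"
    and um: "\<And>\<phi>. L2on {0..1} \<phi> \<Longrightarrow> (\<lambda>t. L2ip (u t) \<phi>) \<in> borel_measurable (lebesgue_on {0..T})"
    and ui: "integrable (lebesgue_on {0..T}) (\<lambda>t. L2norm2 {0..1} (u t))"
    and v: "L2on {0..1} v" and p: "continuous_on {0..T} p"
  shows "(\<lambda>n. \<integral>t. L2ip (proj n (u t)) v * p t \<partial>lebesgue_on {0..T}) \<longlonglongrightarrow> (\<integral>t. L2ip (u t) v * p t \<partial>lebesgue_on {0..T})"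
proof -
  obtain B where B: "\<And>t. t \<in> {0..T} \<Longrightarrow> cmod (p t) \<le> B"
    using compact_imp_bounded[OF compact_continuous_image[OF p compact_Icc]] unfolding bounded_iff by blast
  have [measurable]: "p \<in> borel_measurable (lebesgue_on {0..T})"
    by (intro continuous_imp_measurable_on_sets_lebesgue p) auto
  note um[OF v, measurable] um[OF L2, measurable]
  interpret F: finite_measure "lebesgue_on {0..T}" by (rule finite_measure_lebesgue_on_Icc)
  show ?thesis
  proof (rule integral_dominated_convergence[where w = "\<lambda>t. (L2norm2 {0..1} (u t) + L2norm2 {0..1} v) * B"])
    show "(\<lambda>t. L2ip (u t) v * p t) \<in> borel_measurable (lebesgue_on {0..T})" by measurable
    show "(\<lambda>t. L2ip (proj n (u t)) v * p t) \<in> borel_measurable (lebesgue_on {0..T})" for n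
      unfolding proj_def[abs_def] ip_lincomb_left[OF v] by measurable
    show "AE t in lebesgue_on {0..T}. (\<lambda>n. L2ip (proj n (u t)) v * p t) \<longlonglongrightarrow> L2ip (u t) v * p t"
      using u by eventually_elim (intro tendsto_intros ip_proj_tendsto v)
    show "integrable (lebesgue_on {0..T}) (\<lambda>t. (L2norm2 {0..1} (u t) + L2norm2 {0..1} v) * B)"
      using ui by simp
    show "AE t in lebesgue_on {0..T}. norm (L2ip (proj n (u t)) v * p t) \<le> (L2norm2 {0..1} (u t) + L2norm2 {0..1} v) * B" for n
      using u AE_space
    proof eventually_elim
      case (elim t)
      let ?x = "L2norm2 {0..1} (u t)" and ?y = "L2norm2 {0..1} v"
      have nn: "0 \<le> ?x" "0 \<le> ?y" by (auto simp: L2norm2_nonneg)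
      have "(cmod (L2ip (proj n (u t)) v))\<^sup>2 \<le> ?x * ?y"
        using L2ip_Cauchy_Schwarz[OF L2_proj v, of n "u t"] norm2_proj_le[OF elim(1), of n]
          mult_right_mono[OF norm2_proj_le[OF elim(1), of n] nn(2)] by simp
      also have "\<dots> \<le> (?x + ?y)\<^sup>2" using nn by (simp add: power2_sum)
      finally have "cmod (L2ip (proj n (u t)) v) \<le> ?x + ?y" using nn by (auto intro: power2_le_imp_le)
      then show ?case using B[of t] elim(2) nn by (auto simp: norm_mult intro!: mult_mono)
    qed
  qed
qed

section \<open>Fourier coefficients of the weak solution\<close>

lemma H1_AC: "H1 u ux \<Longrightarrow> AC 1 u ux"
  unfolding H1_def AC_def using L2on_integrable by blast

lemma AC_H1:
  assumes "AC 1 u ux" "L2on {0..1} ux" shows "H1 u ux"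
  unfolding H1_def using assms(2) AC_eq[OF assms(1)] by blast

lemma H1_continuous: "H1 u ux \<Longrightarrow> continuous_on {0..1} u"
  by (rule AC_continuous_on[OF H1_AC])

lemma H1_L2: "H1 u ux \<Longrightarrow> L2on {0..1} u" "H1 u ux \<Longrightarrow> L2on {0..1} ux"
  using L2on_continuous[OF H1_continuous] unfolding H1_def by blast+

lemma sn_AC: "AC b (sn k) (\<lambda>x. complex_of_real (freq k) * cs (Suc k) x)"
proof (rule AC_vector_derivative)
  fix x
  have "((\<lambda>x. sqrt 2 * sin (freq k * x)) has_real_derivative sqrt 2 * (cos (freq k * x) * freq k)) (at x within {0..b})"
    by (auto intro!: derivative_eq_intros)
  then have "((\<lambda>x. sqrt 2 * sin (freq k * x)) has_vector_derivative sqrt 2 * (cos (freq k * x) * freq k)) (at x within {0..b})"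
    by (simp add: has_real_derivative_iff_has_vector_derivative)
  from bounded_linear.has_vector_derivative[OF bounded_linear_of_real this]
  show "(sn k has_vector_derivative complex_of_real (freq k) * cs (Suc k) x) (at x within {0..b})"
    by (simp add: sn_def[abs_def] cs_Suc mult.commute mult.left_commute)
qed (intro continuous_intros continuous_on_cs)

lemma cs_AC: "AC b (cs (Suc k)) (\<lambda>x. - complex_of_real (freq k) * sn k x)"
proof (rule AC_vector_derivative)
  fix x
  have "((\<lambda>x. sqrt 2 * cos (freq k * x)) has_real_derivative - (sqrt 2 * (sin (freq k * x) * freq k))) (at x within {0..b})"
    by (auto intro!: derivative_eq_intros)
  then have "((\<lambda>x. sqrt 2 * cos (freq k * x)) has_vector_derivative - (sqrt 2 * (sin (freq k * x) * freq k))) (at x within {0..b})"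
    by (simp add: has_real_derivative_iff_has_vector_derivative)
  from bounded_linear.has_vector_derivative[OF bounded_linear_of_real this]
  show "(cs (Suc k) has_vector_derivative - complex_of_real (freq k) * sn k x) (at x within {0..b})"
    by (simp add: sn_def cs_Suc[abs_def] mult.commute mult.left_commute)
qed (intro continuous_intros continuous_on_sn)

lemma sn_0 [simp]: "sn k 0 = 0" and sn_1 [simp]: "sn k 1 = 0" and cs_at_0: "cs (Suc k) 0 = complex_of_real (sqrt 2)"
  by (simp_all add: sn_def cs_Suc freq_def sin_times_pi_eq_0 del: of_nat_Suc)

lemma H10_sn: "H10 (sn k) (\<lambda>x. complex_of_real (freq k) * cs (Suc k) x)"
  unfolding H10_def
  by (intro conjI AC_H1 sn_AC L2on_cmult L2on_continuous continuous_on_cs) auto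

text \<open>Integration by parts without boundary terms, \<open>u\<close> being zero at both ends:
  the cosine coefficients of the derivative are the sine coefficients of \<open>u\<close> times the
  frequency.\<close>

lemma H10_ip_cs:
  assumes "H10 u ux"
  shows "L2ip ux (cs (Suc k)) = complex_of_real (freq k) * L2ip u (sn k)" "L2ip ux (cs 0) = 0"
proof -
  have u: "AC 1 u ux" "u 0 = 0" "u 1 = 0" using assms H1_AC unfolding H10_def by blast+
  show "L2ip ux (cs (Suc k)) = complex_of_real (freq k) * L2ip u (sn k)"
  proof -
    have "(\<integral>x. u x * (- complex_of_real (freq k) * sn k x) \<partial>lebesgue_on {0..1}) = - complex_of_real (freq k) * L2ip u (sn k)"
      unfolding L2ip_def by (subst Bochner_Integration.integral_mult_right_zero[symmetric]) (simp add: mult_ac)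
    then show ?thesis using AC_by_parts[OF u(1) cs_AC[of 1 k]] u(2,3) by (simp add: L2ip_def[of ux])
  qed
  show "L2ip ux (cs 0) = 0"
    using AC_integral[OF u(1), of 1] u by (simp add: L2ip_def)
qed

text \<open>The same integration by parts for a test function that may be nonzero at 0. The
  surviving boundary term, with the value sqrt 2 of the cosine at 0, is the origin of the
  coefficients of \<open>flux\<close>.\<close>

lemma cs_ip_H1:
  assumes \<phi>: "H1 \<phi> \<phi>x" "\<phi> 1 = 0"
  shows "L2ip (cs (Suc k)) \<phi>x = - complex_of_real (sqrt 2) * cnj (\<phi> 0) + complex_of_real (freq k) * L2ip (sn k) \<phi>"
proof -
  have "AC 1 (\<lambda>x. cnj (\<phi> x)) (\<lambda>x. cnj (\<phi>x x))"
    by (rule AC_bounded_linear[OF bounded_linear_cnj H1_AC[OF \<phi>(1)]])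
  note parts = AC_by_parts[OF this cs_AC[of 1 k]]
  have "(\<integral>x. cnj (\<phi> x) * (- complex_of_real (freq k) * sn k x) \<partial>lebesgue_on {0..1}) = - complex_of_real (freq k) * L2ip (sn k) \<phi>"
    unfolding L2ip_def by (subst Bochner_Integration.integral_mult_right_zero[symmetric]) (simp add: mult_ac)
  then show ?thesis
    using parts \<phi>(2) by (simp add: L2ip_def[of "cs (Suc k)"] cs_at_0 mult.commute)
qed

text \<open>Cauchy-Schwarz on [0,x] starting from the value 0 at the left end. It turns continuity
  in time with values in the energy space into uniform control in x.\<close>

lemma H1_sup_le:
  assumes u: "H10 u ux" and x: "x \<in> {0..1}"
  shows "(cmod (u x))\<^sup>2 \<le> L2norm2 {0..1} ux"
proof -
  have AC: "AC 1 u ux" and u0: "u 0 = 0" and L2: "L2on {0..1} ux"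
    using u H1_AC H1_L2 unfolding H10_def by blast+
  interpret F: finite_measure "lebesgue_on {0..x}" by (rule finite_measure_lebesgue_on_Icc)
  have Lx: "sqint (lebesgue_on {0..x}) ux"
    using L2on_subset[OF L2, of "{0..x}"] x by (simp add: L2on_iff_sqint)
  have "(cmod (\<integral>y. ux y * 1 \<partial>lebesgue_on {0..x}))\<^sup>2 \<le> (\<integral>y. (cmod (ux y))\<^sup>2 \<partial>lebesgue_on {0..x}) * (\<integral>y. (cmod 1)\<^sup>2 \<partial>lebesgue_on {0..x})"
    by (rule Cauchy_Schwarz_sqint[OF Lx]) auto
  also have "\<dots> \<le> (\<integral>y. (cmod (ux y))\<^sup>2 \<partial>lebesgue_on {0..x}) * 1"
    using x by (intro mult_left_mono) (auto simp: measure_restrict_space integral_nonneg_AE)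
  also have "\<dots> \<le> L2norm2 {0..1} ux * 1"
    unfolding L2norm2_def using L2 x by (intro mult_right_mono integral_mono_lebesgue_on_AE) (auto simp: L2on_def)
  finally show ?thesis using AC_integral[OF AC x] u0 by simp
qed

lemma H10_diff: "H10 u ux \<Longrightarrow> H10 v vx \<Longrightarrow> H10 (\<lambda>x. u x - v x) (\<lambda>x. ux x - vx x)"
proof -
  assume "H10 u ux" "H10 v vx"
  then have h: "H1 u ux" "H1 v vx" and bd: "u 0 = 0" "u 1 = 0" "v 0 = 0" "v 1 = 0"
    unfolding H10_def by blast+
  have "H1 (\<lambda>x. u x - v x) (\<lambda>x. ux x - vx x)"
    by (rule AC_H1[OF AC_diff[OF h[THEN H1_AC]] L2on_diff[OF h[THEN H1_L2(2)]]])
  then show ?thesis unfolding H10_def using bd by simp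
qed

lemma L2ip_tendsto:
  assumes u: "\<forall>\<^sub>F s in F. L2on {0..1} (u s)" and u0: "L2on {0..1} u0" and v: "L2on {0..1} v"
    and lim: "((\<lambda>s. L2norm2 {0..1} (\<lambda>x. u s x - u0 x)) \<longlongrightarrow> 0) F"
  shows "((\<lambda>s. L2ip (u s) v) \<longlongrightarrow> L2ip u0 v) F"
proof -
  have "((\<lambda>s. L2norm2 {0..1} (\<lambda>x. u s x - u0 x) * L2norm2 {0..1} v) \<longlongrightarrow> 0 * L2norm2 {0..1} v) F"
    by (intro tendsto_intros lim)
  then have "((\<lambda>s. L2norm2 {0..1} (\<lambda>x. u s x - u0 x) * L2norm2 {0..1} v) \<longlongrightarrow> 0) F" by simp
  then have "((\<lambda>s. (cmod (L2ip (u s) v - L2ip u0 v))\<^sup>2) \<longlongrightarrow> 0) F"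
  proof (rule tendsto_sandwich[OF _ _ tendsto_const, rotated 2])
    show "\<forall>\<^sub>F s in F. (cmod (L2ip (u s) v - L2ip u0 v))\<^sup>2 \<le> L2norm2 {0..1} (\<lambda>x. u s x - u0 x) * L2norm2 {0..1} v"
      using u
    proof eventually_elim
      case (elim s)
      show ?case using L2ip_Cauchy_Schwarz[OF L2on_diff[OF elim u0] v] by (simp add: L2ip_diff_left[OF elim u0 v])
    qed
  qed simp
  then have "((\<lambda>s. sqrt ((cmod (L2ip (u s) v - L2ip u0 v))\<^sup>2)) \<longlongrightarrow> sqrt 0) F"
    by (intro tendsto_intros)
  then show ?thesis by (simp add: LIM_zero_iff tendsto_norm_zero_iff)
qed

lemma L2norm2_tendsto:
  assumes u: "\<forall>\<^sub>F s in F. L2on {0..1} (u s)" and u0: "L2on {0..1} u0"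
    and lim: "((\<lambda>s. L2norm2 {0..1} (\<lambda>x. u s x - u0 x)) \<longlongrightarrow> 0) F"
  shows "((\<lambda>s. L2norm2 {0..1} (u s)) \<longlongrightarrow> L2norm2 {0..1} u0) F"
proof -
  have "((\<lambda>s. L2norm2 {0..1} (\<lambda>x. u s x - u0 x) + 2 * Re (L2ip (u s) u0) - L2norm2 {0..1} u0) \<longlongrightarrow> 0 + 2 * Re (L2ip u0 u0) - L2norm2 {0..1} u0) F"
    by (intro tendsto_intros lim L2ip_tendsto[OF u u0 u0 lim])
  then have "((\<lambda>s. L2norm2 {0..1} (\<lambda>x. u s x - u0 x) + 2 * Re (L2ip (u s) u0) - L2norm2 {0..1} u0) \<longlongrightarrow> L2norm2 {0..1} u0) F"
    by (simp add: L2ip_self[OF u0])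
  then show ?thesis
  proof (rule Lim_transform_eventually)
    show "\<forall>\<^sub>F s in F. L2norm2 {0..1} (\<lambda>x. u s x - u0 x) + 2 * Re (L2ip (u s) u0) - L2norm2 {0..1} u0 = L2norm2 {0..1} (u s)"
      using u by eventually_elim (simp add: L2norm2_diff_expand u0)
  qed
qed

text \<open>\<open>G\<close> is a jointly measurable representative of \<open>g\<close>; integrals
  of the forcing are computed with \<open>G\<close> and carried back through the almost everywhere
  equality of sections.\<close>

locale wave_solution =
  fixes a :: "real \<Rightarrow> real" and T :: real and g G :: "real \<Rightarrow> real \<Rightarrow> complex" and w0 w1 :: "real \<Rightarrow> complex"
    and w wx wt :: "real \<Rightarrow> real \<Rightarrow> complex"
  assumes a_cont: "continuous_on {0..1} a" and T_pos: "T > 0"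
    and weak: "weak_solution a T g w0 w1 w wx wt"
    and G: "L2prod T G" and G_eq: "AE t in lebesgue_on {0..T}. AE x in lebesgue_on {0..1}. g t x = G t x"
begin

lemma w_H10: "t \<in> {0..T} \<Longrightarrow> H10 (w t) (wx t)" and wt_L2: "t \<in> {0..T} \<Longrightarrow> L2on {0..1} (wt t)"
  using weak unfolding weak_solution_def by blast+

lemma wx_L2: "t \<in> {0..T} \<Longrightarrow> L2on {0..1} (wx t)" and w_L2: "t \<in> {0..T} \<Longrightarrow> L2on {0..1} (w t)"
  using H1_L2 w_H10 unfolding H10_def by blast+

lemma eventually_in: "\<forall>\<^sub>F s in at t within {0..T}. s \<in> {0..T}"
  by (simp add: eventually_at_filter)

lemma wx_tendsto: "t \<in> {0..T} \<Longrightarrow> ((\<lambda>s. L2norm2 {0..1} (\<lambda>x. wx s x - wx t x)) \<longlongrightarrow> 0) (at t within {0..T})"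
  and wt_tendsto: "t \<in> {0..T} \<Longrightarrow> ((\<lambda>s. L2norm2 {0..1} (\<lambda>x. wt s x - wt t x)) \<longlongrightarrow> 0) (at t within {0..T})"
  and w_dq_tendsto: "t \<in> {0..T} \<Longrightarrow> ((\<lambda>s. L2norm2 {0..1} (\<lambda>x. (w s x - w t x) / complex_of_real (s - t) - wt t x)) \<longlongrightarrow> 0) (at t within {0..T})"
  using weak unfolding weak_solution_def by blast+

lemma ev_wx: "\<forall>\<^sub>F s in at t within {0..T}. L2on {0..1} (wx s)"
  and ev_wt: "\<forall>\<^sub>F s in at t within {0..T}. L2on {0..1} (wt s)"
  by (rule eventually_mono[OF eventually_in], erule wx_L2 wt_L2)+

lemma wx_ip_continuous: "L2on {0..1} \<phi> \<Longrightarrow> continuous_on {0..T} (\<lambda>t. L2ip (wx t) \<phi>)"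
  unfolding continuous_on_def by (intro ballI L2ip_tendsto[OF ev_wx wx_L2 _ wx_tendsto])

lemma wt_ip_continuous: "L2on {0..1} \<phi> \<Longrightarrow> continuous_on {0..T} (\<lambda>t. L2ip (wt t) \<phi>)"
  unfolding continuous_on_def by (intro ballI L2ip_tendsto[OF ev_wt wt_L2 _ wt_tendsto])

lemma wx_norm_continuous: "continuous_on {0..T} (\<lambda>t. L2norm2 {0..1} (wx t))"
  unfolding continuous_on_def by (intro ballI L2norm2_tendsto[OF ev_wx wx_L2 wx_tendsto])

lemma wt_norm_continuous: "continuous_on {0..T} (\<lambda>t. L2norm2 {0..1} (wt t))"
  unfolding continuous_on_def by (intro ballI L2norm2_tendsto[OF ev_wt wt_L2 wt_tendsto])

text \<open>The increment is split at (t,y): its change in time is bounded by the norm of the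
  difference of the spatial derivatives, its change in space by the continuity of one fixed section.
  Joint continuity makes \<open>a w\<close> a legitimate source on the rectangle.\<close>

lemma w_jointly_continuous: "continuous_on ({0..T} \<times> {0..1}) (\<lambda>p. w (fst p) (snd p))"
proof (rule continuous_on_eq_continuous_within[THEN iffD2], rule ballI)
  fix p assume "p \<in> {0..T} \<times> {0..1::real}"
  then obtain t x where p: "p = (t, x)" "t \<in> {0..T}" "x \<in> {0..1}" by auto
  let ?F = "at p within {0..T} \<times> {0..1}"
  have ev: "\<forall>\<^sub>F q in ?F. q \<in> {0..T} \<times> {0..1}" by (simp add: eventually_at_filter)
  have fst: "(fst \<longlongrightarrow> t) ?F" and snd: "(snd \<longlongrightarrow> x) ?F"
    using tendsto_fst[OF tendsto_ident_at[of p "{0..T} \<times> {0..1}"]] tendsto_snd[OF tendsto_ident_at[of p "{0..T} \<times> {0..1}"]]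
    by (simp_all add: p(1))
  have ev1: "\<forall>\<^sub>F q in ?F. fst q \<in> {0..T}" "\<forall>\<^sub>F q in ?F. snd q \<in> {0..1}"
    using ev by (eventually_elim, simp add: mem_Times_iff)+
  have c: "continuous_on {0..T} (\<lambda>s. L2norm2 {0..1} (\<lambda>x. wx s x - wx t x))"
  proof -
    have "L2norm2 {0..1} (\<lambda>x. wx s x - wx t x) = L2norm2 {0..1} (wx s) - 2 * Re (L2ip (wx s) (wx t)) + L2norm2 {0..1} (wx t)"
      if "s \<in> {0..T}" for s using L2norm2_diff_expand[OF wx_L2 wx_L2] that p by blast
    note eq = this
    have "continuous_on {0..T} (\<lambda>s. L2norm2 {0..1} (wx s) - 2 * Re (L2ip (wx s) (wx t)) + L2norm2 {0..1} (wx t))"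
      by (intro continuous_intros wx_norm_continuous wx_ip_continuous wx_L2 p)
    then show ?thesis by (rule continuous_on_eq) (rule eq[symmetric])
  qed
  have "((\<lambda>q. L2norm2 {0..1} (\<lambda>x. wx (fst q) x - wx t x)) \<longlongrightarrow> L2norm2 {0..1} (\<lambda>x. wx t x - wx t x)) ?F"
    by (rule continuous_on_tendsto_compose[OF c fst p(2) ev1(1)])
  then have "((\<lambda>q. sqrt (L2norm2 {0..1} (\<lambda>x. wx (fst q) x - wx t x))) \<longlongrightarrow> sqrt 0) ?F"
    by (intro tendsto_real_sqrt) (simp add: L2norm2_def)
  moreover have "((\<lambda>q. w t (snd q)) \<longlongrightarrow> w t x) ?F"
    using w_H10[OF p(2)] unfolding H10_def
    by (intro continuous_on_tendsto_compose[OF _ snd p(3) ev1(2)] H1_continuous[of _ "wx t"]) blast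
  then have "((\<lambda>q. cmod (w t (snd q) - w t x)) \<longlongrightarrow> 0) ?F"
    by (simp add: LIM_zero tendsto_norm_zero)
  ultimately have lim: "((\<lambda>q. sqrt (L2norm2 {0..1} (\<lambda>x. wx (fst q) x - wx t x)) + cmod (w t (snd q) - w t x)) \<longlongrightarrow> 0) ?F"
    unfolding real_sqrt_zero by (rule tendsto_add_zero)
  have "((\<lambda>q. w (fst q) (snd q) - w t x) \<longlongrightarrow> 0) ?F"
  proof (rule Lim_null_comparison[OF _ lim], use ev in eventually_elim)
    case (elim q)
    have "(cmod (w (fst q) (snd q) - w t (snd q)))\<^sup>2 \<le> L2norm2 {0..1} (\<lambda>x. wx (fst q) x - wx t x)"
      using elim p(2) by (intro H1_sup_le[OF H10_diff[OF w_H10 w_H10]]) (simp_all add: mem_Times_iff)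
    then have "cmod (w (fst q) (snd q) - w t (snd q)) \<le> sqrt (L2norm2 {0..1} (\<lambda>x. wx (fst q) x - wx t x))"
      by (simp add: real_le_rsqrt)
    then show ?case
      using norm_triangle_ineq[of "w (fst q) (snd q) - w t (snd q)" "w t (snd q) - w t x"] by simp
  qed
  then show "continuous ?F (\<lambda>p. w (fst p) (snd p))"
    using p(1) by (simp add: continuous_within LIM_zero_iff)
qed

definition aw :: "real \<Rightarrow> real \<Rightarrow> complex" where "aw t x = complex_of_real (a x) * w t x"

lemma w_L2prod: "L2prod T w"
  by (rule L2prod_continuous[OF w_jointly_continuous])

lemma aw_L2prod: "L2prod T aw"
  unfolding aw_def
  by (intro L2prod_continuous continuous_intros w_jointly_continuous continuous_on_compose2[OF a_cont]) auto

text \<open>With the potential on the right the operator is diagonal in the sines; the unknown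
  \<open>w\<close> is simply regarded as given here.\<close>

definition F :: "real \<Rightarrow> real \<Rightarrow> complex" where "F t x = G t x - aw t x"

lemma F_L2prod: "L2prod T F"
  unfolding F_def[abs_def] by (rule L2prod_diff[OF G aw_L2prod])

lemma ip_g: 
  assumes "L2on {0..1} \<phi>"
  shows "AE t in lebesgue_on {0..T}. L2ip (G t) \<phi> = L2ip (g t) \<phi>"
    and "AE t in lebesgue_on {0..T}. L2ip (F t) \<phi> = L2ip (G t) \<phi> - L2ip (aw t) \<phi>"
proof -
  show "AE t in lebesgue_on {0..T}. L2ip (F t) \<phi> = L2ip (G t) \<phi> - L2ip (aw t) \<phi>"
    using L2prod_section(1)[OF G] L2prod_section(1)[OF aw_L2prod]
    by eventually_elim (simp add: F_def[abs_def] L2ip_diff_left assms)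
  show "AE t in lebesgue_on {0..T}. L2ip (G t) \<phi> = L2ip (g t) \<phi>"
    using G_eq L2prod_section(1)[OF G]
  proof eventually_elim
    case (elim t)
    have m: "(\<lambda>x. G t x * cnj (\<phi> x)) \<in> borel_measurable (lebesgue_on {0..1})"
      using L2on_integrable_ip[OF elim(2) assms] by auto
    show ?case unfolding L2ip_def
      by (rule integral_lebesgue_on_cong_AE[OF m]) (use elim(1) in \<open>auto elim: eventually_mono\<close>)
  qed
qed

lemma integrable_ip_mult:
  assumes "L2prod T H" "L2on {0..1} \<phi>" "continuous_on {0..T} p"
  shows "integrable (lebesgue_on {0..T}) (\<lambda>t. L2ip (H t) \<phi> * p t)"
  by (intro L2on_integrable_mult L2prod_ip_L2on L2on_continuous assms)

lemma integral_ip_g: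
  assumes \<phi>: "L2on {0..1} \<phi>" and p: "continuous_on {0..T} p"
  shows "(\<integral>t. L2ip (g t) \<phi> * p t \<partial>lebesgue_on {0..T})
    = (\<integral>t. L2ip (F t) \<phi> * p t \<partial>lebesgue_on {0..T}) + (\<integral>t. L2ip (aw t) \<phi> * p t \<partial>lebesgue_on {0..T})"
proof -
  have m: "(\<lambda>t. L2ip (F t) \<phi> * p t + L2ip (aw t) \<phi> * p t) \<in> borel_measurable (lebesgue_on {0..T})"
    using integrable_ip_mult[OF F_L2prod \<phi> p] integrable_ip_mult[OF aw_L2prod \<phi> p] by auto
  have "(\<integral>t. L2ip (F t) \<phi> * p t + L2ip (aw t) \<phi> * p t \<partial>lebesgue_on {0..T}) = (\<integral>t. L2ip (g t) \<phi> * p t \<partial>lebesgue_on {0..T})"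
  proof (rule integral_lebesgue_on_cong_AE[OF m])
    show "AE t in lebesgue_on {0..T}. L2ip (F t) \<phi> * p t + L2ip (aw t) \<phi> * p t = L2ip (g t) \<phi> * p t"
      using ip_g[OF \<phi>] by eventually_elim (simp flip: distrib_right)
  qed auto
  then show ?thesis using integrable_ip_mult[OF F_L2prod \<phi> p] integrable_ip_mult[OF aw_L2prod \<phi> p] by simp
qed

definition c :: "nat \<Rightarrow> real \<Rightarrow> complex" where "c k t = L2ip (w t) (sn k)"
definition d :: "nat \<Rightarrow> real \<Rightarrow> complex" where "d k t = L2ip (wt t) (sn k)"
definition f :: "nat \<Rightarrow> real \<Rightarrow> complex" where "f k t = L2ip (F t) (sn k)"

lemma d_continuous: "continuous_on {0..T} (d k)"
  unfolding d_def[abs_def] by (rule wt_ip_continuous[OF SN.L2])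

lemma f_L2: "L2on {0..T} (f k)"
  unfolding f_def[abs_def] by (rule L2prod_ip_L2on[OF F_L2prod SN.L2])

text \<open>The difference quotients of \<open>w\<close> converge in L2, hence so do their inner
  products with a fixed sine.\<close>

lemma c_AC: "AC T (c k) (d k)"
proof (rule AC_vector_derivative[OF _ d_continuous])
  fix t assume t: "t \<in> {0..T}"
  have "((\<lambda>s. L2ip (\<lambda>x. (w s x - w t x) / complex_of_real (s - t)) (sn k)) \<longlongrightarrow> d k t) (at t within {0..T})"
    unfolding d_def
  proof (rule L2ip_tendsto[OF _ wt_L2[OF t] SN.L2 w_dq_tendsto[OF t]])
    show "\<forall>\<^sub>F s in at t within {0..T}. L2on {0..1} (\<lambda>x. (w s x - w t x) / complex_of_real (s - t))"
      using eventually_in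
    proof eventually_elim
      case (elim s)
      from L2on_cmult[OF L2on_diff[OF w_L2[OF elim] w_L2[OF t]], of "inverse (complex_of_real (s - t))"]
      show ?case by (simp add: divide_inverse mult.commute)
    qed
  qed
  moreover have "\<forall>\<^sub>F s in at t within {0..T}. L2ip (\<lambda>x. (w s x - w t x) / complex_of_real (s - t)) (sn k) = (c k s - c k t) /\<^sub>R (s - t)"
    using eventually_in
  proof eventually_elim
    case (elim s)
    have "L2ip (\<lambda>x. (w s x - w t x) / complex_of_real (s - t)) (sn k) = L2ip (\<lambda>x. complex_of_real (inverse (s - t)) * (w s x - w t x)) (sn k)"
      by (simp add: divide_inverse mult.commute)
    also have "\<dots> = complex_of_real (inverse (s - t)) * (c k s - c k t)"
      unfolding L2ip_cmult_left c_def by (subst L2ip_diff_left[OF w_L2[OF elim] w_L2[OF t] SN.L2]) simp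
    finally show ?case by (simp add: scaleR_conv_of_real)
  qed
  ultimately have "((\<lambda>s. (c k s - c k t) /\<^sub>R (s - t)) \<longlongrightarrow> d k t) (at t within {0..T})"
    by (rule Lim_transform_eventually)
  then show "(c k has_vector_derivative d k t) (at t within {0..T})"
    unfolding has_vector_derivative_def has_derivative_iff_norm
  proof (intro conjI bounded_linear_scaleR_left)
    assume *: "((\<lambda>s. (c k s - c k t) /\<^sub>R (s - t)) \<longlongrightarrow> d k t) (at t within {0..T})"
    have "((\<lambda>s. norm ((c k s - c k t) /\<^sub>R (s - t) - d k t)) \<longlongrightarrow> 0) (at t within {0..T})"
      using * by (intro tendsto_norm_zero) (simp add: LIM_zero)
    then show "((\<lambda>s. norm (c k s - c k t - (s - t) *\<^sub>R d k t) / norm (s - t)) \<longlongrightarrow> 0) (at t within {0..T})"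
    proof (rule Lim_transform_eventually)
      have "norm ((c k s - c k t) /\<^sub>R (s - t) - d k t) = norm (c k s - c k t - (s - t) *\<^sub>R d k t) / norm (s - t)" if "s \<noteq> t" for s
      proof -
        have "(c k s - c k t) /\<^sub>R (s - t) - d k t = (c k s - c k t - (s - t) *\<^sub>R d k t) /\<^sub>R (s - t)"
          using that by (simp add: scaleR_diff_right)
        then show ?thesis by (simp add: divide_inverse mult.commute)
      qed
      then show "\<forall>\<^sub>F s in at t within {0..T}. norm ((c k s - c k t) /\<^sub>R (s - t) - d k t) = norm (c k s - c k t - (s - t) *\<^sub>R d k t) / norm (s - t)"
        by (simp add: eventually_at_filter)
    qed
  qed
qed

lemma c_continuous: "continuous_on {0..T} (c k)"
  by (rule AC_continuous_on[OF c_AC])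

lemma ip_wx: "t \<in> {0..T} \<Longrightarrow> L2ip (wx t) (cs (Suc k)) = complex_of_real (freq k) * c k t"
  and ip_wx0: "t \<in> {0..T} \<Longrightarrow> L2ip (wx t) (cs 0) = 0"
  unfolding c_def using H10_ip_cs[OF w_H10] by blast+

text \<open>Testing the weak equation with \<open>sn k\<close> gives c'' + freq^2 c = f in the sense
  of distributions in time, which \<open>du_Bois_Reymond\<close> turns into an integrated
  equation.\<close>

lemma d_AC: "AC T (d k) (\<lambda>t. f k t - complex_of_real ((freq k)\<^sup>2) * c k t)"
proof (rule du_Bois_Reymond[OF d_continuous _ T_pos])
  show "integrable (lebesgue_on {0..T}) (\<lambda>t. f k t - complex_of_real ((freq k)\<^sup>2) * c k t)"
    by (intro L2on_integrable L2on_diff L2on_cmult f_L2 L2on_continuous c_continuous)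
  fix p assume p: "test_fun T p"
  let ?I = "integral\<^sup>L (lebesgue_on {0..T})"
  let ?p = "\<lambda>t. complex_of_real (p t)"
  have pc: "continuous_on {0..T} ?p" by (intro continuous_intros test_fun_continuous[OF p])
  have "- ?I (\<lambda>t. d k t * complex_of_real (deriv p t))
        + ?I (\<lambda>t. L2ip (wx t) (\<lambda>x. complex_of_real (freq k) * cs (Suc k) x) * ?p t)
        + ?I (\<lambda>t. L2ip (aw t) (sn k) * ?p t) = ?I (\<lambda>t. L2ip (g t) (sn k) * ?p t)"
    using weak p H10_sn unfolding weak_solution_def d_def aw_def by blast
  moreover have "?I (\<lambda>t. L2ip (wx t) (\<lambda>x. complex_of_real (freq k) * cs (Suc k) x) * ?p t)
     = ?I (\<lambda>t. complex_of_real ((freq k)\<^sup>2) * c k t * ?p t)"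
    by (intro Bochner_Integration.integral_cong refl) (simp add: L2ip_cmult_right ip_wx power2_eq_square)
  moreover have "integrable (lebesgue_on {0..T}) (\<lambda>t. f k t * ?p t)"
    by (intro L2on_integrable_mult f_L2 L2on_continuous pc)
  moreover have "integrable (lebesgue_on {0..T}) (\<lambda>t. complex_of_real ((freq k)\<^sup>2) * c k t * ?p t)"
    by (intro continuous_on_integrable_Icc continuous_intros c_continuous pc)
  ultimately show "- ?I (\<lambda>t. d k t * complex_of_real (deriv p t)) = ?I (\<lambda>t. (f k t - complex_of_real ((freq k)\<^sup>2) * c k t) * ?p t)"
    unfolding integral_ip_g[OF SN.L2 pc] f_def[symmetric]
    by (simp add: left_diff_distrib algebra_simps)
qed

text \<open>Termwise x-derivative at 0 of the truncated sine series of \<open>w\<close>. Convergence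
  as n grows is sought only in L2(0,T).\<close>

definition flux :: "nat \<Rightarrow> real \<Rightarrow> complex" where
  "flux n t = (\<Sum>k<n. complex_of_real (sqrt 2 * freq k) * c k t)"

lemma flux_continuous: "continuous_on {0..T} (flux n)"
  unfolding flux_def[abs_def] by (intro continuous_intros c_continuous)

text \<open>Mode by mode this is the equation for \<open>c k\<close> multiplied by the coefficient
  of the test function; the boundary contribution of each cosine adds up to the flux. The cosine
  projection has \<open>Suc n\<close> terms because its member of index 0 carries coefficient zero
  and the others pair with the first n sines.\<close>

lemma truncated_Green:
  assumes \<phi>: "H1 \<phi> \<phi>x" "\<phi> 1 = 0" and p: "test_fun T p"
  shows "- (\<integral>t. L2ip (SN.proj n (wt t)) \<phi> * complex_of_real (deriv p t) \<partial>lebesgue_on {0..T})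
     + (\<integral>t. L2ip (CS.proj (Suc n) (wx t)) \<phi>x * complex_of_real (p t) \<partial>lebesgue_on {0..T})
     + (\<integral>t. flux n t * cnj (\<phi> 0) * complex_of_real (p t) \<partial>lebesgue_on {0..T})
    = (\<integral>t. L2ip (SN.proj n (F t)) \<phi> * complex_of_real (p t) \<partial>lebesgue_on {0..T})"
proof -
  let ?I = "integral\<^sup>L (lebesgue_on {0..T})"
  let ?p = "\<lambda>t. complex_of_real (p t)" and ?p' = "\<lambda>t. complex_of_real (deriv p t)"
  define \<eta> where "\<eta> k = L2ip (sn k) \<phi>" for k
  have pc: "continuous_on {0..T} ?p" "continuous_on {0..T} ?p'" by (intro continuous_intros test_fun_continuous[OF p])+
  have \<phi>L: "L2on {0..1} \<phi>" "L2on {0..1} \<phi>x" using H1_L2[OF \<phi>(1)] .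
  have 1: "?I (\<lambda>t. L2ip (SN.proj n (wt t)) \<phi> * ?p' t) = (\<Sum>k<n. \<eta> k * ?I (\<lambda>t. d k t * ?p' t))"
  proof -
    have "?I (\<lambda>t. L2ip (SN.proj n (wt t)) \<phi> * ?p' t) = ?I (\<lambda>t. \<Sum>k<n. \<eta> k * (d k t * ?p' t))"
      unfolding SN.proj_def[abs_def] SN.ip_lincomb_left[OF \<phi>L(1)] d_def \<eta>_def
      by (intro Bochner_Integration.integral_cong refl) (simp add: sum_distrib_left sum_distrib_right mult_ac)
    also have "\<dots> = (\<Sum>k<n. \<eta> k * ?I (\<lambda>t. d k t * ?p' t))"
      by (subst Bochner_Integration.integral_sum) (auto intro!: continuous_on_integrable_Icc continuous_intros d_continuous pc)
    finally show ?thesis .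
  qed
  have 3: "?I (\<lambda>t. L2ip (SN.proj n (F t)) \<phi> * ?p t) = (\<Sum>k<n. \<eta> k * ?I (\<lambda>t. f k t * ?p t))"
  proof -
    have "?I (\<lambda>t. L2ip (SN.proj n (F t)) \<phi> * ?p t) = ?I (\<lambda>t. \<Sum>k<n. \<eta> k * (f k t * ?p t))"
      unfolding SN.proj_def[abs_def] SN.ip_lincomb_left[OF \<phi>L(1)] f_def \<eta>_def
      by (intro Bochner_Integration.integral_cong refl) (simp add: sum_distrib_left sum_distrib_right mult_ac)
    also have "\<dots> = (\<Sum>k<n. \<eta> k * ?I (\<lambda>t. f k t * ?p t))"
      by (subst Bochner_Integration.integral_sum)
        (intro Bochner_Integration.integrable_mult_right L2on_integrable_mult[OF f_L2 L2on_continuous[OF pc(1)]], simp)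
    finally show ?thesis .
  qed
  have 2: "?I (\<lambda>t. L2ip (CS.proj (Suc n) (wx t)) \<phi>x * ?p t) + ?I (\<lambda>t. flux n t * cnj (\<phi> 0) * ?p t)
     = (\<Sum>k<n. \<eta> k * ?I (\<lambda>t. complex_of_real ((freq k)\<^sup>2) * c k t * ?p t))"
  proof -
    have e: "L2ip (CS.proj (Suc n) (wx t)) \<phi>x = - flux n t * cnj (\<phi> 0) + (\<Sum>k<n. \<eta> k * (complex_of_real ((freq k)\<^sup>2) * c k t))"
      if t: "t \<in> {0..T}" for t
    proof -
      have "L2ip (CS.proj (Suc n) (wx t)) \<phi>x = (\<Sum>k<n. complex_of_real (freq k) * c k t * L2ip (cs (Suc k)) \<phi>x)"
        unfolding CS.proj_def[abs_def] CS.ip_lincomb_left[OF \<phi>L(2)]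
        by (subst sum.lessThan_Suc_shift) (simp add: ip_wx[OF t] ip_wx0[OF t])
      also have "\<dots> = (\<Sum>k<n. - (complex_of_real (sqrt 2 * freq k) * c k t) * cnj (\<phi> 0) + \<eta> k * (complex_of_real ((freq k)\<^sup>2) * c k t))"
        by (simp add: cs_ip_H1[OF \<phi>] \<eta>_def algebra_simps power2_eq_square)
      also have "\<dots> = - flux n t * cnj (\<phi> 0) + (\<Sum>k<n. \<eta> k * (complex_of_real ((freq k)\<^sup>2) * c k t))"
        by (simp add: flux_def sum.distrib sum_distrib_right sum_negf sum_subtractf)
      finally show ?thesis .
    qed
    have "?I (\<lambda>t. L2ip (CS.proj (Suc n) (wx t)) \<phi>x * ?p t)
       = ?I (\<lambda>t. (\<Sum>k<n. \<eta> k * (complex_of_real ((freq k)\<^sup>2) * c k t * ?p t)) - flux n t * cnj (\<phi> 0) * ?p t)"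
    proof (intro Bochner_Integration.integral_cong refl)
      fix t assume "t \<in> space (lebesgue_on {0..T})"
      then have "t \<in> {0..T}" by simp
      from e[OF this] show "L2ip (CS.proj (Suc n) (wx t)) \<phi>x * ?p t
        = (\<Sum>k<n. \<eta> k * (complex_of_real ((freq k)\<^sup>2) * c k t * ?p t)) - flux n t * cnj (\<phi> 0) * ?p t"
        by (simp add: left_diff_distrib distrib_right sum_distrib_right mult.assoc)
    qed
    also have "\<dots> = ?I (\<lambda>t. \<Sum>k<n. \<eta> k * (complex_of_real ((freq k)\<^sup>2) * c k t * ?p t)) - ?I (\<lambda>t. flux n t * cnj (\<phi> 0) * ?p t)"
      by (intro Bochner_Integration.integral_diff continuous_on_integrable_Icc continuous_intros flux_continuous c_continuous pc)
    also have "?I (\<lambda>t. \<Sum>k<n. \<eta> k * (complex_of_real ((freq k)\<^sup>2) * c k t * ?p t)) = (\<Sum>k<n. \<eta> k * ?I (\<lambda>t. complex_of_real ((freq k)\<^sup>2) * c k t * ?p t))"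
      by (subst Bochner_Integration.integral_sum) (auto intro!: continuous_on_integrable_Icc continuous_intros c_continuous pc)
    finally show ?thesis by simp
  qed
  \<comment> \<open>The equation of mode k tested in time; the boundary terms vanish with
    \<open>p\<close>.\<close>
  have k: "- ?I (\<lambda>t. d k t * ?p' t) + ?I (\<lambda>t. complex_of_real ((freq k)\<^sup>2) * c k t * ?p t) = ?I (\<lambda>t. f k t * ?p t)" for k
  proof -
    have "?I (\<lambda>t. (f k t - complex_of_real ((freq k)\<^sup>2) * c k t) * ?p t) = - ?I (\<lambda>t. d k t * ?p' t)"
      using AC_by_parts[OF d_AC test_fun_AC[OF p]] T_pos test_fun_endpoints[OF p] by simp
    moreover have "?I (\<lambda>t. (f k t - complex_of_real ((freq k)\<^sup>2) * c k t) * ?p t) = ?I (\<lambda>t. f k t * ?p t) - ?I (\<lambda>t. complex_of_real ((freq k)\<^sup>2) * c k t * ?p t)"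
      unfolding left_diff_distrib
      by (intro Bochner_Integration.integral_diff L2on_integrable_mult f_L2 L2on_continuous continuous_intros c_continuous pc)
    ultimately show ?thesis by (simp add: algebra_simps)
  qed
  have "(\<Sum>k<n. \<eta> k * ?I (\<lambda>t. f k t * ?p t)) = (\<Sum>k<n. \<eta> k * (- ?I (\<lambda>t. d k t * ?p' t) + ?I (\<lambda>t. complex_of_real ((freq k)\<^sup>2) * c k t * ?p t)))"
    by (simp only: k)
  also have "\<dots> = - (\<Sum>k<n. \<eta> k * ?I (\<lambda>t. d k t * ?p' t)) + (\<Sum>k<n. \<eta> k * ?I (\<lambda>t. complex_of_real ((freq k)\<^sup>2) * c k t * ?p t))"
    unfolding distrib_left sum.distrib mult_minus_right sum_negf ..
  finally show ?thesis unfolding 1 3 using 2 by (simp add: add.assoc)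
qed

text \<open>All terms of the truncated Green formula converge: the interior ones by completeness of
  the two systems, the boundary one by assumption. Restoring \<open>a w\<close> on the left gives
  the characterisation with the original forcing.\<close>

lemma normal_derivative_limit:
  assumes \<psi>: "L2on {0..T} \<psi>" and lim: "(\<lambda>n. L2norm2 {0..T} (\<lambda>t. flux n t - \<psi> t)) \<longlonglongrightarrow> 0"
  shows "normal_derivative_at_0 a T g w wx wt \<psi>"
  unfolding normal_derivative_at_0_def
proof (intro conjI allI impI \<psi>)
  fix \<phi> \<phi>x p assume \<phi>: "H1 \<phi> \<phi>x" "\<phi> 1 = 0" and p: "test_fun T p"
  let ?M = "lebesgue_on {0..T}"
  let ?I = "integral\<^sup>L ?M"
  let ?p = "\<lambda>t. complex_of_real (p t)" and ?p' = "\<lambda>t. complex_of_real (deriv p t)"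
  have pc: "continuous_on {0..T} ?p" "continuous_on {0..T} ?p'" by (intro continuous_intros test_fun_continuous[OF p])+
  have \<phi>L: "L2on {0..1} \<phi>" "L2on {0..1} \<phi>x" using H1_L2[OF \<phi>(1)] .
  have 1: "(\<lambda>n. ?I (\<lambda>t. L2ip (SN.proj n (wt t)) \<phi> * ?p' t)) \<longlonglongrightarrow> ?I (\<lambda>t. L2ip (wt t) \<phi> * ?p' t)"
    by (rule SN.integral_ip_proj_tendsto[OF _ _ _ \<phi>L(1) pc(2)])
      (intro AE_I2 wt_L2 continuous_imp_measurable_on_sets_lebesgue wt_ip_continuous continuous_on_integrable_Icc wt_norm_continuous; simp)+
  have 2: "(\<lambda>n. ?I (\<lambda>t. L2ip (CS.proj n (wx t)) \<phi>x * ?p t)) \<longlonglongrightarrow> ?I (\<lambda>t. L2ip (wx t) \<phi>x * ?p t)"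
    by (rule CS.integral_ip_proj_tendsto[OF _ _ _ \<phi>L(2) pc(1)])
      (intro AE_I2 wx_L2 continuous_imp_measurable_on_sets_lebesgue wx_ip_continuous continuous_on_integrable_Icc wx_norm_continuous; simp)+
  have 3: "(\<lambda>n. ?I (\<lambda>t. L2ip (SN.proj n (F t)) \<phi> * ?p t)) \<longlonglongrightarrow> ?I (\<lambda>t. L2ip (F t) \<phi> * ?p t)"
    by (rule SN.integral_ip_proj_tendsto[OF L2prod_section(1)[OF F_L2prod] L2prod_ip_measurable[OF F_L2prod]
          L2prod_section(2)[OF F_L2prod] \<phi>L(1) pc(1)])
  define q where "q t = cnj (\<phi> 0) * ?p t" for t
  have q: "L2on {0..T} q" unfolding q_def[abs_def] by (intro L2on_continuous continuous_intros pc)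
  have fl: "L2on {0..T} (flux n)" for n by (intro L2on_continuous flux_continuous)
  have 4: "(\<lambda>n. ?I (\<lambda>t. flux n t * q t)) \<longlonglongrightarrow> ?I (\<lambda>t. \<psi> t * q t)"
  proof -
    have "(\<lambda>n. L2norm2 {0..T} (\<lambda>t. flux n t - \<psi> t) * L2norm2 {0..T} q) \<longlonglongrightarrow> 0 * L2norm2 {0..T} q"
      by (intro tendsto_intros lim)
    then have "(\<lambda>n. L2norm2 {0..T} (\<lambda>t. flux n t - \<psi> t) * L2norm2 {0..T} q) \<longlonglongrightarrow> 0" by simp
    then have "(\<lambda>n. (cmod (?I (\<lambda>t. flux n t * q t) - ?I (\<lambda>t. \<psi> t * q t)))\<^sup>2) \<longlonglongrightarrow> 0"
    proof (rule tendsto_sandwich[OF _ _ tendsto_const, rotated 2])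
      have "(cmod (?I (\<lambda>t. flux n t * q t) - ?I (\<lambda>t. \<psi> t * q t)))\<^sup>2 \<le> L2norm2 {0..T} (\<lambda>t. flux n t - \<psi> t) * L2norm2 {0..T} q" for n
        using Cauchy_Schwarz_sqint[of ?M "\<lambda>t. flux n t - \<psi> t" q] fl[of n] \<psi> q
          L2on_integrable_mult[OF fl q, of n] L2on_integrable_mult[OF \<psi> q]
        by (auto simp: L2on_iff_sqint L2norm2_def left_diff_distrib)
      then show "\<forall>\<^sub>F n in sequentially. (cmod (?I (\<lambda>t. flux n t * q t) - ?I (\<lambda>t. \<psi> t * q t)))\<^sup>2 \<le> L2norm2 {0..T} (\<lambda>t. flux n t - \<psi> t) * L2norm2 {0..T} q"
        by simp
    qed simp
    then have "(\<lambda>n. sqrt ((cmod (?I (\<lambda>t. flux n t * q t) - ?I (\<lambda>t. \<psi> t * q t)))\<^sup>2)) \<longlonglongrightarrow> sqrt 0"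
      by (intro tendsto_intros)
    then show ?thesis by (simp add: LIM_zero_iff tendsto_norm_zero_iff)
  qed
  have "(\<lambda>n. - ?I (\<lambda>t. L2ip (SN.proj n (wt t)) \<phi> * ?p' t) + ?I (\<lambda>t. L2ip (CS.proj (Suc n) (wx t)) \<phi>x * ?p t) + ?I (\<lambda>t. flux n t * q t))
    \<longlonglongrightarrow> - ?I (\<lambda>t. L2ip (wt t) \<phi> * ?p' t) + ?I (\<lambda>t. L2ip (wx t) \<phi>x * ?p t) + ?I (\<lambda>t. \<psi> t * q t)"
    by (intro tendsto_intros 1 4 LIMSEQ_Suc[OF 2])
  moreover have "- ?I (\<lambda>t. L2ip (SN.proj n (wt t)) \<phi> * ?p' t) + ?I (\<lambda>t. L2ip (CS.proj (Suc n) (wx t)) \<phi>x * ?p t) + ?I (\<lambda>t. flux n t * q t)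
     = ?I (\<lambda>t. L2ip (SN.proj n (F t)) \<phi> * ?p t)" for n
    using truncated_Green[OF \<phi> p, of n] by (simp add: q_def mult.assoc)
  ultimately have "- ?I (\<lambda>t. L2ip (wt t) \<phi> * ?p' t) + ?I (\<lambda>t. L2ip (wx t) \<phi>x * ?p t) + ?I (\<lambda>t. \<psi> t * q t) = ?I (\<lambda>t. L2ip (F t) \<phi> * ?p t)"
    using LIMSEQ_unique[OF _ 3] by simp
  then show "- ?I (\<lambda>t. L2ip (wt t) \<phi> * ?p' t) + ?I (\<lambda>t. L2ip (wx t) \<phi>x * ?p t)
     + ?I (\<lambda>t. L2ip (\<lambda>x. complex_of_real (a x) * w t x) \<phi> * ?p t) + ?I (\<lambda>t. \<psi> t * cnj (\<phi> 0) * ?p t) = ?I (\<lambda>t. L2ip (g t) \<phi> * ?p t)"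
    unfolding integral_ip_g[OF \<phi>L(1) pc(1)] aw_def[symmetric] q_def by (simp add: algebra_simps)
qed

end

section \<open>The mass matrix and cell averages\<close>

text \<open>Shooting from the left for the mass equation, with the values at nodes 0 and 1 set to
  zero. Every entry is a fixed finite linear combination of entries of \<open>y\<close>, so
  regularity in time is inherited.\<close>

fun forward :: "real \<Rightarrow> (nat \<Rightarrow> complex) \<Rightarrow> nat \<Rightarrow> complex" where
  "forward h y 0 = 0"
| "forward h y (Suc 0) = 0"
| "forward h y (Suc (Suc j)) = complex_of_real (4 / h) * y (Suc j) - 2 * forward h y (Suc j) - forward h y j"

text \<open>The sequence \<open>(-1)^j j\<close> solves the homogeneous recursion; the multiple of it added to \<open>forward\<close> makes the
  value at \<open>N + 1\<close> vanish.\<close>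
definition tri_inv :: "nat \<Rightarrow> real \<Rightarrow> (nat \<Rightarrow> complex) \<Rightarrow> nat \<Rightarrow> complex" where
  "tri_inv N h y j = forward h y j + (-1) ^ (j + N) * of_nat j / of_nat (Suc N) * forward h y (Suc N)"

lemma tri_inv_solves:
  assumes "h \<noteq> 0"
  shows "complex_of_real (h / 4) * (tri_inv N h y j + 2 * tri_inv N h y (Suc j) + tri_inv N h y (Suc (Suc j))) = y (Suc j)"
proof -
  have "tri_inv N h y j + 2 * tri_inv N h y (Suc j) + tri_inv N h y (Suc (Suc j)) = complex_of_real (4 / h) * y (Suc j)"
    unfolding tri_inv_def by (simp add: algebra_simps add_divide_distrib[symmetric])
  then show ?thesis using assms by simp
qed

text \<open>A solution vanishing at 0 differs from \<open>forward\<close> by a multiple of the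
  alternating sequence with modulus j; that sequence is nonzero at N + 1, so the second boundary
  condition fixes the multiple. This is invertibility of the mass matrix in explicit form.\<close>

lemma tri_inv_unique:
  assumes h: "h \<noteq> 0" and bd: "v 0 = 0" "v (Suc N) = 0"
    and eq: "\<And>j. j < N \<Longrightarrow> complex_of_real (h / 4) * (v j + 2 * v (Suc j) + v (Suc (Suc j))) = y (Suc j)"
    and j: "j \<le> Suc N"
  shows "v j = tri_inv N h y j"
proof -
  have rec: "v (Suc (Suc j)) = complex_of_real (4 / h) * y (Suc j) - 2 * v (Suc j) - v j" if "j < N" for j
    unfolding eq[OF that, symmetric] using h by (simp add: algebra_simps)
  have form: "v j = forward h y j + (-1) ^ Suc j * of_nat j * v 1" if "j \<le> Suc N" for j
    using that
  proof (induction j rule: less_induct)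
    case (less j)
    consider "j = 0" | "j = 1" | i where "j = Suc (Suc i)" by (metis One_nat_def not0_implies_Suc)
    then show ?case
    proof cases
      case 3
      then have i: "i < N" using less.prems by simp
      show ?thesis unfolding 3 rec[OF i] using less.IH[of i] less.IH[of "Suc i"] less.prems 3
        by (simp add: algebra_simps)
    qed (use bd in auto)
  qed
  have "v 1 * of_nat (Suc N) = (-1) ^ Suc N * forward h y (Suc N)"
  proof -
    have "0 = forward h y (Suc N) + (-1) ^ N * (of_nat (Suc N) * v 1)"
      using form[of "Suc N"] bd(2) by (simp add: mult.assoc)
    then have "(-1) ^ N * 0 = (-1) ^ N * forward h y (Suc N) + ((-1) ^ N * (-1) ^ N) * (of_nat (Suc N) * v 1)"
      by (metis distrib_left mult.assoc)
    then have "of_nat (Suc N) * v 1 + (-1) ^ N * forward h y (Suc N) = 0"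
      by (simp add: power_add[symmetric] add.commute del: of_nat_Suc flip: mult_2)
    then show ?thesis by (simp add: eq_neg_iff_add_eq_0 mult.commute del: of_nat_Suc)
  qed
  then have "v 1 = (-1) ^ Suc N * forward h y (Suc N) / of_nat (Suc N)"
    unfolding nonzero_eq_divide_eq[OF of_nat_neq_0] .
  then show ?thesis using form[OF j] by (simp add: tri_inv_def power_add mult_ac)
qed

lemma forward_AC:
  assumes "\<And>i. i \<in> {1..N} \<Longrightarrow> AC T (\<lambda>t. y t i) (\<lambda>t. y' t i)" "j \<le> Suc N"
  shows "AC T (\<lambda>t. forward h (y t) j) (\<lambda>t. forward h (y' t) j)"
  using assms(2)
proof (induction j rule: less_induct)
  case (less j)
  consider "j = 0" | "j = 1" | i where "j = Suc (Suc i)" by (metis One_nat_def not0_implies_Suc)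
  then show ?case
  proof cases
    case 3
    show ?thesis unfolding 3 forward.simps
      by (intro AC_diff AC_cmult assms(1) less.IH) (use less.prems 3 in auto)
  qed (auto simp: AC_const)
qed

text \<open>The discrete solution is only known to satisfy an integral equation for the mass matrix
  applied to V. Inverting that matrix explicitly transfers absolute continuity, and the density, to
  V itself.\<close>

lemma tri_inv_AC:
  assumes "\<And>i. i \<in> {1..N} \<Longrightarrow> AC T (\<lambda>t. y t i) (\<lambda>t. y' t i)" "j \<le> Suc N"
  shows "AC T (\<lambda>t. tri_inv N h (y t) j) (\<lambda>t. tri_inv N h (y' t) j)"
  unfolding tri_inv_def
  by (intro AC_add AC_cmult forward_AC[where N = N, OF assms(1)]) (use assms(2) in auto)

section \<open>Mesh, cell means and half-cell integrals\<close>

lemma mesh_pos: "mesh N > 0" and Suc_mesh: "real (Suc N) * mesh N = 1"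
  by (simp_all add: mesh_def)

lemma node_0 [simp]: "node N 0 = 0" and node_1: "node N (Suc 0) = mesh N"
  and node_last [simp]: "node N (Suc N) = 1" and node_Suc: "node N (Suc j) = node N j + mesh N"
  by (simp_all add: node_def mesh_def add.commute algebra_simps add_divide_distrib[symmetric])

lemma node_in_unit: "j \<le> Suc N \<Longrightarrow> node N j \<in> {0..1}"
  by (simp add: node_def mesh_def)

definition cell_mean :: "nat \<Rightarrow> (real \<Rightarrow> complex) \<Rightarrow> nat \<Rightarrow> complex" where
  "cell_mean N u j = integral\<^sup>L (lebesgue_on {node N j..node N (Suc j)}) u / complex_of_real (mesh N)"

lemma cell_subset: "j \<le> N \<Longrightarrow> {node N j..node N (Suc j)} \<subseteq> {0..1}"
  using node_in_unit[of j N] node_in_unit[of "Suc j" N] by auto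

lemma node_mono: "node N j \<le> node N (Suc j)"
  using mesh_pos[of N] by (simp add: node_Suc)

lemma integral_lebesgue_on_combine:
  fixes u :: "real \<Rightarrow> complex"
  assumes "integrable (lebesgue_on {a..c}) u" "a \<le> b" "b \<le> c"
  shows "integral\<^sup>L (lebesgue_on {a..c}) u = integral\<^sup>L (lebesgue_on {a..b}) u + integral\<^sup>L (lebesgue_on {b..c}) u"
proof -
  have "integrable (lebesgue_on {a..b}) u" "integrable (lebesgue_on {b..c}) u"
    using assms by (auto intro: integrable_lebesgue_on_subset)
  then show ?thesis
    using assms integrable_on_lebesgue_on[OF assms(1)]
    by (simp add: lebesgue_integral_eq_integral Henstock_Kurzweil_Integration.integral_combine)
qed

text \<open>The support of the half-cell integral consists of two full cells, hence it has exactly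
  the averaged form in which \<open>r\<close> enters \<open>scheme\<close>.\<close>

lemma half_cell_int_eq:
  assumes u: "integrable (lebesgue_on {0..1}) u" and j: "j < N"
  shows "half_cell_int N u (Suc j) = complex_of_real (mesh N / 2) * (cell_mean N u j + cell_mean N u (Suc j))"
proof -
  have "integrable (lebesgue_on {node N j..node N (Suc (Suc j))}) u"
    using node_in_unit[of j N] node_in_unit[of "Suc (Suc j)" N] j
    by (intro integrable_lebesgue_on_subset[OF u]) auto
  from integral_lebesgue_on_combine[OF this node_mono node_mono] show ?thesis
    using mesh_pos[of N] by (simp add: half_cell_int_def cell_mean_def field_simps)
qed

lemma cell_mean_sq_le:
  assumes u: "L2on {0..1} u" and j: "j \<le> N"
  shows "mesh N * (cmod (cell_mean N u j))\<^sup>2 \<le> (\<integral>x. (cmod (u x))\<^sup>2 \<partial>lebesgue_on {node N j..node N (Suc j)})"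
proof -
  let ?C = "{node N j..node N (Suc j)}"
  interpret F: finite_measure "lebesgue_on ?C" by (rule finite_measure_lebesgue_on_Icc)
  have "sqint (lebesgue_on ?C) u"
    using L2on_subset[OF u cell_subset[OF j]] by (simp add: L2on_iff_sqint)
  then have "(cmod (\<integral>x. u x * 1 \<partial>lebesgue_on ?C))\<^sup>2 \<le> (\<integral>x. (cmod (u x))\<^sup>2 \<partial>lebesgue_on ?C) * (\<integral>x. (cmod 1)\<^sup>2 \<partial>lebesgue_on ?C)"
    by (rule Cauchy_Schwarz_sqint) auto
  also have "(\<integral>x. (cmod 1)\<^sup>2 \<partial>lebesgue_on ?C) = mesh N"
    using mesh_pos[of N] by (simp add: measure_restrict_space node_Suc)
  finally show ?thesis
    using mesh_pos[of N] by (simp add: cell_mean_def norm_divide power_divide power2_eq_square field_simps)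
qed

text \<open>Cauchy-Schwarz in each cell, then additivity over cells: passing to cell means does not
  increase the L2 norm, so no regularity of the source is required.\<close>

lemma sum_cell_mean_sq_le:
  assumes u: "L2on {0..1} u"
  shows "mesh N * (\<Sum>j\<le>N. (cmod (cell_mean N u j))\<^sup>2) \<le> L2norm2 {0..1} u"
proof -
  \<comment> \<open>The integrand is viewed as complex because
    \<open>integral_lebesgue_on_combine\<close> is stated for complex functions.\<close>
  let ?f = "\<lambda>x. complex_of_real ((cmod (u x))\<^sup>2)"
  have fi: "integrable (lebesgue_on {0..1}) ?f" by (rule integrable_of_real) (use u in \<open>simp add: L2on_def\<close>)
  have sums: "(\<Sum>j<n. integral\<^sup>L (lebesgue_on {node N j..node N (Suc j)}) ?f) = integral\<^sup>L (lebesgue_on {0..node N n}) ?f"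
    if "n \<le> Suc N" for n
    using that
  proof (induction n)
    case (Suc n)
    have "integrable (lebesgue_on {0..node N (Suc n)}) ?f"
      using node_in_unit[OF Suc.prems] by (intro integrable_lebesgue_on_subset[OF fi]) auto
    from integral_lebesgue_on_combine[OF this _ node_mono] show ?case
      using Suc node_in_unit[of n N] by simp
  qed simp
  have "mesh N * (\<Sum>j\<le>N. (cmod (cell_mean N u j))\<^sup>2) \<le> (\<Sum>j\<le>N. \<integral>x. (cmod (u x))\<^sup>2 \<partial>lebesgue_on {node N j..node N (Suc j)})"
    unfolding sum_distrib_left by (intro sum_mono cell_mean_sq_le[OF u]) auto
  also have "\<dots> = L2norm2 {0..1} u"
  proof -
    have "complex_of_real (\<Sum>j\<le>N. \<integral>x. (cmod (u x))\<^sup>2 \<partial>lebesgue_on {node N j..node N (Suc j)}) = complex_of_real (L2norm2 {0..1} u)"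
      using sums[of "Suc N"] unfolding of_real_sum lessThan_Suc_atMost
      by (simp add: L2norm2_def del: of_real_power flip: integral_complex_of_real)
    then show ?thesis by (simp only: of_real_eq_iff)
  qed
  finally show ?thesis .
qed

lemma L2prod_tensor:
  assumes \<alpha>: "L2on {0..T} \<alpha>" and \<phi>: "L2on {0..1} \<phi>"
  shows "L2prod T (\<lambda>t x. \<alpha> t * \<phi> x)"
  unfolding L2prod_def sqint_def
proof
  interpret P: pair_sigma_finite "lebesgue_on {0..T}" "lebesgue_on {0..1::real}"
    by (rule pair_sigma_finite_lebesgue_on)
  have [measurable]: "\<alpha> \<in> borel_measurable (lebesgue_on {0..T})" "\<phi> \<in> borel_measurable (lebesgue_on {0..1})"
    using assms by (auto simp: L2on_def)
  show m[measurable]: "(\<lambda>p. \<alpha> (fst p) * \<phi> (snd p)) \<in> borel_measurable (rectM T)" by measurable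
  show "integrable (rectM T) (\<lambda>p. (cmod (\<alpha> (fst p) * \<phi> (snd p)))\<^sup>2)"
    by (rule P.Fubini_integrable) (use assms in \<open>auto simp: norm_mult power_mult_distrib L2on_def\<close>)
qed

lemma L2norm2_sum_le:
  assumes "\<And>k. k < n \<Longrightarrow> L2on S (u k)"
  shows "L2norm2 S (\<lambda>t. \<Sum>k<n. x k * u k t) \<le> real n * (\<Sum>k<n. (cmod (x k))\<^sup>2 * L2norm2 S (u k))"
proof -
  have i: "integrable (lebesgue_on S) (\<lambda>t. (cmod (u k t))\<^sup>2)" if "k < n" for k
    using assms[OF that] by (simp add: L2on_def)
  have "L2norm2 S (\<lambda>t. \<Sum>k<n. x k * u k t) \<le> (\<integral>t. real n * (\<Sum>k<n. (cmod (x k))\<^sup>2 * (cmod (u k t))\<^sup>2) \<partial>lebesgue_on S)"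
    unfolding L2norm2_def
  proof (rule integral_mono)
    have "L2on S (\<lambda>t. \<Sum>k<n. x k * u k t)" using assms by (intro L2on_sum L2on_cmult) auto
    then show "integrable (lebesgue_on S) (\<lambda>t. (cmod (\<Sum>k<n. x k * u k t))\<^sup>2)" by (simp add: L2on_def)
    show "integrable (lebesgue_on S) (\<lambda>t. real n * (\<Sum>k<n. (cmod (x k))\<^sup>2 * (cmod (u k t))\<^sup>2))"
      using i by (intro Bochner_Integration.integrable_mult_right Bochner_Integration.integrable_sum) auto
    fix t
    have "(cmod (\<Sum>k<n. x k * u k t))\<^sup>2 \<le> (\<Sum>k<n. cmod (x k * u k t))\<^sup>2"
      by (intro power_mono norm_sum) auto
    also have "\<dots> \<le> (\<Sum>k<n. (cmod (x k * u k t))\<^sup>2) * real (card {..<n})"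
      by (rule sum_squared_le_sum_of_squares)
    finally show "(cmod (\<Sum>k<n. x k * u k t))\<^sup>2 \<le> real n * (\<Sum>k<n. (cmod (x k))\<^sup>2 * (cmod (u k t))\<^sup>2)"
      by (simp add: norm_mult power_mult_distrib mult.commute)
  qed
  also have "\<dots> = real n * (\<Sum>k<n. (cmod (x k))\<^sup>2 * L2norm2 S (u k))"
    using i by (simp add: L2norm2_def)
  finally show ?thesis .
qed

text \<open>The energy identity with zero displacement and with the mass equation tested by its own
  solution. It bounds the initial velocity error, which is given only through the mass
  matrix.\<close>

lemma static_mean_estimate:
  fixes v r :: "nat \<Rightarrow> real"
  assumes h: "h > 0" and bd: "v 0 = 0" "v (Suc N) = 0"
    and eq: "\<And>j. j < N \<Longrightarrow> h / 4 * (v j + 2 * v (Suc j) + v (Suc (Suc j))) = h / 2 * (r j + r (Suc j))"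
  shows "h * (\<Sum>j\<le>N. (mean v j)\<^sup>2) \<le> h * (\<Sum>j\<le>N. (r j)\<^sup>2)"
proof -
  have "scheme N h (\<lambda>_. 0) (\<lambda>_. 0) v r (\<lambda>_. 0)" unfolding scheme_def using eq by simp
  from energy_identity[OF this _ bd] have "h * (\<Sum>j\<le>N. mean v j * mean v j) = h * (\<Sum>j\<le>N. mean v j * r j)"
    using h by (simp add: dq_def)
  also have "\<dots> \<le> h * (\<Sum>j\<le>N. (mean v j)\<^sup>2 / 2 + (r j)\<^sup>2 / 2)"
    using h sum_squares_bound[of "mean v _" "r _"] by (intro mult_left_mono sum_mono) (auto simp: field_simps)
  also have "\<dots> = (h * (\<Sum>j\<le>N. (mean v j)\<^sup>2)) / 2 + (h * (\<Sum>j\<le>N. (r j)\<^sup>2)) / 2"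
    by (simp add: sum.distrib sum_divide_distrib[symmetric] algebra_simps)
  finally show ?thesis by (simp add: power2_eq_square)
qed

section \<open>The error equation\<close>

text \<open>On \<open>sn k\<close> the mass matrix acts as \<open>h csq\<close>, the stiffness matrix as \<open>4/h sin\<^sup>2\<close>, and integration over
  half cells as \<open>h sinc\<close>; \<open>b1\<close> and \<open>b2\<close> are the resulting consistency defects in front of \<open>f k\<close> and \<open>c k\<close>.\<close>
definition csq :: "nat \<Rightarrow> nat \<Rightarrow> real" where "csq k N = (cos (freq k * mesh N / 2))\<^sup>2"
definition sinc :: "nat \<Rightarrow> nat \<Rightarrow> real" where "sinc k N = sin (freq k * mesh N) / (freq k * mesh N)"
definition b1 :: "nat \<Rightarrow> nat \<Rightarrow> real" where "b1 k N = 1 - csq k N / sinc k N"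
definition b2 :: "nat \<Rightarrow> nat \<Rightarrow> real" where
  "b2 k N = ((freq k)\<^sup>2 * csq k N - 4 / (mesh N)\<^sup>2 * (sin (freq k * mesh N / 2))\<^sup>2) / sinc k N"

lemma b1_tendsto: "(\<lambda>N. b1 k N) \<longlonglongrightarrow> 0"
proof -
  have "(\<lambda>N. 1 - (cos (p * (1 / (real N + 1)) / 2))\<^sup>2 / (sin (p * (1 / (real N + 1))) / (p * (1 / (real N + 1))))) \<longlonglongrightarrow> 0"
    if "p > 0" for p :: real using that by real_asymp
  from this[OF freq_pos[of k]] show ?thesis by (simp only: b1_def csq_def sinc_def mesh_def)
qed

lemma b2_tendsto: "(\<lambda>N. b2 k N) \<longlonglongrightarrow> 0"
proof -
  have "(\<lambda>N. (p\<^sup>2 * (cos (p * (1 / (real N + 1)) / 2))\<^sup>2 - 4 / (1 / (real N + 1))\<^sup>2 * (sin (p * (1 / (real N + 1)) / 2))\<^sup>2)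
     / (sin (p * (1 / (real N + 1))) / (p * (1 / (real N + 1))))) \<longlonglongrightarrow> 0"
    if "p > 0" for p :: real using that by real_asymp (simp add: power2_eq_square)
  from this[OF freq_pos[of k]] show ?thesis by (simp only: b2_def csq_def sinc_def mesh_def)
qed

lemma sinc_eventually_nonzero: "\<forall>\<^sub>F N in sequentially. sinc k N \<noteq> 0"
proof -
  have "(\<lambda>N. sin (p * (1 / (real N + 1))) / (p * (1 / (real N + 1)))) \<longlonglongrightarrow> 1"
    if "p > 0" for p :: real using that by real_asymp
  from this[OF freq_pos[of k]] have "(\<lambda>N. sinc k N) \<longlonglongrightarrow> 1" by (simp only: sinc_def mesh_def)
  then have "\<forall>\<^sub>F N in sequentially. sinc k N > 0" by (rule order_tendstoD(1)) simp
  then show ?thesis by eventually_elim simp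
qed

lemma sn_node_sum: "sn k (node N j) + sn k (node N (Suc (Suc j))) = complex_of_real (2 * cos (freq k * mesh N)) * sn k (node N (Suc j))"
proof -
  define x where "x = freq k * node N (Suc j)"
  define y where "y = freq k * mesh N"
  have e: "freq k * node N j = x - y" "freq k * node N (Suc (Suc j)) = x + y"
    by (simp_all add: x_def y_def node_Suc algebra_simps)
  have "sqrt 2 * sin (x - y) + sqrt 2 * sin (x + y) = 2 * cos y * (sqrt 2 * sin x)"
    by (simp add: sin_add sin_diff algebra_simps)
  then show ?thesis
    unfolding sn_def e x_def[symmetric] y_def[symmetric] of_real_add[symmetric] of_real_mult[symmetric] by (simp only:)
qed

lemma mass_sn: "complex_of_real (mesh N / 4) * (sn k (node N j) + 2 * sn k (node N (Suc j)) + sn k (node N (Suc (Suc j))))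
    = complex_of_real (mesh N * csq k N) * sn k (node N (Suc j))"
proof -
  have c: "2 * cos (freq k * mesh N) = 4 * csq k N - 2"
    using cos_double_cos[of "freq k * mesh N / 2"] by (simp add: csq_def)
  have "sn k (node N j) + 2 * sn k (node N (Suc j)) + sn k (node N (Suc (Suc j)))
     = (sn k (node N j) + sn k (node N (Suc (Suc j)))) + 2 * sn k (node N (Suc j))" by simp
  also have "\<dots> = complex_of_real (4 * csq k N) * sn k (node N (Suc j))"
    unfolding sn_node_sum c by (simp add: algebra_simps)
  finally show ?thesis by simp
qed

lemma stiffness_sn: "(2 * sn k (node N (Suc j)) - sn k (node N j) - sn k (node N (Suc (Suc j)))) / complex_of_real (mesh N)
    = complex_of_real (4 / mesh N * (sin (freq k * mesh N / 2))\<^sup>2) * sn k (node N (Suc j))"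
proof -
  have c: "2 * cos (freq k * mesh N) = 2 - 4 * (sin (freq k * mesh N / 2))\<^sup>2"
    using cos_double_sin[of "freq k * mesh N / 2"] by simp
  have "2 * sn k (node N (Suc j)) - sn k (node N j) - sn k (node N (Suc (Suc j)))
     = 2 * sn k (node N (Suc j)) - (sn k (node N j) + sn k (node N (Suc (Suc j))))" by simp
  also have "\<dots> = complex_of_real (4 * (sin (freq k * mesh N / 2))\<^sup>2) * sn k (node N (Suc j))"
    unfolding sn_node_sum c by (simp add: algebra_simps)
  finally show ?thesis by simp
qed

lemma half_cell_sn:
  assumes "j < N"
  shows "half_cell_int N (sn k) (Suc j) = complex_of_real (mesh N * sinc k N) * sn k (node N (Suc j))"
proof -
  define p where "p = freq k"
  have p: "p > 0" by (simp add: p_def freq_pos)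
  define l where "l = node N j"
  define u where "u = node N (Suc (Suc j))"
  have lu: "l \<le> u" "u = node N (Suc j) + mesh N" "l = node N (Suc j) - mesh N"
    using mesh_pos[of N] by (simp_all add: l_def u_def node_Suc)
  have "((\<lambda>x. sqrt 2 * sin (p * x)) has_integral (- sqrt 2 * cos (p * u) / p - (- sqrt 2 * cos (p * l) / p))) {l..u}"
    using p lu(1)
    by (intro fundamental_theorem_of_calculus) (auto intro!: derivative_eq_intros simp: has_real_derivative_iff_has_vector_derivative[symmetric])
  moreover have "- sqrt 2 * cos (p * u) / p - (- sqrt 2 * cos (p * l) / p) = 2 * (mesh N * sinc k N * (sqrt 2 * sin (p * node N (Suc j))))"
    using p mesh_pos[of N] unfolding lu(2,3) sinc_def p_def[symmetric]
    by (simp add: distrib_left right_diff_distrib cos_add cos_diff field_simps)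
  ultimately have "integral {l..u} (\<lambda>x. sqrt 2 * sin (p * x)) = 2 * (mesh N * sinc k N * (sqrt 2 * sin (p * node N (Suc j))))"
    using integral_unique by metis
  moreover have "integral\<^sup>L (lebesgue_on {l..u}) (\<lambda>x. sqrt 2 * sin (p * x)) = integral {l..u} (\<lambda>x. sqrt 2 * sin (p * x))"
    by (intro lebesgue_integral_eq_integral continuous_on_integrable_Icc continuous_intros) auto
  ultimately have "integral\<^sup>L (lebesgue_on {l..u}) (sn k) = complex_of_real (2 * (mesh N * sinc k N * (sqrt 2 * sin (p * node N (Suc j)))))"
    unfolding sn_def[abs_def] p_def[symmetric] integral_complex_of_real by simp
  then show ?thesis
    by (simp add: half_cell_int_def l_def u_def sn_def p_def)
qed

context
  fixes N j :: nat
  assumes j: "j < N"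
begin

lemma half_cell_subset: "{node N j..node N (Suc (Suc j))} \<subseteq> {0..1}"
  using node_in_unit[of j N] node_in_unit[of "Suc (Suc j)" N] j by auto

lemma half_cell_integrable: "integrable (lebesgue_on {0..1}) u \<Longrightarrow> integrable (lebesgue_on {node N j..node N (Suc (Suc j))}) u"
  for u :: "real \<Rightarrow> complex"
  by (erule integrable_lebesgue_on_subset[OF _ half_cell_subset]) simp_all

lemma half_cell_add: "integrable (lebesgue_on {0..1}) u \<Longrightarrow> integrable (lebesgue_on {0..1}) v \<Longrightarrow>
    half_cell_int N (\<lambda>x. u x + v x) (Suc j) = half_cell_int N u (Suc j) + half_cell_int N v (Suc j)"
  and half_cell_diff: "integrable (lebesgue_on {0..1}) u \<Longrightarrow> integrable (lebesgue_on {0..1}) v \<Longrightarrow>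
    half_cell_int N (\<lambda>x. u x - v x) (Suc j) = half_cell_int N u (Suc j) - half_cell_int N v (Suc j)"
  by (simp_all add: half_cell_int_def half_cell_integrable add_divide_distrib diff_divide_distrib)

lemma half_cell_cmult: "half_cell_int N (\<lambda>x. r * u x) (Suc j) = r * half_cell_int N u (Suc j)"
  by (simp add: half_cell_int_def)

lemma half_cell_sum: "(\<And>i. i \<in> I \<Longrightarrow> integrable (lebesgue_on {0..1}) (u i)) \<Longrightarrow>
    half_cell_int N (\<lambda>x. \<Sum>i\<in>I. u i x) (Suc j) = (\<Sum>i\<in>I. half_cell_int N (u i) (Suc j))"
  by (simp add: half_cell_int_def half_cell_integrable sum_divide_distrib Bochner_Integration.integral_sum)

end

text \<open>Mesh \<open>N\<close> and truncation \<open>n\<close> are fixed here. A nonvanishing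
  \<open>sinc\<close> allows each eigenvalue defect to be rewritten as a multiple of the half-cell
  integral of \<open>sn k\<close>, that is, as a source on cells.\<close>

locale discrete_wave = wave_solution +
  fixes N n :: nat and W V :: "real \<Rightarrow> nat \<Rightarrow> complex" and A :: real
  assumes disc: "discrete_solution a T g w0 w1 N W V" and N: "N \<ge> 1"
    and a_bounds: "\<And>x. x \<in> {0..1} \<Longrightarrow> 0 \<le> a x \<and> a x \<le> A"
    and w1_L2: "L2on {0..1} w1" and sinc: "\<And>k. k < n \<Longrightarrow> sinc k N \<noteq> 0"
begin

abbreviation "h \<equiv> mesh N"

lemma h_pos: "h > 0" by (rule mesh_pos)

definition rhs :: "real \<Rightarrow> nat \<Rightarrow> complex" where
  "rhs t i = half_cell_int N (g t) i - Kh N (W t) i - Lh a N (W t) i"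

definition E :: "nat \<Rightarrow> real \<Rightarrow> complex" where
  "E j t = ext0 N (W t) j - (\<Sum>k<n. c k t * sn k (node N j))"
definition D :: "nat \<Rightarrow> real \<Rightarrow> complex" where
  "D j t = ext0 N (V t) j - (\<Sum>k<n. d k t * sn k (node N j))"
text \<open>Density of \<open>D\<close>: the acceleration of the discrete solution is not part of
  \<open>discrete_solution\<close> and is recovered by inverting the mass matrix on the right-hand
  side, and the modes contribute their equation from \<open>d_AC\<close>.\<close>

definition D' :: "nat \<Rightarrow> real \<Rightarrow> complex" where
  "D' j t = tri_inv N h (rhs t) j - (\<Sum>k<n. (f k t - complex_of_real ((freq k)\<^sup>2) * c k t) * sn k (node N j))"

lemma ext0_W_AC: "AC T (\<lambda>t. ext0 N (W t) j) (\<lambda>t. ext0 N (V t) j)"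
proof (cases "1 \<le> j \<and> j \<le> N")
  case True
  then have "j \<in> {1..N}" by simp
  then have "AC T (\<lambda>t. W t j) (\<lambda>t. V t j)"
    using disc unfolding discrete_solution_def by (intro AC_vector_derivative) blast+
  then show ?thesis using True by (simp add: ext0_def)
next
  case False
  then have "ext0 N v j = 0" for v by (auto simp: ext0_def)
  then show ?thesis by (simp add: AC_const)
qed

lemma mass_V_AC:
  assumes i: "i \<in> {1..N}" shows "AC T (\<lambda>t. Mh N (V t) i) (\<lambda>t. rhs t i)"
proof (rule ACI)
  have *: "integrable (lebesgue_on {0..t}) (\<lambda>s. rhs s i) \<and>
      Mh N (V t) i - Mh N (V 0) i = integral\<^sup>L (lebesgue_on {0..t}) (\<lambda>s. rhs s i)" if "t \<in> {0..T}" for t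
    using disc i that unfolding discrete_solution_def rhs_def by blast
  show "integrable (lebesgue_on {0..T}) (\<lambda>t. rhs t i)" using *[of T] T_pos by simp
  fix t assume "t \<in> {0..T}"
  then show "integral\<^sup>L (lebesgue_on {0..t}) (\<lambda>t. rhs t i) = Mh N (V t) i - Mh N (V 0) i" using * by simp
qed

lemma ext0_V_eq: "j \<le> Suc N \<Longrightarrow> ext0 N (V t) j = tri_inv N h (Mh N (V t)) j"
  using h_pos by (intro tri_inv_unique) (auto simp: ext0_def[of N _ 0] ext0_def[of N _ "Suc N"] Mh_def)

lemma ext0_V_AC: 
  assumes "j \<le> Suc N" shows "AC T (\<lambda>t. ext0 N (V t) j) (\<lambda>t. tri_inv N h (rhs t) j)"
  using tri_inv_AC[OF mass_V_AC assms] unfolding ext0_V_eq[OF assms] .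

lemma E_AC: "AC T (E j) (D j)"
  unfolding E_def[abs_def] D_def[abs_def]
  by (intro AC_diff ext0_W_AC AC_sum AC_cmult_right c_AC)

lemma D_AC: "j \<le> Suc N \<Longrightarrow> AC T (D j) (D' j)"
  unfolding D'_def[abs_def] D_def[abs_def]
  by (rule AC_diff[OF ext0_V_AC]) (assumption, intro AC_sum AC_cmult_right d_AC)

lemma boundary_values: "E 0 t = 0" "E (Suc N) t = 0" "D 0 t = 0" "D (Suc N) t = 0"
  by (simp_all add: E_def D_def ext0_def)

text \<open>Everything in the error equation that is seen through half-cell integrals: the tail of
  the forcing, the potential acting on the tail of \<open>w\<close> (what is left of
  \<open>a w\<close> after the truncated part is compared with the discrete potential), and the
  eigenvalue defects.\<close>

definition residual :: "real \<Rightarrow> real \<Rightarrow> complex" where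
  "residual t x = (F t x - SN.proj n (F t) x) + complex_of_real (a x) * (w t x - SN.proj n (w t) x)
     + (\<Sum>k<n. (complex_of_real (b1 k N) * f k t + complex_of_real (b2 k N) * c k t) * sn k x)"

text \<open>Half-cell mean minus nodal value of a sn_k: the scheme lumps the potential at the nodes
  but averages the data. This defect stays nodal and is independent of time, so \<open>rho\<close>
  inherits its time derivative from \<open>c k\<close>.\<close>

definition gam :: "nat \<Rightarrow> nat \<Rightarrow> complex" where
  "gam k j = half_cell_int N (\<lambda>x. complex_of_real (a x) * sn k x) j / complex_of_real h
     - complex_of_real (a (node N j)) * sn k (node N j)"

definition rho :: "nat \<Rightarrow> real \<Rightarrow> complex" where "rho j t = (\<Sum>k<n. c k t * gam k j)"
definition rho' :: "nat \<Rightarrow> real \<Rightarrow> complex" where "rho' j t = (\<Sum>k<n. d k t * gam k j)"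

lemma rho_AC: "AC T (rho j) (rho' j)"
  unfolding rho_def[abs_def] rho'_def[abs_def]
  by (intro AC_sum AC_cmult_right c_AC)

lemma a_sn_L2: "L2on {0..1} (\<lambda>x. complex_of_real (a x) * sn k x)"
  by (intro L2on_continuous continuous_intros a_cont continuous_on_sn)

lemma half_cell_residual:
  assumes t: "t \<in> {0..T}" and F: "L2on {0..1} (F t)" and j: "j < N"
  shows "half_cell_int N (residual t) (Suc j) = half_cell_int N (F t) (Suc j) + half_cell_int N (aw t) (Suc j)
     - (\<Sum>k<n. f k t * half_cell_int N (sn k) (Suc j)) - (\<Sum>k<n. c k t * half_cell_int N (\<lambda>x. complex_of_real (a x) * sn k x) (Suc j))
     + (\<Sum>k<n. (complex_of_real (b1 k N) * f k t + complex_of_real (b2 k N) * c k t) * half_cell_int N (sn k) (Suc j))"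
proof -
  have sum_i: "integrable (lebesgue_on {0..1}) (\<lambda>x. \<Sum>k<n. x' k * u k x)" if "\<And>k. L2on {0..1} (u k)" for x' u
    using that by (intro L2on_integrable L2on_sum L2on_cmult)
  have hsum: "half_cell_int N (\<lambda>x. \<Sum>k<n. x' k * u k x) (Suc j) = (\<Sum>k<n. x' k * half_cell_int N (u k) (Suc j))"
    if "\<And>k. L2on {0..1} (u k)" for x' u
    using that by (subst half_cell_sum[OF j]) (auto intro!: L2on_integrable simp: half_cell_cmult[OF j])
  have awL: "L2on {0..1} (aw t)"
    unfolding aw_def[abs_def] using H1_continuous w_H10[OF t]
    by (intro L2on_continuous continuous_intros a_cont) (auto simp: H10_def)
  have "residual t = (\<lambda>x. ((F t x - (\<Sum>k<n. f k t * sn k x)) + (aw t x - (\<Sum>k<n. c k t * (complex_of_real (a x) * sn k x))))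
     + (\<Sum>k<n. (complex_of_real (b1 k N) * f k t + complex_of_real (b2 k N) * c k t) * sn k x))"
    by (simp add: fun_eq_iff residual_def SN.proj_def f_def c_def aw_def right_diff_distrib sum_distrib_left mult.left_commute)
  then show ?thesis
    using L2on_integrable[OF F] L2on_integrable[OF awL] sum_i[OF SN.L2] sum_i[OF a_sn_L2]
    by (simp add: half_cell_add[OF j] half_cell_diff[OF j] hsum[OF SN.L2] hsum[OF a_sn_L2])
qed

text \<open>The sine vectors being eigenvectors, the truncated series passes through the scheme as
  scalar factors. What is not a half-cell integral of \<open>residual\<close> is then precisely the
  lumping defect of the potential.\<close>

lemma scheme_error:
  assumes t: "t \<in> {0..T}" and F: "L2on {0..1} (F t)" and G: "L2on {0..1} (G t)"
    and eq: "AE x in lebesgue_on {0..1}. g t x = G t x" and R: "L2on {0..1} (residual t)" and j: "j < N"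
  shows "complex_of_real (h / 4) * (D' j t + 2 * D' (Suc j) t + D' (Suc (Suc j)) t)
      + (2 * E (Suc j) t - E j t - E (Suc (Suc j)) t) / complex_of_real h
      + complex_of_real (h * a (node N (Suc j))) * E (Suc j) t
    = complex_of_real (h / 2) * (cell_mean N (residual t) j + cell_mean N (residual t) (Suc j)) + complex_of_real h * rho (Suc j) t"
proof -
  let ?s = "\<lambda>k. sn k (node N (Suc j))"
  have awL: "L2on {0..1} (aw t)"
    unfolding aw_def[abs_def] using H1_continuous w_H10[OF t]
    by (intro L2on_continuous continuous_intros a_cont) (auto simp: H10_def)
  have hg: "half_cell_int N (g t) (Suc j) = half_cell_int N (F t) (Suc j) + half_cell_int N (aw t) (Suc j)"
  proof -
    have Gi: "integrable (lebesgue_on {node N j..node N (Suc (Suc j))}) (G t)"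
      by (rule half_cell_integrable[OF j L2on_integrable[OF G]])
    have "integral\<^sup>L (lebesgue_on {node N j..node N (Suc (Suc j))}) (G t) = integral\<^sup>L (lebesgue_on {node N j..node N (Suc (Suc j))}) (g t)"
    proof (rule integral_lebesgue_on_cong_AE)
      show "AE x in lebesgue_on {node N j..node N (Suc (Suc j))}. G t x = g t x"
        using AE_lebesgue_on_subset[OF eq half_cell_subset[OF j]] by (simp add: eq_commute)
    qed (use Gi in auto)
    then have "half_cell_int N (g t) (Suc j) = half_cell_int N (G t) (Suc j)" by (simp add: half_cell_int_def)
    also have "G t = (\<lambda>x. F t x + aw t x)" by (simp add: F_def[abs_def])
    finally show ?thesis by (simp add: half_cell_add[OF j L2on_integrable[OF F] L2on_integrable[OF awL]])
  qed
  have M: "complex_of_real (h / 4) * (tri_inv N h (rhs t) j + 2 * tri_inv N h (rhs t) (Suc j) + tri_inv N h (rhs t) (Suc (Suc j)))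
      = half_cell_int N (g t) (Suc j) - (2 * ext0 N (W t) (Suc j) - ext0 N (W t) j - ext0 N (W t) (Suc (Suc j))) / complex_of_real h
        - complex_of_real (h * a (node N (Suc j))) * ext0 N (W t) (Suc j)"
    using h_pos by (subst tri_inv_solves) (simp_all add: rhs_def Kh_def Lh_def)
  define p where "p k = f k t - complex_of_real ((freq k)\<^sup>2) * c k t" for k
  have "complex_of_real (h / 4) * (D' j t + 2 * D' (Suc j) t + D' (Suc (Suc j)) t)
      + (2 * E (Suc j) t - E j t - E (Suc (Suc j)) t) / complex_of_real h
      + complex_of_real (h * a (node N (Suc j))) * E (Suc j) t
    = half_cell_int N (g t) (Suc j)
      - (\<Sum>k<n. p k * (complex_of_real (h / 4) * (sn k (node N j) + 2 * sn k (node N (Suc j)) + sn k (node N (Suc (Suc j))))))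
      - (\<Sum>k<n. c k t * ((2 * sn k (node N (Suc j)) - sn k (node N j) - sn k (node N (Suc (Suc j)))) / complex_of_real h))
      - (\<Sum>k<n. c k t * (complex_of_real (h * a (node N (Suc j))) * ?s k))"
  proof -
    have 1: "complex_of_real (h / 4) * (D' j t + 2 * D' (Suc j) t + D' (Suc (Suc j)) t)
      = complex_of_real (h / 4) * (tri_inv N h (rhs t) j + 2 * tri_inv N h (rhs t) (Suc j) + tri_inv N h (rhs t) (Suc (Suc j)))
       - (\<Sum>k<n. p k * (complex_of_real (h / 4) * (sn k (node N j) + 2 * sn k (node N (Suc j)) + sn k (node N (Suc (Suc j))))))"
      unfolding D'_def p_def[symmetric] by (simp add: algebra_simps sum.distrib sum_distrib_left sum_divide_distrib add_divide_distrib diff_divide_distrib)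
    have 2: "(2 * E (Suc j) t - E j t - E (Suc (Suc j)) t) / complex_of_real h
      = (2 * ext0 N (W t) (Suc j) - ext0 N (W t) j - ext0 N (W t) (Suc (Suc j))) / complex_of_real h
       - (\<Sum>k<n. c k t * ((2 * sn k (node N (Suc j)) - sn k (node N j) - sn k (node N (Suc (Suc j)))) / complex_of_real h))"
      unfolding E_def by (simp add: algebra_simps sum.distrib sum_subtractf sum_distrib_left sum_divide_distrib add_divide_distrib diff_divide_distrib)
    have 3: "complex_of_real (h * a (node N (Suc j))) * E (Suc j) t = complex_of_real (h * a (node N (Suc j))) * ext0 N (W t) (Suc j)
      - (\<Sum>k<n. c k t * (complex_of_real (h * a (node N (Suc j))) * ?s k))"
      unfolding E_def by (simp add: right_diff_distrib sum_distrib_left mult_ac)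
    show ?thesis unfolding 1 2 3 M by simp
  qed
  also have "\<dots> = half_cell_int N (g t) (Suc j)
      - (\<Sum>k<n. p k * (complex_of_real (h * csq k N) * ?s k))
      - (\<Sum>k<n. c k t * (complex_of_real (4 / h * (sin (freq k * h / 2))\<^sup>2) * ?s k))
      - (\<Sum>k<n. c k t * (complex_of_real (h * a (node N (Suc j))) * ?s k))"
    unfolding mass_sn stiffness_sn ..
  also have "\<dots> = half_cell_int N (residual t) (Suc j) + complex_of_real h * rho (Suc j) t"
  proof -
    \<comment> \<open>Multiplying by the factor h sinc of the half-cell integral clears the
      denominators in \<open>b1\<close> and \<open>b2\<close>; the equation of the mode replaces the
      acceleration coefficient by \<open>p k\<close>.\<close>
    have k: "(complex_of_real (b1 k N) * f k t + complex_of_real (b2 k N) * c k t) * (complex_of_real (h * sinc k N) * ?s k)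
       = f k t * (complex_of_real (h * sinc k N) * ?s k) - p k * (complex_of_real (h * csq k N) * ?s k)
         - c k t * (complex_of_real (4 / h * (sin (freq k * h / 2))\<^sup>2) * ?s k)" if "k < n" for k
    proof -
      have r1: "b1 k N * (h * sinc k N) = h * sinc k N - h * csq k N"
        using sinc[OF that] by (simp add: b1_def algebra_simps)
      have r2: "b2 k N * (h * sinc k N) = (freq k)\<^sup>2 * (h * csq k N) - 4 / h * (sin (freq k * h / 2))\<^sup>2"
        using sinc[OF that] h_pos by (simp add: b2_def field_simps power2_eq_square)
      have "(complex_of_real (b1 k N) * f k t + complex_of_real (b2 k N) * c k t) * (complex_of_real (h * sinc k N) * ?s k)
        = f k t * complex_of_real (b1 k N * (h * sinc k N)) * ?s k + c k t * complex_of_real (b2 k N * (h * sinc k N)) * ?s k"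
        by (simp add: algebra_simps)
      then show ?thesis unfolding r1 r2 p_def by (simp add: algebra_simps)
    qed
    have rh: "complex_of_real h * rho (Suc j) t = (\<Sum>k<n. c k t * half_cell_int N (\<lambda>x. complex_of_real (a x) * sn k x) (Suc j))
        - (\<Sum>k<n. c k t * (complex_of_real (h * a (node N (Suc j))) * ?s k))"
      using h_pos unfolding rho_def gam_def by (simp add: sum_distrib_left sum_subtractf[symmetric] algebra_simps)
    have "(\<Sum>k<n. (complex_of_real (b1 k N) * f k t + complex_of_real (b2 k N) * c k t) * (complex_of_real (h * sinc k N) * ?s k))
      = (\<Sum>k<n. f k t * (complex_of_real (h * sinc k N) * ?s k)) - (\<Sum>k<n. p k * (complex_of_real (h * csq k N) * ?s k))
         - (\<Sum>k<n. c k t * (complex_of_real (4 / h * (sin (freq k * h / 2))\<^sup>2) * ?s k))"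
      unfolding sum_subtractf[symmetric] by (rule sum.cong[OF refl], rule k) simp
    then show ?thesis unfolding half_cell_residual[OF t F j] half_cell_sn[OF j] rh hg by simp
  qed
  also have "half_cell_int N (residual t) (Suc j) = complex_of_real (h / 2) * (cell_mean N (residual t) j + cell_mean N (residual t) (Suc j))"
    by (rule half_cell_int_eq[OF L2on_integrable[OF R] j])
  finally show ?thesis .
qed

end

lemma L2prod_sum: "(\<And>k. k < (n::nat) \<Longrightarrow> L2prod T (u k)) \<Longrightarrow> L2prod T (\<lambda>t x. \<Sum>k<n. u k t x)"
  unfolding L2prod_def by (intro sqint_sum) simp

lemma L2norm2_real_mult_le:
  assumes u: "L2on {0..1} u" and m: "\<alpha> \<in> borel_measurable (lebesgue_on {0..1})"
    and \<alpha>: "\<And>x. x \<in> {0..1} \<Longrightarrow> \<bar>\<alpha> x\<bar> \<le> A"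
  shows "L2norm2 {0..1} (\<lambda>x. complex_of_real (\<alpha> x) * u x) \<le> A\<^sup>2 * L2norm2 {0..1} u"
    and "L2on {0..1} (\<lambda>x. complex_of_real (\<alpha> x) * u x)"
proof -
  have le: "(cmod (complex_of_real (\<alpha> x) * u x))\<^sup>2 \<le> A\<^sup>2 * (cmod (u x))\<^sup>2" if "x \<in> {0..1}" for x
    using power_mono[OF \<alpha>[OF that] abs_ge_zero, of 2]
    by (simp add: norm_mult power_mult_distrib mult_right_mono)
  have ui: "integrable (lebesgue_on {0..1}) (\<lambda>x. A\<^sup>2 * (cmod (u x))\<^sup>2)" using u by (simp add: L2on_def)
  have um: "u \<in> borel_measurable (lebesgue_on {0..1})" using u by (simp add: L2on_def)
  show L: "L2on {0..1} (\<lambda>x. complex_of_real (\<alpha> x) * u x)"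
    unfolding L2on_iff_sqint
    by (rule sqint_dominated[OF _ ui]) (use le um m in \<open>auto intro!: AE_I2\<close>)
  have "L2norm2 {0..1} (\<lambda>x. complex_of_real (\<alpha> x) * u x) \<le> (\<integral>x. A\<^sup>2 * (cmod (u x))\<^sup>2 \<partial>lebesgue_on {0..1})"
    unfolding L2norm2_def by (rule integral_mono[OF _ ui]) (use L le in \<open>auto simp: L2on_def\<close>)
  then show "L2norm2 {0..1} (\<lambda>x. complex_of_real (\<alpha> x) * u x) \<le> A\<^sup>2 * L2norm2 {0..1} u"
    by (simp add: L2norm2_def)
qed

text \<open>Uniform continuity makes the bound simultaneous for all nodes. For a merely continuous
  function no rate is available, hence the formulation with an arbitrary tolerance.\<close>

lemma half_cell_mean_tendsto:
  assumes u: "continuous_on {0..1} u" and e: "e > 0"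
  shows "\<forall>\<^sub>F N in sequentially. \<forall>j<N. cmod (half_cell_int N u (Suc j) / complex_of_real (mesh N) - u (node N (Suc j))) \<le> e"
proof -
  have "uniformly_continuous_on {0..1} u" by (intro compact_uniformly_continuous u compact_Icc)
  then obtain \<delta> where \<delta>: "\<delta> > 0" "\<And>x y. x \<in> {0..1} \<Longrightarrow> y \<in> {0..1} \<Longrightarrow> dist x y < \<delta> \<Longrightarrow> dist (u x) (u y) < e"
    using e unfolding uniformly_continuous_on_def by metis
  have "(\<lambda>N. 1 / (real N + 1)) \<longlonglongrightarrow> 0" by real_asymp
  then have "\<forall>\<^sub>F N in sequentially. mesh N < \<delta>"
    unfolding mesh_def using \<delta>(1) by (rule order_tendstoD(2))
  then show ?thesis
  proof eventually_elim
    case (elim N)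
    show ?case
    proof (intro allI impI)
      fix j assume j: "j < N"
      let ?l = "node N j" and ?r = "node N (Suc (Suc j))" and ?m = "node N (Suc j)"
      have h: "mesh N > 0" by (rule mesh_pos)
      have lr: "?l = ?m - mesh N" "?r = ?m + mesh N" by (simp_all add: node_Suc)
      have i: "integrable (lebesgue_on {?l..?r}) u"
        by (rule half_cell_integrable[OF j continuous_on_integrable_Icc[OF u]])
      interpret F: finite_measure "lebesgue_on {?l..?r}" by (rule finite_measure_lebesgue_on_Icc)
      have meas: "measure lebesgue {?l..?r} = 2 * mesh N" using h by (simp add: lr)
      have "(\<integral>x. u x - u ?m \<partial>lebesgue_on {?l..?r}) = integral\<^sup>L (lebesgue_on {?l..?r}) u - complex_of_real (2 * mesh N) * u ?m"
        using i h by (simp add: measure_restrict_space lr scaleR_conv_of_real)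
      then have eq: "half_cell_int N u (Suc j) / complex_of_real (mesh N) - u ?m = (\<integral>x. u x - u ?m \<partial>lebesgue_on {?l..?r}) / complex_of_real (2 * mesh N)"
        using h by (simp add: half_cell_int_def field_simps)
      have "cmod (\<integral>x. u x - u ?m \<partial>lebesgue_on {?l..?r}) \<le> (\<integral>x. e \<partial>lebesgue_on {?l..?r})"
      proof (rule order_trans[OF integral_norm_bound integral_mono])
        fix x assume "x \<in> space (lebesgue_on {?l..?r})"
        then have x: "x \<in> {?l..?r}" by simp
        have "dist (u x) (u ?m) < e"
          using x half_cell_subset[OF j] node_in_unit[of "Suc j" N] j elim
          by (intro \<delta>(2)) (auto simp: lr dist_real_def abs_if)
        then show "cmod (u x - u ?m) \<le> e" by (simp add: dist_norm)
      qed (use i in auto)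
      also have "\<dots> = e * (2 * mesh N)" using h by (simp add: measure_restrict_space lr)
      finally show "cmod (half_cell_int N u (Suc j) / complex_of_real (mesh N) - u ?m) \<le> e"
        unfolding eq using h by (simp add: norm_divide divide_le_eq)
    qed
  qed
qed

text \<open>The constant of \<open>direct_inequality\<close>; it involves neither the mesh nor the
  truncation.\<close>

definition direct_const :: "real \<Rightarrow> real \<Rightarrow> real" where
  "direct_const T A = (2 * (4 + A\<^sup>2) * T + 4) * (18 + 8 * T\<^sup>2 + 8 * T) + 1 + T"

section \<open>Residual and initial error\<close>

context discrete_wave
begin

lemma A_nonneg: "A \<ge> 0"
  using a_bounds[of 0] by simp

lemma proj_F: "SN.proj n (F t) x = (\<Sum>k<n. f k t * sn k x)" and proj_w: "SN.proj n (w t) x = (\<Sum>k<n. c k t * sn k x)"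
  by (simp_all add: SN.proj_def f_def c_def)

lemma residual_L2prod: "L2prod T residual"
proof -
  have 1: "L2prod T (\<lambda>t x. \<Sum>k<n. f k t * sn k x)"
    by (intro L2prod_sum L2prod_tensor f_L2 SN.L2)
  have 2: "L2prod T (\<lambda>t x. complex_of_real (a x) * (w t x - (\<Sum>k<n. c k t * sn k x)))"
    by (intro L2prod_continuous continuous_intros w_jointly_continuous
        continuous_on_compose2[OF a_cont] continuous_on_compose2[OF c_continuous] continuous_on_compose2[OF continuous_on_sn[of UNIV]]) auto
  have 3: "L2prod T (\<lambda>t x. \<Sum>k<n. (complex_of_real (b1 k N) * f k t + complex_of_real (b2 k N) * c k t) * sn k x)"
    by (intro L2prod_sum L2prod_tensor SN.L2 L2on_add L2on_cmult f_L2 L2on_continuous c_continuous)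
  show ?thesis
    unfolding residual_def[abs_def] proj_F proj_w
    by (intro L2prod_add L2prod_diff F_L2prod 1 2 3)
qed

text \<open>The factors 4 come from splitting the three-term \<open>residual\<close> by two
  successive applications of the doubling inequality for squared norms; in the last term the second
  doubling separates \<open>f k\<close> from \<open>c k\<close>.\<close>

definition Qb :: real where
  "Qb = 4 * (\<integral>t. L2norm2 {0..1} (\<lambda>x. F t x - SN.proj n (F t) x) \<partial>lebesgue_on {0..T})
    + 4 * A\<^sup>2 * (\<integral>t. L2norm2 {0..1} (\<lambda>x. w t x - SN.proj n (w t) x) \<partial>lebesgue_on {0..T})
    + 4 * (\<Sum>k<n. (b1 k N)\<^sup>2 * L2norm2 {0..T} (f k) + (b2 k N)\<^sup>2 * L2norm2 {0..T} (c k))"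

lemma residual_norm_le: "(\<integral>t. L2norm2 {0..1} (residual t) \<partial>lebesgue_on {0..T}) \<le> Qb"
proof -
  let ?eF = "\<lambda>t. L2norm2 {0..1} (\<lambda>x. F t x - SN.proj n (F t) x)"
  let ?ew = "\<lambda>t. L2norm2 {0..1} (\<lambda>x. w t x - SN.proj n (w t) x)"
  let ?b = "\<lambda>t. 4 * ?eF t + 4 * A\<^sup>2 * ?ew t + 4 * (\<Sum>k<n. (b1 k N)\<^sup>2 * (cmod (f k t))\<^sup>2 + (b2 k N)\<^sup>2 * (cmod (c k t))\<^sup>2)"
  have fi: "integrable (lebesgue_on {0..T}) (\<lambda>t. (cmod (f k t))\<^sup>2)" "integrable (lebesgue_on {0..T}) (\<lambda>t. (cmod (c k t))\<^sup>2)" for k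
    using f_L2[of k] L2on_continuous[OF c_continuous[of k]] by (simp_all add: L2on_def)
  note ei = SN.L2prod_minus_proj_tendsto(2)[OF F_L2prod] SN.L2prod_minus_proj_tendsto(2)[OF w_L2prod]
  have "(\<integral>t. L2norm2 {0..1} (residual t) \<partial>lebesgue_on {0..T}) \<le> (\<integral>t. ?b t \<partial>lebesgue_on {0..T})"
  proof (rule integral_mono_AE)
    show "integrable (lebesgue_on {0..T}) (\<lambda>t. L2norm2 {0..1} (residual t))" by (rule L2prod_section(2)[OF residual_L2prod])
    show "integrable (lebesgue_on {0..T}) ?b" using ei fi by simp
    show "AE t in lebesgue_on {0..T}. L2norm2 {0..1} (residual t) \<le> ?b t"
      using L2prod_section(1)[OF F_L2prod] AE_space
    proof eventually_elim
      case (elim t)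
      then have t: "t \<in> {0..T}" by simp
      let ?u1 = "\<lambda>x. F t x - SN.proj n (F t) x"
      let ?u2 = "\<lambda>x. complex_of_real (a x) * (w t x - SN.proj n (w t) x)"
      let ?u3 = "\<lambda>x. \<Sum>k<n. (complex_of_real (b1 k N) * f k t + complex_of_real (b2 k N) * c k t) * sn k x"
      have am: "a \<in> borel_measurable (lebesgue_on {0..1})" by (intro continuous_imp_measurable_on_sets_lebesgue a_cont) auto
      have ab: "\<And>x. x \<in> {0..1} \<Longrightarrow> \<bar>a x\<bar> \<le> A" using a_bounds by auto
      have L1: "L2on {0..1} ?u1" by (rule L2on_diff[OF elim(1) SN.L2_proj])
      note m = L2norm2_real_mult_le[OF L2on_diff[OF w_L2[OF t] SN.L2_proj[of n "w t"]] am ab]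
      have L3: "L2on {0..1} ?u3" by (rule SN.L2_lincomb)
      have n3: "L2norm2 {0..1} ?u3 \<le> 2 * (\<Sum>k<n. (b1 k N)\<^sup>2 * (cmod (f k t))\<^sup>2 + (b2 k N)\<^sup>2 * (cmod (c k t))\<^sup>2)"
        unfolding SN.norm2_lincomb sum_distrib_left
      proof (rule sum_mono)
        fix k
        show "(cmod (complex_of_real (b1 k N) * f k t + complex_of_real (b2 k N) * c k t))\<^sup>2
          \<le> 2 * ((b1 k N)\<^sup>2 * (cmod (f k t))\<^sup>2 + (b2 k N)\<^sup>2 * (cmod (c k t))\<^sup>2)"
          using cmod_add_sq_le[of "complex_of_real (b1 k N) * f k t" "complex_of_real (b2 k N) * c k t"]
          by (simp add: norm_mult power_mult_distrib)
      qed
      have "L2norm2 {0..1} (residual t) \<le> 2 * (2 * L2norm2 {0..1} ?u1 + 2 * L2norm2 {0..1} ?u2) + 2 * L2norm2 {0..1} ?u3"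
        unfolding residual_def[abs_def]
        using L2norm2_add_le[OF L2on_add[OF L1 m(2)] L3] L2norm2_add_le[OF L1 m(2)] by simp
      then show ?case using m(1) n3 by simp
    qed
  qed
  also have "\<dots> = Qb"
    using ei fi by (simp add: Qb_def L2norm2_def[of "{0..T}"])
  finally show ?thesis .
qed

lemma w_init: "x \<in> {0..1} \<Longrightarrow> w 0 x = w0 x" and wt_init: "L2norm2 {0..1} (\<lambda>x. wt 0 x - w1 x) = 0"
  using weak unfolding weak_solution_def by blast+

lemma zero_in: "0 \<in> {0..T}" using T_pos by simp

text \<open>The initial velocity is attained only up to zero L2 distance, which Cauchy-Schwarz makes
  sufficient for the coefficients.\<close>

lemma d_init: "d k 0 = L2ip w1 (sn k)"
proof -
  have "(cmod (L2ip (\<lambda>x. wt 0 x - w1 x) (sn k)))\<^sup>2 \<le> 0"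
    using L2ip_Cauchy_Schwarz[OF L2on_diff[OF wt_L2[OF zero_in] w1_L2] SN.L2, of k] wt_init by simp
  then have "L2ip (\<lambda>x. wt 0 x - w1 x) (sn k) = 0" by simp
  then show ?thesis by (simp add: L2ip_diff_left[OF wt_L2[OF zero_in] w1_L2 SN.L2] d_def)
qed

text \<open>The initial displacement is interpolated at the nodes, so the difference quotients of
  the error are exactly the cell means of the derivative of the series tail; there is no
  interpolation error.\<close>

lemma init_dq:
  "h * (\<Sum>j\<le>N. (cmod ((E (Suc j) 0 - E j 0) / complex_of_real h))\<^sup>2) \<le> L2norm2 {0..1} (\<lambda>x. wx 0 x - CS.proj (Suc n) (wx 0) x)"
proof -
  define u where "u x = w 0 x - (\<Sum>k<n. c k 0 * sn k x)" for x
  define ux where "ux x = wx 0 x - (\<Sum>k<n. c k 0 * (complex_of_real (freq k) * cs (Suc k) x))" for x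
  have H: "H10 (w 0) (wx 0)" by (rule w_H10[OF zero_in])
  have AC: "AC 1 u ux"
    unfolding u_def[abs_def] ux_def[abs_def]
    by (intro AC_diff H1_AC AC_sum AC_cmult sn_AC) (use H in \<open>simp add: H10_def\<close>)
  \<comment> \<open>Differentiating n sines gives the cosines of index 1 to n; the constant cosine
    has coefficient zero, hence the projection of rank \<open>Suc n\<close>.\<close>
  have ux_eq: "ux = (\<lambda>x. wx 0 x - CS.proj (Suc n) (wx 0) x)"
    unfolding ux_def CS.proj_def
    by (rule ext, subst sum.lessThan_Suc_shift) (simp add: ip_wx[OF zero_in] ip_wx0[OF zero_in] mult_ac)
  have L: "L2on {0..1} ux" unfolding ux_eq by (rule L2on_diff[OF wx_L2[OF zero_in] CS.L2_proj])
  have E: "E j 0 = u (node N j)" if "j \<le> Suc N" for j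
  proof -
    have "j = 0 \<or> j = Suc N \<or> j \<in> {1..N}" using that by auto
    then consider "j = 0" | "j = Suc N" | "j \<in> {1..N}" by blast
    then have "ext0 N (W 0) j = w 0 (node N j)"
    proof cases
      case 3
      then have "W 0 j = w0 (node N j)" using disc unfolding discrete_solution_def by blast
      then show ?thesis using 3 w_init[OF node_in_unit[OF that]] by (simp add: ext0_def)
    qed (use H in \<open>simp_all add: ext0_def H10_def\<close>)
    then show ?thesis by (simp add: E_def u_def)
  qed
  have "(E (Suc j) 0 - E j 0) / complex_of_real h = cell_mean N ux j" if j: "j \<le> N" for j
  proof -
    have n: "node N j \<in> {0..1}" "node N (Suc j) \<in> {0..1}" using node_in_unit j by auto
    have "integral\<^sup>L (lebesgue_on {0..node N (Suc j)}) ux = integral\<^sup>L (lebesgue_on {0..node N j}) ux + integral\<^sup>L (lebesgue_on {node N j..node N (Suc j)}) ux"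
      by (rule integral_lebesgue_on_combine[OF AC_integrable_subset[OF AC n(2)] _ node_mono]) (use n in simp)
    then have "integral\<^sup>L (lebesgue_on {node N j..node N (Suc j)}) ux = u (node N (Suc j)) - u (node N j)"
      unfolding AC_integral[OF AC n(1)] AC_integral[OF AC n(2)] by simp
    then show ?thesis using j by (simp add: E cell_mean_def)
  qed
  then have "h * (\<Sum>j\<le>N. (cmod ((E (Suc j) 0 - E j 0) / complex_of_real h))\<^sup>2) = h * (\<Sum>j\<le>N. (cmod (cell_mean N ux j))\<^sup>2)"
    by (intro arg_cong[where f = "\<lambda>x. h * x"] sum.cong) auto
  also have "\<dots> \<le> L2norm2 {0..1} ux" by (rule sum_cell_mean_sq_le[OF L])
  finally show ?thesis unfolding ux_eq .
qed

text \<open>A function whose half-cell integrals equal the mass matrix applied to the initial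
  velocity error. The factor 1 - b1 is csq/sinc, the quotient of the two symbols on mode k.\<close>

definition q0 :: "real \<Rightarrow> complex" where
  "q0 x = w1 x - (\<Sum>k<n. complex_of_real (1 - b1 k N) * d k 0 * sn k x)"

lemma q0_L2: "L2on {0..1} q0"
  unfolding q0_def[abs_def] by (intro L2on_diff w1_L2 SN.L2_lincomb)

lemma q0_norm_le: "L2norm2 {0..1} q0 \<le> 2 * L2norm2 {0..1} (\<lambda>x. w1 x - SN.proj n w1 x) + 2 * (\<Sum>k<n. (b1 k N)\<^sup>2 * (cmod (d k 0))\<^sup>2)"
proof -
  have "q0 = (\<lambda>x. (w1 x - SN.proj n w1 x) + (\<Sum>k<n. (complex_of_real (b1 k N) * d k 0) * sn k x))"
    by (simp add: fun_eq_iff q0_def SN.proj_def d_init left_diff_distrib sum_subtractf)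
  then show ?thesis
    using L2norm2_add_le[OF L2on_diff[OF w1_L2 SN.L2_proj] SN.L2_lincomb, of n w1 "\<lambda>k. complex_of_real (b1 k N) * d k 0" n]
    by (simp add: SN.norm2_lincomb norm_mult power_mult_distrib)
qed

lemma init_mass:
  assumes j: "j < N"
  shows "complex_of_real (h / 4) * (D j 0 + 2 * D (Suc j) 0 + D (Suc (Suc j)) 0) = complex_of_real (h / 2) * (cell_mean N q0 j + cell_mean N q0 (Suc j))"
proof -
  have M: "complex_of_real (h / 4) * (ext0 N (V 0) j + 2 * ext0 N (V 0) (Suc j) + ext0 N (V 0) (Suc (Suc j))) = half_cell_int N w1 (Suc j)"
  proof -
    have "Suc j \<in> {1..N}" using j by simp
    then have "Mh N (V 0) (Suc j) = half_cell_int N w1 (Suc j)" using disc unfolding discrete_solution_def by blast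
    then show ?thesis by (simp add: Mh_def)
  qed
  have "complex_of_real (h / 4) * (D j 0 + 2 * D (Suc j) 0 + D (Suc (Suc j)) 0)
    = complex_of_real (h / 4) * (ext0 N (V 0) j + 2 * ext0 N (V 0) (Suc j) + ext0 N (V 0) (Suc (Suc j)))
     - (\<Sum>k<n. d k 0 * (complex_of_real (h / 4) * (sn k (node N j) + 2 * sn k (node N (Suc j)) + sn k (node N (Suc (Suc j))))))"
    unfolding D_def by (simp add: algebra_simps sum.distrib sum_distrib_left sum_divide_distrib add_divide_distrib diff_divide_distrib)
  also have "\<dots> = half_cell_int N w1 (Suc j) - (\<Sum>k<n. d k 0 * (complex_of_real (h * csq k N) * sn k (node N (Suc j))))"
    unfolding M mass_sn ..
  also have "\<dots> = half_cell_int N w1 (Suc j) - (\<Sum>k<n. complex_of_real (1 - b1 k N) * d k 0 * half_cell_int N (sn k) (Suc j))"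
  proof -
    have k: "d k 0 * (complex_of_real (h * csq k N) * sn k (node N (Suc j))) = complex_of_real (1 - b1 k N) * d k 0 * half_cell_int N (sn k) (Suc j)"
      if "k < n" for k
    proof -
      have "h * csq k N = (1 - b1 k N) * (h * sinc k N)" using sinc[OF that] by (simp add: b1_def)
      then have e: "complex_of_real (h * csq k N) = complex_of_real (1 - b1 k N) * complex_of_real (h * sinc k N)"
        by (simp only: of_real_mult[symmetric])
      show ?thesis unfolding half_cell_sn[OF j] e by (simp only: mult_ac)
    qed
    show ?thesis
      by (rule arg_cong[where f = "\<lambda>z. half_cell_int N w1 (Suc j) - z"], rule sum.cong[OF refl], rule k) simp
  qed
  also have "\<dots> = half_cell_int N q0 (Suc j)"
  proof -
    have "half_cell_int N (\<lambda>x. \<Sum>k<n. complex_of_real (1 - b1 k N) * d k 0 * sn k x) (Suc j)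
       = (\<Sum>k<n. complex_of_real (1 - b1 k N) * d k 0 * half_cell_int N (sn k) (Suc j))"
      by (subst half_cell_sum[OF j]) (simp_all only: half_cell_cmult[OF j] L2on_integrable[OF L2on_cmult[OF SN.L2]])
    then show ?thesis
      unfolding q0_def[abs_def] half_cell_diff[OF j L2on_integrable[OF w1_L2] L2on_integrable[OF SN.L2_lincomb]] by simp
  qed
  also have "\<dots> = complex_of_real (h / 2) * (cell_mean N q0 j + cell_mean N q0 (Suc j))"
    by (rule half_cell_int_eq[OF L2on_integrable[OF q0_L2] j])
  finally show ?thesis .
qed

text \<open>Bound for the initial energy of the error. The kinetic half is \<open>q0_norm_le\<close>
  with its doubling cancelled; in the factor (1 + A)/2 the 1 is the gradient part and A the
  potential, estimated through the discrete Poincare inequality.\<close>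

definition E0b :: real where
  "E0b = L2norm2 {0..1} (\<lambda>x. w1 x - SN.proj n w1 x) + (\<Sum>k<n. (b1 k N)\<^sup>2 * (cmod (d k 0))\<^sup>2)
    + (1 + A) / 2 * L2norm2 {0..1} (\<lambda>x. wx 0 x - CS.proj (Suc n) (wx 0) x)"

text \<open>Used for \<open>L = Re\<close> and \<open>L = Im\<close>, since the direct inequality is proved for real sequences.\<close>
lemma part_estimate:
  assumes L: "bounded_linear L" and L_le: "\<And>z. \<bar>L z\<bar> \<le> cmod z"
    and \<kappa>: "\<And>j t. j < N \<Longrightarrow> t \<in> {0..T} \<Longrightarrow> cmod (rho (Suc j) t) \<le> \<kappa>"
      "\<And>j t. j < N \<Longrightarrow> t \<in> {0..T} \<Longrightarrow> cmod (rho' (Suc j) t) \<le> \<kappa>"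
  shows "(\<integral>t. (L (E 1 t) / h)\<^sup>2 + (L (D 1 t) / 2)\<^sup>2 \<partial>lebesgue_on {0..T}) \<le> direct_const T A * (E0b + \<kappa>\<^sup>2 + Qb)"
proof -
  interpret L: bounded_linear L by fact
  have Lm: "L (complex_of_real r * z) = r * L z" for r z
    using L.scaleR[of r z] by (simp add: scaleR_conv_of_real)
  have Ld: "L (z / complex_of_real r) = L z / r" for r z
    using Lm[of "inverse r" z] by (simp add: divide_inverse mult.commute)
  have L2: "L (2 * z) = 2 * L z" for z using Lm[of 2 z] by simp
  have Lsq: "(L z)\<^sup>2 \<le> (cmod z)\<^sup>2" for z using power_mono[OF L_le abs_ge_zero, of z 2] by simp
  define \<alpha> where "\<alpha> j = a (node N j)" for j
  have \<alpha>: "0 \<le> \<alpha> (Suc j)" "\<alpha> (Suc j) \<le> A" if "j < N" for j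
    using a_bounds[OF node_in_unit[of "Suc j" N]] that by (auto simp: \<alpha>_def)
  interpret S: semidiscrete N h T A \<kappa> \<alpha> "\<lambda>j t. L (E j t)" "\<lambda>j t. L (D j t)" "\<lambda>j t. L (D' j t)"
    "\<lambda>j t. L (cell_mean N (residual t) j)" "\<lambda>j t. L (rho j t)" "\<lambda>j t. L (rho' j t)" "\<lambda>t. L2norm2 {0..1} (residual t)"
  proof
    show "real (Suc N) * h = 1" by (rule Suc_mesh)
    show "0 < T" by (rule T_pos)
    show "L (E 0 t) = 0" "L (E (Suc N) t) = 0" "L (D 0 t) = 0" "L (D (Suc N) t) = 0" for t
      by (simp_all add: boundary_values L.zero)
    show "AC T (\<lambda>t. L (E j t)) (\<lambda>t. L (D j t))" for j by (rule AC_bounded_linear[OF L E_AC])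
    show "j \<le> Suc N \<Longrightarrow> AC T (\<lambda>t. L (D j t)) (\<lambda>t. L (D' j t))" for j by (rule AC_bounded_linear[OF L D_AC])
    show "AC T (\<lambda>t. L (rho (Suc j) t)) (\<lambda>t. L (rho' (Suc j) t))" for j by (rule AC_bounded_linear[OF L rho_AC])
    show "j < N \<Longrightarrow> t \<in> {0..T} \<Longrightarrow> \<bar>L (rho (Suc j) t)\<bar> \<le> \<kappa>" for j t using L_le \<kappa>(1) order_trans by blast
    show "j < N \<Longrightarrow> t \<in> {0..T} \<Longrightarrow> \<bar>L (rho' (Suc j) t)\<bar> \<le> \<kappa>" for j t using L_le \<kappa>(2) order_trans by blast
    show "j < N \<Longrightarrow> 0 \<le> \<alpha> (Suc j)" "j < N \<Longrightarrow> \<alpha> (Suc j) \<le> A" for j using \<alpha> by auto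
    show "integrable (lebesgue_on {0..T}) (\<lambda>t. L2norm2 {0..1} (residual t))" by (rule L2prod_section(2)[OF residual_L2prod])
    show "AE t in lebesgue_on {0..T}. h * (\<Sum>j\<le>N. (L (cell_mean N (residual t) j))\<^sup>2) \<le> L2norm2 {0..1} (residual t)"
      using L2prod_section(1)[OF residual_L2prod]
    proof eventually_elim
      case (elim t)
      have "h * (\<Sum>j\<le>N. (L (cell_mean N (residual t) j))\<^sup>2) \<le> h * (\<Sum>j\<le>N. (cmod (cell_mean N (residual t) j))\<^sup>2)"
        using h_pos by (intro mult_left_mono sum_mono Lsq) auto
      then show ?case using sum_cell_mean_sq_le[OF elim, of N] by simp
    qed
    show "AE t in lebesgue_on {0..T}. scheme N h \<alpha> (\<lambda>j. L (E j t)) (\<lambda>j. L (D' j t)) (\<lambda>j. L (cell_mean N (residual t) j)) (\<lambda>j. L (rho j t))"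
      using L2prod_section(1)[OF residual_L2prod] L2prod_section(1)[OF F_L2prod] L2prod_section(1)[OF G] G_eq AE_space
    proof eventually_elim
      case (elim t)
      then have t: "t \<in> {0..T}" by simp
      show ?case
        unfolding scheme_def
      proof (intro allI impI)
        fix j assume j: "j < N"
        show "h / 4 * (L (D' j t) + 2 * L (D' (Suc j) t) + L (D' (Suc (Suc j)) t))
           + (2 * L (E (Suc j) t) - L (E j t) - L (E (Suc (Suc j)) t)) / h + h * \<alpha> (Suc j) * L (E (Suc j) t)
          = h / 2 * (L (cell_mean N (residual t) j) + L (cell_mean N (residual t) (Suc j))) + h * L (rho (Suc j) t)"
          using arg_cong[OF scheme_error[OF t elim(2,3,4,1) j], of L]
          unfolding L.add L.diff Lm Ld L2 \<alpha>_def .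
      qed
    qed
  qed
  have "S.En 0 \<le> E0b"
  proof -
    let ?w = "\<lambda>j. L (E j 0)" and ?v = "\<lambda>j. L (D j 0)"
    have mean: "h * (\<Sum>j\<le>N. (mean ?v j)\<^sup>2) \<le> L2norm2 {0..1} q0"
    proof -
      have "h * (\<Sum>j\<le>N. (mean ?v j)\<^sup>2) \<le> h * (\<Sum>j\<le>N. (L (cell_mean N q0 j))\<^sup>2)"
      proof (rule static_mean_estimate[OF h_pos])
        fix j assume "j < N"
        from arg_cong[OF init_mass[OF this], of L]
        show "h / 4 * (L (D j 0) + 2 * L (D (Suc j) 0) + L (D (Suc (Suc j)) 0)) = h / 2 * (L (cell_mean N q0 j) + L (cell_mean N q0 (Suc j)))"
          unfolding L.add Lm L2 .
      qed (simp_all add: boundary_values L.zero)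
      also have "\<dots> \<le> h * (\<Sum>j\<le>N. (cmod (cell_mean N q0 j))\<^sup>2)"
        using h_pos by (intro mult_left_mono sum_mono Lsq) auto
      also have "\<dots> \<le> L2norm2 {0..1} q0" by (rule sum_cell_mean_sq_le[OF q0_L2])
      finally show ?thesis .
    qed
    have dq: "h * (\<Sum>j\<le>N. (dq h ?w j)\<^sup>2) \<le> L2norm2 {0..1} (\<lambda>x. wx 0 x - CS.proj (Suc n) (wx 0) x)"
    proof -
      have "h * (\<Sum>j\<le>N. (dq h ?w j)\<^sup>2) = h * (\<Sum>j\<le>N. (L ((E (Suc j) 0 - E j 0) / complex_of_real h))\<^sup>2)"
        by (simp add: dq_def Ld L.diff)
      also have "\<dots> \<le> h * (\<Sum>j\<le>N. (cmod ((E (Suc j) 0 - E j 0) / complex_of_real h))\<^sup>2)"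
        using h_pos by (intro mult_left_mono sum_mono Lsq) auto
      finally show ?thesis using init_dq by simp
    qed
    let ?P = "h * (\<Sum>j\<le>N. (dq h ?w j)\<^sup>2)"
    have P: "?P \<ge> 0" using h_pos by (intro mult_nonneg_nonneg sum_nonneg) auto
    \<comment> \<open>Each squared nodal value is at most \<open>?P\<close>, and the N nodes
      weighted by h have total mass at most 1.\<close>
    have pot: "h * (\<Sum>j<N. \<alpha> (Suc j) * (?w (Suc j) * ?w (Suc j))) \<le> A * ?P"
    proof -
      have "h * (\<Sum>j<N. \<alpha> (Suc j) * (?w (Suc j) * ?w (Suc j))) \<le> h * (\<Sum>j<N. A * ?P)"
      proof (intro mult_left_mono sum_mono)
        fix j assume "j \<in> {..<N}"
        then have j: "j < N" by simp
        have "?w (Suc j) * ?w (Suc j) \<le> ?P"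
          using discrete_Poincare[where w = ?w, OF Suc_mesh, of "Suc j"] j by (simp add: boundary_values L.zero power2_eq_square)
        then show "\<alpha> (Suc j) * (?w (Suc j) * ?w (Suc j)) \<le> A * ?P"
          by (rule mult_mono[OF \<alpha>(2)[OF j]]) (simp_all add: A_nonneg)
      qed (use h_pos in auto)
      also have "\<dots> = (real N * h) * (A * ?P)" by simp
      also have "\<dots> \<le> 1 * (A * ?P)" using A_nonneg P by (intro mult_right_mono S.Nh_le_1) auto
      finally show ?thesis by simp
    qed
    have "S.En 0 = (h * (\<Sum>j\<le>N. (mean ?v j)\<^sup>2) + ?P + h * (\<Sum>j<N. \<alpha> (Suc j) * (?w (Suc j) * ?w (Suc j)))) / 2"
      by (simp add: energy_def power2_eq_square)
    also have "\<dots> \<le> (L2norm2 {0..1} q0 + ?P + A * ?P) / 2"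
      by (intro divide_right_mono add_mono mean pot) auto
    also have "\<dots> = L2norm2 {0..1} q0 / 2 + (1 + A) / 2 * ?P" by (simp add: field_simps)
    also have "\<dots> \<le> L2norm2 {0..1} q0 / 2 + (1 + A) / 2 * L2norm2 {0..1} (\<lambda>x. wx 0 x - CS.proj (Suc n) (wx 0) x)"
      using A_nonneg by (intro add_left_mono mult_left_mono dq) auto
    also have "\<dots> \<le> E0b" using q0_norm_le by (simp add: E0b_def)
    finally show ?thesis .
  qed
  from S.direct_inequality[OF this]
  have "(\<integral>t. (L (E 1 t) / h)\<^sup>2 + (L (D 1 t) / 2)\<^sup>2 \<partial>lebesgue_on {0..T}) \<le> direct_const T A * (E0b + \<kappa>\<^sup>2 + S.Q)"
    by (simp add: dq_def mean_def boundary_values L.zero direct_const_def)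
  also have "\<dots> \<le> direct_const T A * (E0b + \<kappa>\<^sup>2 + Qb)"
    using residual_norm_le T_pos by (intro mult_left_mono add_left_mono) (auto simp: direct_const_def intro!: add_nonneg_nonneg mult_nonneg_nonneg)
  finally show ?thesis .
qed

text \<open>Adding the real and imaginary parts gives the factor 2. The direct inequality sees the
  velocity as its mean D_1/2 in the first cell, so the second bound carries an additional factor
  4.\<close>

lemma error_estimate:
  assumes \<kappa>: "\<And>j t. j < N \<Longrightarrow> t \<in> {0..T} \<Longrightarrow> cmod (rho (Suc j) t) \<le> \<kappa>"
      "\<And>j t. j < N \<Longrightarrow> t \<in> {0..T} \<Longrightarrow> cmod (rho' (Suc j) t) \<le> \<kappa>"
  shows "L2norm2 {0..T} (\<lambda>t. E 1 t / complex_of_real h) \<le> 2 * direct_const T A * (E0b + \<kappa>\<^sup>2 + Qb)"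
    and "L2norm2 {0..T} (D 1) \<le> 8 * direct_const T A * (E0b + \<kappa>\<^sup>2 + Qb)"
proof -
  let ?K = "direct_const T A * (E0b + \<kappa>\<^sup>2 + Qb)"
  have cE: "continuous_on {0..T} (E 1)" by (rule AC_continuous_on[OF E_AC])
  have cD: "continuous_on {0..T} (D 1)" by (rule AC_continuous_on[OF D_AC]) simp
  have i: "integrable (lebesgue_on {0..T}) (\<lambda>t. (Re (E 1 t) / h)\<^sup>2 + (Re (D 1 t) / 2)\<^sup>2)"
    "integrable (lebesgue_on {0..T}) (\<lambda>t. (Im (E 1 t) / h)\<^sup>2 + (Im (D 1 t) / 2)\<^sup>2)"
    using h_pos by (intro continuous_on_integrable_Icc continuous_intros cE cD; simp)+
  have "(\<integral>t. (cmod (E 1 t / complex_of_real h))\<^sup>2 + (cmod (D 1 t))\<^sup>2 / 4 \<partial>lebesgue_on {0..T})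
     = (\<integral>t. ((Re (E 1 t) / h)\<^sup>2 + (Re (D 1 t) / 2)\<^sup>2) + ((Im (E 1 t) / h)\<^sup>2 + (Im (D 1 t) / 2)\<^sup>2) \<partial>lebesgue_on {0..T})"
    by (intro Bochner_Integration.integral_cong refl)
      (simp add: norm_divide power_divide, simp add: cmod_power2 add_divide_distrib)
  also have "\<dots> \<le> 2 * ?K"
    unfolding Bochner_Integration.integral_add[OF i]
    using part_estimate[OF bounded_linear_Re abs_Re_le_cmod \<kappa>] part_estimate[OF bounded_linear_Im abs_Im_le_cmod \<kappa>] by simp
  finally have le: "(\<integral>t. (cmod (E 1 t / complex_of_real h))\<^sup>2 + (cmod (D 1 t))\<^sup>2 / 4 \<partial>lebesgue_on {0..T}) \<le> 2 * ?K" .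
  have "integrable (lebesgue_on {0..T}) (\<lambda>t. (cmod (E 1 t / complex_of_real h))\<^sup>2)" "integrable (lebesgue_on {0..T}) (\<lambda>t. (cmod (D 1 t))\<^sup>2)"
    using h_pos by (intro continuous_on_integrable_Icc continuous_intros cE cD; simp)+
  then have "L2norm2 {0..T} (\<lambda>t. E 1 t / complex_of_real h) + L2norm2 {0..T} (D 1) / 4 \<le> 2 * ?K"
    using le by (simp add: L2norm2_def)
  then show "L2norm2 {0..T} (\<lambda>t. E 1 t / complex_of_real h) \<le> 2 * direct_const T A * (E0b + \<kappa>\<^sup>2 + Qb)"
    "L2norm2 {0..T} (D 1) \<le> 8 * direct_const T A * (E0b + \<kappa>\<^sup>2 + Qb)"
    using L2norm2_nonneg[of "{0..T}" "D 1"] L2norm2_nonneg[of "{0..T}" "\<lambda>t. E 1 t / complex_of_real h"] by simp_all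
qed

end

section \<open>Convergence of the boundary traces\<close>

lemma sn_mesh_tendsto: "(\<lambda>N. sn k (mesh N)) \<longlonglongrightarrow> 0"
  and sn_mesh_dq_tendsto: "(\<lambda>N. sn k (mesh N) / complex_of_real (mesh N)) \<longlonglongrightarrow> complex_of_real (sqrt 2 * freq k)"
proof -
  have "(\<lambda>N. sqrt 2 * sin (p * (1 / (real N + 1)))) \<longlonglongrightarrow> 0" if "p > 0" for p :: real
    using that by real_asymp
  moreover have "(\<lambda>N. sqrt 2 * sin (p * (1 / (real N + 1))) / (1 / (real N + 1))) \<longlonglongrightarrow> sqrt 2 * p" if "p > 0" for p :: real
    using that by real_asymp (simp add: sqrt_def)
  ultimately have "(\<lambda>N. sqrt 2 * sin (freq k * (1 / (real N + 1)))) \<longlonglongrightarrow> 0"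
    "(\<lambda>N. sqrt 2 * sin (freq k * (1 / (real N + 1))) / (1 / (real N + 1))) \<longlonglongrightarrow> sqrt 2 * freq k"
    using freq_pos[of k] by blast+
  from this[THEN tendsto_of_real, where 'a = complex]
  show "(\<lambda>N. sn k (mesh N)) \<longlonglongrightarrow> 0"
    "(\<lambda>N. sn k (mesh N) / complex_of_real (mesh N)) \<longlonglongrightarrow> complex_of_real (sqrt 2 * freq k)"
    by (simp_all only: sn_def mesh_def of_real_divide of_real_0)
qed

lemma L2norm2_lincomb_tendsto_0:
  fixes n :: nat
  assumes u: "\<And>k. k < n \<Longrightarrow> L2on S (u k)" and x: "\<And>k. k < n \<Longrightarrow> (\<lambda>N. x N k) \<longlonglongrightarrow> (0::complex)"
  shows "(\<lambda>N. L2norm2 S (\<lambda>t. \<Sum>k<n. x N k * u k t)) \<longlonglongrightarrow> 0"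
proof -
  have "(\<lambda>N. real n * (\<Sum>k<n. (cmod (x N k))\<^sup>2 * L2norm2 S (u k))) \<longlonglongrightarrow> real n * (\<Sum>k<n. (cmod 0)\<^sup>2 * L2norm2 S (u k))"
    by (intro tendsto_intros x) simp
  then have "(\<lambda>N. real n * (\<Sum>k<n. (cmod (x N k))\<^sup>2 * L2norm2 S (u k))) \<longlonglongrightarrow> 0" by simp
  then show ?thesis
    by (rule tendsto_sandwich[OF _ _ tendsto_const, rotated 2]) (auto intro!: always_eventually L2norm2_nonneg L2norm2_sum_le u)
qed

lemma eventually_ball_lessThan: "(\<And>k. k < (n::nat) \<Longrightarrow> \<forall>\<^sub>F N in F'. P N k) \<Longrightarrow> \<forall>\<^sub>F N in F'. \<forall>k<n. P N k"
  using eventually_ball_finite[of "{..<n}" P F'] by (simp add: Ball_def)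

locale wave_approximation = wave_solution +
  fixes W V :: "nat \<Rightarrow> real \<Rightarrow> nat \<Rightarrow> complex" and A :: real
  assumes disc: "\<And>N. N \<ge> 1 \<Longrightarrow> discrete_solution a T g w0 w1 N (W N) (V N)"
    and a_bounds: "\<And>x. x \<in> {0..1} \<Longrightarrow> 0 \<le> a x \<and> a x \<le> A" and w1_L2: "L2on {0..1} w1"
begin

text \<open>The part of \<open>E0b\<close> and \<open>Qb\<close> that does not involve the mesh:
  only series tails of the data and of the source.\<close>

definition \<delta> :: "nat \<Rightarrow> real" where
  "\<delta> n = L2norm2 {0..1} (\<lambda>x. w1 x - SN.proj n w1 x)
    + (1 + A) / 2 * L2norm2 {0..1} (\<lambda>x. wx 0 x - CS.proj (Suc n) (wx 0) x)
    + 4 * (\<integral>t. L2norm2 {0..1} (\<lambda>x. F t x - SN.proj n (F t) x) \<partial>lebesgue_on {0..T})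
    + 4 * A\<^sup>2 * (\<integral>t. L2norm2 {0..1} (\<lambda>x. w t x - SN.proj n (w t) x) \<partial>lebesgue_on {0..T})"

lemma \<delta>_tendsto: "\<delta> \<longlonglongrightarrow> 0"
proof -
  have "(\<lambda>n. \<delta> n) \<longlonglongrightarrow> 0 + (1 + A) / 2 * 0 + 4 * 0 + 4 * A\<^sup>2 * 0"
    unfolding \<delta>_def using T_pos
    by (intro tendsto_intros SN.proj_tendsto w1_L2 LIMSEQ_Suc[OF CS.proj_tendsto] wx_L2
        SN.L2prod_minus_proj_tendsto(1) F_L2prod w_L2prod) simp
  then show ?thesis by simp
qed

lemma W1_continuous: "N \<ge> 1 \<Longrightarrow> continuous_on {0..T} (\<lambda>t. W N t 1)"
proof -
  assume N: "N \<ge> 1"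
  have 1: "1 \<in> {1..N}" using N by simp
  have "\<forall>t\<in>{0..T}. ((\<lambda>s. W N s 1) has_vector_derivative V N t 1) (at t within {0..T})"
    using disc[OF N] 1 unfolding discrete_solution_def by blast
  then show "continuous_on {0..T} (\<lambda>t. W N t 1)"
    by (intro continuous_on_vector_derivative) blast
qed

text \<open>The truncation stays fixed while the mesh is refined, so the finitely many mode defects
  and lumping errors disappear and \<open>\<delta> n\<close> remains. The first node then compares
  the sine values over h with their derivatives at 0, which converts the truncated series into
  \<open>flux\<close>.\<close>

lemma trace_estimate:
  assumes e: "e > 0"
  shows "\<forall>\<^sub>F N in sequentially. L2norm2 {0..T} (\<lambda>t. W N t 1 / complex_of_real (mesh N) - flux n t) \<le> 16 * direct_const T A * \<delta> n + e
    \<and> L2norm2 {0..T} (\<lambda>t. V N t 1) \<le> 16 * direct_const T A * \<delta> n + e"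
proof -
  let ?K = "direct_const T A"
  have K: "?K > 0" unfolding direct_const_def using T_pos by (intro add_pos_nonneg add_nonneg_pos mult_nonneg_nonneg add_nonneg_nonneg) auto
  \<comment> \<open>Two contributions of size \<open>e1\<close>, from the mode defects and from
    \<kappa>^2, cost e/32 after multiplication by the constant; the factor 16 leaves e/2, and the
    first-node terms, each below e/4 and doubled, use the other half.\<close>
  define e1 where "e1 = e / (64 * ?K)"
  have e1: "e1 > 0" using e K by (simp add: e1_def)
  have bound: "\<exists>B. \<forall>k<n. \<forall>t\<in>{0..T}. cmod (u k t) \<le> B" if "\<And>k. continuous_on {0..T} (u k)" for u :: "nat \<Rightarrow> real \<Rightarrow> complex"
  proof -
    have "\<exists>B. \<forall>t\<in>{0..T}. cmod (u k t) \<le> B" for k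
      using compact_imp_bounded[OF compact_continuous_image[OF that compact_Icc], of k] unfolding bounded_iff by blast
    then obtain B where B: "\<And>k t. t \<in> {0..T} \<Longrightarrow> cmod (u k t) \<le> B k" by metis
    have "cmod (u k t) \<le> (\<Sum>k<n. \<bar>B k\<bar>)" if "k < n" "t \<in> {0..T}" for k t
      using B[OF that(2), of k] member_le_sum[of k "{..<n}" "\<lambda>k. \<bar>B k\<bar>"] that by fastforce
    then show ?thesis by blast
  qed
  obtain B1 where B1: "\<forall>k<n. \<forall>t\<in>{0..T}. cmod (c k t) \<le> B1" using bound[of c, OF c_continuous] by blast
  obtain B2 where B2: "\<forall>k<n. \<forall>t\<in>{0..T}. cmod (d k t) \<le> B2" using bound[of d, OF d_continuous] by blast
  define B where "B = 1 + \<bar>B1\<bar> + \<bar>B2\<bar>"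
  have B: "B > 0" "\<And>k t. k < n \<Longrightarrow> t \<in> {0..T} \<Longrightarrow> cmod (c k t) \<le> B" "\<And>k t. k < n \<Longrightarrow> t \<in> {0..T} \<Longrightarrow> cmod (d k t) \<le> B"
    using B1 B2 unfolding B_def by (simp, fastforce, fastforce)
  define \<kappa> where "\<kappa> = sqrt e1"
  \<comment> \<open>Tolerance per mode: n coefficients bounded by \<open>B\<close> then sum to at
    most \<kappa>. \<open>Suc n\<close> keeps the denominator positive for n = 0.\<close>
  define \<gamma> where "\<gamma> = \<kappa> / (B * real (Suc n))"
  have \<kappa>: "\<kappa> > 0" "\<kappa>\<^sup>2 = e1" using e1 by (auto simp: \<kappa>_def)
  have \<gamma>: "\<gamma> > 0" using \<kappa> B by (simp add: \<gamma>_def)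
  define \<eta> where "\<eta> N = (\<Sum>k<n. (b1 k N)\<^sup>2 * (cmod (d k 0))\<^sup>2)
     + 4 * (\<Sum>k<n. (b1 k N)\<^sup>2 * L2norm2 {0..T} (f k) + (b2 k N)\<^sup>2 * L2norm2 {0..T} (c k))" for N
  have "(\<lambda>N. \<eta> N) \<longlonglongrightarrow> (\<Sum>k<n. 0\<^sup>2 * (cmod (d k 0))\<^sup>2) + 4 * (\<Sum>k<n. 0\<^sup>2 * L2norm2 {0..T} (f k) + 0\<^sup>2 * L2norm2 {0..T} (c k))"
    unfolding \<eta>_def by (intro tendsto_intros b1_tendsto b2_tendsto)
  then have "\<eta> \<longlonglongrightarrow> 0" by simp
  then have ev_\<eta>: "\<forall>\<^sub>F N in sequentially. \<eta> N < e1" using e1 by (rule order_tendstoD(2))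
  have ev_sinc: "\<forall>\<^sub>F N in sequentially. \<forall>k<n. sinc k N \<noteq> 0"
    by (intro eventually_ball_lessThan sinc_eventually_nonzero)
  have ev_gam: "\<forall>\<^sub>F N in sequentially. \<forall>k<n. \<forall>j<N. cmod (half_cell_int N (\<lambda>x. complex_of_real (a x) * sn k x) (Suc j) / complex_of_real (mesh N)
      - complex_of_real (a (node N (Suc j))) * sn k (node N (Suc j))) \<le> \<gamma>"
    by (intro eventually_ball_lessThan half_cell_mean_tendsto continuous_intros a_cont continuous_on_sn \<gamma>)
  define p where "p N t = (\<Sum>k<n. (sn k (mesh N) / complex_of_real (mesh N) - complex_of_real (sqrt 2 * freq k)) * c k t)" for N t
  define s where "s N t = (\<Sum>k<n. sn k (mesh N) * d k t)" for N t
  have cL: "L2on {0..T} (c k)" and dL: "L2on {0..T} (d k)" for k by (intro L2on_continuous c_continuous d_continuous)+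
  have "(\<lambda>N. L2norm2 {0..T} (p N)) \<longlonglongrightarrow> 0"
    unfolding p_def[abs_def] by (intro L2norm2_lincomb_tendsto_0 cL LIM_zero sn_mesh_dq_tendsto)
  then have ev_p: "\<forall>\<^sub>F N in sequentially. L2norm2 {0..T} (p N) < e / 4" using e by (intro order_tendstoD(2)) auto
  have "(\<lambda>N. L2norm2 {0..T} (s N)) \<longlonglongrightarrow> 0"
    unfolding s_def[abs_def] by (intro L2norm2_lincomb_tendsto_0 dL sn_mesh_tendsto)
  then have ev_s: "\<forall>\<^sub>F N in sequentially. L2norm2 {0..T} (s N) < e / 4" using e by (intro order_tendstoD(2)) auto
  show ?thesis
    using ev_\<eta> ev_sinc ev_gam ev_p ev_s eventually_ge_at_top[of 1]
  proof eventually_elim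
    case (elim N)
    interpret DW: discrete_wave a T g G w0 w1 w wx wt N n "W N" "V N" A
      by unfold_locales (use disc elim a_bounds w1_L2 in blast)+
    have gam: "cmod (DW.gam k (Suc j)) \<le> \<gamma>" if "k < n" "j < N" for k j
      using elim(3) that unfolding DW.gam_def by blast
    have small: "cmod (\<Sum>k<n. u k * DW.gam k (Suc j)) \<le> \<kappa>" if u: "\<And>k. k < n \<Longrightarrow> cmod (u k) \<le> B" and j: "j < N" for u j
    proof -
      have "cmod (\<Sum>k<n. u k * DW.gam k (Suc j)) \<le> (\<Sum>k<n. B * \<gamma>)"
        using u gam j B(1) \<gamma> by (intro order_trans[OF norm_sum] sum_mono) (auto simp: norm_mult intro!: mult_mono)
      also have "\<dots> = real n / real (Suc n) * \<kappa>" using B(1) by (simp add: \<gamma>_def)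
      also have "\<dots> \<le> 1 * \<kappa>" using \<kappa>(1) by (intro mult_right_mono) auto
      finally show ?thesis by simp
    qed
    have r: "cmod (DW.rho (Suc j) t) \<le> \<kappa>" "cmod (DW.rho' (Suc j) t) \<le> \<kappa>" if "j < N" "t \<in> {0..T}" for j t
      unfolding DW.rho_def DW.rho'_def using B(2,3) that by (auto intro!: small)
    note est = DW.error_estimate[OF r]
    have tot: "DW.E0b + \<kappa>\<^sup>2 + DW.Qb \<le> \<delta> n + 2 * e1"
      using elim(1) unfolding DW.E0b_def DW.Qb_def \<delta>_def \<eta>_def \<kappa>(2) by simp
    have k: "?K * (DW.E0b + \<kappa>\<^sup>2 + DW.Qb) \<le> ?K * \<delta> n + e / 32"
    proof -
      have "?K * (DW.E0b + \<kappa>\<^sup>2 + DW.Qb) \<le> ?K * (\<delta> n + 2 * e1)" using tot K by (intro mult_left_mono) auto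
      also have "\<dots> = ?K * \<delta> n + e / 32" using K by (simp add: e1_def field_simps)
      finally show ?thesis .
    qed
    have E: "L2on {0..T} (\<lambda>t. DW.E 1 t / complex_of_real (mesh N))" and D: "L2on {0..T} (DW.D 1)"
      using mesh_pos[of N] by (intro L2on_continuous continuous_intros AC_continuous_on[OF DW.E_AC] AC_continuous_on[OF DW.D_AC]; simp)+
    have pL: "L2on {0..T} (p N)" and sL: "L2on {0..T} (s N)"
      unfolding p_def[abs_def] s_def[abs_def] by (intro L2on_sum L2on_cmult cL dL)+
    have W_eq: "W N t 1 / complex_of_real (mesh N) - flux n t = DW.E 1 t / complex_of_real (mesh N) + p N t" for t
    proof -
      have "p N t = (\<Sum>k<n. c k t * sn k (mesh N)) / complex_of_real (mesh N) - flux n t"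
        unfolding p_def flux_def left_diff_distrib sum_subtractf sum_divide_distrib by (simp add: mult.commute)
      then show ?thesis using elim(6) by (simp add: DW.E_def ext0_def node_1 diff_divide_distrib)
    qed
    have V_eq: "V N t 1 = DW.D 1 t + s N t" for t
      using elim(6) by (simp add: DW.D_def ext0_def s_def node_1 mult.commute)
    \<comment> \<open>Nonnegativity lets the smaller factor 4 of the displacement trace be enlarged
      to the common 16.\<close>
    have \<delta>0: "0 \<le> ?K * (DW.E0b + \<kappa>\<^sup>2 + DW.Qb)"
      using est(1) L2norm2_nonneg[of "{0..T}" "\<lambda>t. DW.E 1 t / complex_of_real (mesh N)"] by simp
    have 1: "L2norm2 {0..T} (\<lambda>t. W N t 1 / complex_of_real (mesh N) - flux n t) \<le> 16 * ?K * \<delta> n + e"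
      unfolding W_eq using L2norm2_add_le[OF E pL] est(1) k \<delta>0 elim(4) by (simp add: mult.assoc)
    have 2: "L2norm2 {0..T} (\<lambda>t. V N t 1) \<le> 16 * ?K * \<delta> n + e"
      unfolding V_eq using L2norm2_add_le[OF D sL] est(2) k \<delta>0 elim(5) by (simp add: mult.assoc)
    show ?case using 1 2 by blast
  qed
qed

lemma flux_L2: "L2on {0..T} (flux n)"
  by (intro L2on_continuous flux_continuous)

text \<open>Both fluxes are close to the same discrete trace on a sufficiently fine mesh. Hidden
  regularity of the continuous solution is thus read off from the uniform discrete estimate.\<close>

lemma flux_Cauchy: "L2norm2 {0..T} (\<lambda>t. flux n t - flux m t) \<le> 32 * direct_const T A * (\<delta> n + \<delta> m)"
proof (rule field_le_epsilon)
  fix e :: real assume e: "e > 0"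
  then have e4: "e / 4 > 0" by simp
  have "\<forall>\<^sub>F N in sequentially. L2norm2 {0..T} (\<lambda>t. flux n t - flux m t) \<le> 32 * direct_const T A * (\<delta> n + \<delta> m) + e"
    using trace_estimate[OF e4, of n] trace_estimate[OF e4, of m] eventually_ge_at_top[of 1]
  proof eventually_elim
    case (elim N)
    have L: "L2on {0..T} (\<lambda>t. W N t 1 / complex_of_real (mesh N))"
      using mesh_pos[of N] elim(3) by (intro L2on_continuous continuous_intros W1_continuous; simp)
    have "L2norm2 {0..T} (\<lambda>t. flux n t - flux m t) \<le> 2 * L2norm2 {0..T} (\<lambda>t. flux n t - W N t 1 / complex_of_real (mesh N))
       + 2 * L2norm2 {0..T} (\<lambda>t. W N t 1 / complex_of_real (mesh N) - flux m t)"
      by (rule L2norm2_triangle[OF flux_L2 L flux_L2])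
    then show ?case
      using elim(1,2) e by (simp add: L2norm2_def norm_minus_commute[of "flux n _"] algebra_simps)
  qed
  \<comment> \<open>The inequality no longer contains the mesh, so holding for large
    \<open>N\<close> means that it holds.\<close>
  then show "L2norm2 {0..T} (\<lambda>t. flux n t - flux m t) \<le> 32 * direct_const T A * (\<delta> n + \<delta> m) + e"
    by (simp add: eventually_sequentially) blast
qed

text \<open>The limit of the fluxes exists by completeness and is identified by Green's formula. For
  the discrete traces the truncation is chosen first, to make \<open>\<delta> n\<close> small, and
  only afterwards is the mesh refined.\<close>

theorem trace_convergence:
  "\<exists>\<psi>. normal_derivative_at_0 a T g w wx wt \<psi>
     \<and> (\<lambda>N. L2norm2 {0..T} (\<lambda>t. W N t 1 / complex_of_real (mesh N) - \<psi> t)) \<longlonglongrightarrow> 0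
     \<and> (\<lambda>N. L2norm2 {0..T} (\<lambda>t. V N t 1)) \<longlonglongrightarrow> 0"
proof -
  let ?K = "direct_const T A"
  have K: "?K > 0" unfolding direct_const_def using T_pos by (intro add_pos_nonneg add_nonneg_pos mult_nonneg_nonneg add_nonneg_nonneg) auto
  have small: "\<forall>\<^sub>F n in sequentially. \<delta> n < e" if "e > 0" for e
    using \<delta>_tendsto that by (rule order_tendstoD(2))
  interpret FM: finite_measure "lebesgue_on {0..T}" by (rule finite_measure_lebesgue_on_Icc)
  obtain \<psi> where \<psi>: "sqint (lebesgue_on {0..T}) \<psi>" "(\<lambda>n. \<integral>x. (cmod (flux n x - \<psi> x))\<^sup>2 \<partial>lebesgue_on {0..T}) \<longlonglongrightarrow> 0"
  proof (rule FM.Riesz_Fischer)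
    show "sqint (lebesgue_on {0..T}) (flux n)" for n using flux_L2 by (simp add: L2on_iff_sqint)
    fix e :: real assume e: "e > 0"
    \<comment> \<open>The Cauchy bound has factor 32 and two such terms, which add up to
      \<open>e\<close>.\<close>
    obtain N where N: "\<And>n. n \<ge> N \<Longrightarrow> \<delta> n < e / (64 * ?K)"
      using small[of "e / (64 * ?K)"] e K by (auto simp: eventually_sequentially)
    have "(\<integral>x. (cmod (flux n x - flux m x))\<^sup>2 \<partial>lebesgue_on {0..T}) < e" if "m \<ge> N" "n \<ge> N" for m n
    proof -
      have "L2norm2 {0..T} (\<lambda>t. flux n t - flux m t) \<le> 32 * ?K * (\<delta> n + \<delta> m)" by (rule flux_Cauchy)
      also have "\<dots> < 32 * ?K * (e / (64 * ?K) + e / (64 * ?K))"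
        using K N[OF that(1)] N[OF that(2)] by (intro mult_strict_left_mono add_strict_mono) auto
      also have "\<dots> = e" using K by (simp add: field_simps)
      finally show ?thesis by (simp add: L2norm2_def)
    qed
    then show "\<exists>N. \<forall>m\<ge>N. \<forall>n\<ge>N. (\<integral>x. (cmod (flux n x - flux m x))\<^sup>2 \<partial>lebesgue_on {0..T}) < e" by blast
  qed blast
  have \<psi>L: "L2on {0..T} \<psi>" using \<psi>(1) by (simp add: L2on_iff_sqint)
  have lim: "(\<lambda>n. L2norm2 {0..T} (\<lambda>t. flux n t - \<psi> t)) \<longlonglongrightarrow> 0" using \<psi>(2) by (simp add: L2norm2_def)
  have nd: "normal_derivative_at_0 a T g w wx wt \<psi>" by (rule normal_derivative_limit[OF \<psi>L lim])
  have c1: "(\<lambda>N. L2norm2 {0..T} (\<lambda>t. W N t 1 / complex_of_real (mesh N) - \<psi> t)) \<longlonglongrightarrow> 0"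
  proof (rule order_tendstoI)
    fix e :: real assume "e < 0"
    then show "\<forall>\<^sub>F N in sequentially. e < L2norm2 {0..T} (\<lambda>t. W N t 1 / complex_of_real (mesh N) - \<psi> t)"
      using L2norm2_nonneg less_le_trans by (intro always_eventually) blast
  next
    fix e :: real assume e: "0 < e"
    \<comment> \<open>The triangle inequality will double three errors of size e/8: the tail, the
      mesh error at this truncation, and the distance of the flux from its limit. The total 3e/4 is
      below \<open>e\<close>.\<close>
    then have e8: "e / 8 > 0" by simp
    have "\<forall>\<^sub>F n in sequentially. \<delta> n < e / (128 * ?K) \<and> L2norm2 {0..T} (\<lambda>t. flux n t - \<psi> t) < e / 8"
      using small[of "e / (128 * ?K)"] order_tendstoD(2)[OF lim, of "e / 8"] e K by (intro eventually_conj) auto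
    then obtain n where n: "\<delta> n < e / (128 * ?K)" "L2norm2 {0..T} (\<lambda>t. flux n t - \<psi> t) < e / 8"
      by (auto simp: eventually_sequentially)
    have Kd: "16 * ?K * \<delta> n < e / 8" using n(1) K by (simp add: field_simps)
    show "\<forall>\<^sub>F N in sequentially. L2norm2 {0..T} (\<lambda>t. W N t 1 / complex_of_real (mesh N) - \<psi> t) < e"
      using trace_estimate[OF e8, of n] eventually_ge_at_top[of 1]
    proof eventually_elim
      case (elim N)
      have L: "L2on {0..T} (\<lambda>t. W N t 1 / complex_of_real (mesh N))"
        using mesh_pos[of N] elim(2) by (intro L2on_continuous continuous_intros W1_continuous; simp)
      show ?case using L2norm2_triangle[OF L flux_L2[of n] \<psi>L] elim(1) n(2) Kd e by simp
    qed
  qed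
  have c2: "(\<lambda>N. L2norm2 {0..T} (\<lambda>t. V N t 1)) \<longlonglongrightarrow> 0"
  proof (rule order_tendstoI)
    fix e :: real assume "e < 0"
    then show "\<forall>\<^sub>F N in sequentially. e < L2norm2 {0..T} (\<lambda>t. V N t 1)"
      using L2norm2_nonneg less_le_trans by (intro always_eventually) blast
  next
    fix e :: real assume e: "0 < e"
    then have e8: "e / 8 > 0" by simp
    obtain n where n: "\<delta> n < e / (128 * ?K)"
      using small[of "e / (128 * ?K)"] e K by (auto simp: eventually_sequentially)
    have Kd: "16 * ?K * \<delta> n < e / 8" using n(1) K by (simp add: field_simps)
    show "\<forall>\<^sub>F N in sequentially. L2norm2 {0..T} (\<lambda>t. V N t 1) < e"
      using trace_estimate[OF e8, of n] by eventually_elim (use Kd e in auto)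
  qed
  show ?thesis using nd c1 c2 by blast
qed

end

theorem theorem5:
  fixes a :: "real \<Rightarrow> real" and T :: real
    and w0 w1 :: "real \<Rightarrow> complex" and g :: "real \<Rightarrow> real \<Rightarrow> complex"
    and W V :: "nat \<Rightarrow> real \<Rightarrow> nat \<Rightarrow> complex"
    and w wx wt :: "real \<Rightarrow> real \<Rightarrow> complex"
  assumes a_cont: "continuous_on {0..1} a"
    and a_nonneg: "\<forall>x\<in>{0..1}. a x \<ge> 0"
    and T_pos: "T > 0"
    and w0_H10: "in_H10 w0"
    and w1_L2: "L2on {0..1} w1"
    and g_L2: "L2_time_space T g"
    and discrete: "\<forall>N\<ge>1. discrete_solution a T g w0 w1 N (W N) (V N)"
    and weak: "weak_solution a T g w0 w1 w wx wt"
  shows "\<exists>\<psi>. normal_derivative_at_0 a T g w wx wt \<psi>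
     \<and> (\<lambda>N. L2norm2 {0..T} (\<lambda>t. W N t 1 / complex_of_real (mesh N) - \<psi> t)) \<longlonglongrightarrow> 0
     \<and> (\<lambda>N. L2norm2 {0..T} (\<lambda>t. V N t 1)) \<longlonglongrightarrow> 0"
proof -
  \<comment> \<open>All Fubini arguments run with this representative; the conclusion still refers
    to the original \<open>g\<close>.\<close>
  obtain G where G: "L2prod T G" "AE t in lebesgue_on {0..T}. AE x in lebesgue_on {0..1}. g t x = G t x"
    using L2_time_space_representative[OF g_L2] .
  obtain A where A: "\<And>x. x \<in> {0..1} \<Longrightarrow> \<bar>a x\<bar> \<le> A"
    using compact_imp_bounded[OF compact_continuous_image[OF a_cont compact_Icc]]
    unfolding bounded_iff real_norm_def by blast
  interpret wave_approximation a T g G w0 w1 w wx wt W V A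
  proof
    show "0 \<le> a x \<and> a x \<le> A" if "x \<in> {0..1}" for x using A[OF that] a_nonneg that by auto
    show "discrete_solution a T g w0 w1 N (W N) (V N)" if "N \<ge> 1" for N using discrete that by blast
  qed (fact a_cont T_pos weak G w1_L2)+
  show ?thesis by (rule trace_convergence)
qed

end
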